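(* Let $p\ge2$ and $\frac p2\le r\le p$. If $\alpha=\alpha_C(p,r)$, then $\lambda_{\alpha_C}(p,r)$ admits both a positive minimizer and the minimizer $y(x)=\sin_p(\pi_p x)$, up to a multiplicative constant. Moreover, if $r>\frac p2$, any minimizer of $\lambda_{\alpha_C}(p,r)$ has constant sign or it is odd. Furthermore, if $r=p$, then $\alpha_C(p,p)=\frac{2^p-1}{2^p}\pi_p^p$.
   Context: For $\alpha\in\mathbb{R}$, $p\ge2$, $\frac p2\le r\le p$, and real-valued $u\in W_0^{1,p}(-1,1)$, $u\not\equiv0$, set $$\mathcal Q_\alpha[u]=\frac{\int_{-1}^1|u'|^p\,dx+\alpha\left|\int_{-1}^1|u|^{r-1}u\,dx\right|^{p/r}}{\int_{-1}^1|u|^p\,dx},\qquad \lambda_\alpha(p,r)=\inf\{\mathcal Q_\alpha[u]:u\in W_0^{1,p}(-1,1),\ u\not\equiv0\}.$$ A minimizer of $\lambda_\alpha(p,r)$ is a function $y\in W_0^{1,p}(-1,1)$, $y\not\equiv0$, with $\mathcal Q_\alpha[y]=\lambda_\alpha(p,r)$. $$\pi_p=2\int_0^{(p-1)^{1/p}}\frac{dt}{[1-t^p/(p-1)]^{1/p}}=2\pi\frac{(p-1)^{1/p}}{p\sin(\pi/p)}.$$ Let $F_p(x)=\int_0^x\frac{dt}{[1-t^p/(p-1)]^{1/p}}$ for $x\in[0,(p-1)^{1/p}]$ and let $z:[0,\pi_p/2]\to[0,(p-1)^{1/p}]$ be its inverse. The function $\sin_p$ is defined by $\sin_p(t)=z(t)$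 for $t\in[0,\pi_p/2]$, $\sin_p(t)=z(\pi_p-t)$ for $t\in[\pi_p/2,\pi_p]$, $\sin_p(t)=-\sin_p(-t)$ for $t\in[-\pi_p,0]$, and extended to $\mathbb{R}$ with period $2\pi_p$. The critical value $\alpha_C=\alpha_C(p,r)$ is the number $$\alpha_C=\min\{\alpha\in\mathbb{R}:\lambda_\alpha(p,r)=\pi_p^p\}=\sup\{\alpha\in\mathbb{R}:\lambda_\alpha(p,r)<\pi_p^p\},$$ which is positive; thus $\lambda_\alpha(p,r)<\pi_p^p$ for $\alpha<\alpha_C$ and $\lambda_\alpha(p,r)=\pi_p^p$ for $\alpha\ge\alpha_C$. *)

theory Defs
  imports "HOL-Analysis.Analysis"
begin

section \<open>The Sobolev space on the interval (-1, 1)\<close>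

text \<open>
  Elements of Lebesgue and Sobolev spaces are represented by functions \<open>real \<Rightarrow> real\<close> that are
  identified when they agree almost everywhere on the interval; values outside it are irrelevant.
\<close>

abbreviation I_open :: "real set" where
  "I_open \<equiv> {-1<..<1}"

definition test_function :: "(real \<Rightarrow> real) \<Rightarrow> bool" where
  "test_function \<phi> \<longleftrightarrow>
     (\<forall>k x. ((deriv ^^ k) \<phi>) differentiable (at x)) \<and>
     (\<exists>K. compact K \<and> K \<subseteq> I_open \<and> (\<forall>x. x \<notin> K \<longrightarrow> \<phi> x = 0))"

definition Lp_space :: "real \<Rightarrow> (real \<Rightarrow> real) set" where
  "Lp_space p = {u. u \<in> borel_measurable (lebesgue_on I_open) \<and>
                    integrable (lebesgue_on I_open) (\<lambda>x. \<bar>u x\<bar> powr p)}"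

definition locally_integrable :: "(real \<Rightarrow> real) \<Rightarrow> bool" where
  "locally_integrable u \<longleftrightarrow>
     (\<forall>K. compact K \<and> K \<subseteq> I_open \<longrightarrow> integrable (lebesgue_on K) u)"

definition has_weak_derivative :: "(real \<Rightarrow> real) \<Rightarrow> (real \<Rightarrow> real) \<Rightarrow> bool" where
  "has_weak_derivative u v \<longleftrightarrow>
     locally_integrable u \<and> locally_integrable v \<and>
     (\<forall>\<phi>. test_function \<phi> \<longrightarrow>
        (LINT x|lebesgue_on I_open. u x * deriv \<phi> x) = - (LINT x|lebesgue_on I_open. v x * \<phi> x))"

text \<open>A choice of representative: weak derivatives are unique up to null sets.\<close>

definition weak_deriv :: "(real \<Rightarrow> real) \<Rightarrow> real \<Rightarrow> real" where
  "weak_deriv u = (SOME v. has_weak_derivative u v)"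

definition W1p :: "real \<Rightarrow> (real \<Rightarrow> real) set" where
  "W1p p = {u \<in> Lp_space p. \<exists>v \<in> Lp_space p. has_weak_derivative u v}"

definition W1p_norm :: "real \<Rightarrow> (real \<Rightarrow> real) \<Rightarrow> real" where
  "W1p_norm p u =
     ((LINT x|lebesgue_on I_open. \<bar>u x\<bar> powr p) +
      (LINT x|lebesgue_on I_open. \<bar>weak_deriv u x\<bar> powr p)) powr (1 / p)"

definition W01p :: "real \<Rightarrow> (real \<Rightarrow> real) set" where
  "W01p p = {u \<in> W1p p. \<forall>\<epsilon>>0. \<exists>\<phi>. test_function \<phi> \<and> W1p_norm p (\<lambda>x. u x - \<phi> x) < \<epsilon>}"

definition nontrivial :: "(real \<Rightarrow> real) \<Rightarrow> bool" where
  "nontrivial u \<longleftrightarrow> \<not> (AE x in lebesgue_on I_open. u x = 0)"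

definition continuous_version :: "(real \<Rightarrow> real) \<Rightarrow> (real \<Rightarrow> real) \<Rightarrow> bool" where
  "continuous_version u w \<longleftrightarrow>
     continuous_on I_open w \<and> (AE x in lebesgue_on I_open. u x = w x)"

section \<open>The nonlocal Rayleigh quotient\<close>

definition Q_functional :: "real \<Rightarrow> real \<Rightarrow> real \<Rightarrow> (real \<Rightarrow> real) \<Rightarrow> real" where
  "Q_functional p r \<alpha> u =
     ((LINT x|lebesgue_on I_open. \<bar>weak_deriv u x\<bar> powr p) +
      \<alpha> * \<bar>LINT x|lebesgue_on I_open. \<bar>u x\<bar> powr (r - 1) * u x\<bar> powr (p / r)) /
     (LINT x|lebesgue_on I_open. \<bar>u x\<bar> powr p)"

text \<open>
  The infimum is finite for \<open>r \<le> p\<close>, also when \<open>\<alpha> < 0\<close>, since Hoelder's inequality bounds the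
  nonlocal term by a multiple of the denominator; so the real-valued infimum is the intended one.
\<close>

definition eigval :: "real \<Rightarrow> real \<Rightarrow> real \<Rightarrow> real" where
  "eigval p r \<alpha> = (INF u \<in> {u \<in> W01p p. nontrivial u}. Q_functional p r \<alpha> u)"

definition minimizer :: "real \<Rightarrow> real \<Rightarrow> real \<Rightarrow> (real \<Rightarrow> real) \<Rightarrow> bool" where
  "minimizer p r \<alpha> y \<longleftrightarrow>
     y \<in> W01p p \<and> nontrivial y \<and> Q_functional p r \<alpha> y = eigval p r \<alpha>"

section \<open>Generalized trigonometric functions\<close>

text \<open>
  At the upper endpoint \<open>t = (p - 1) powr (1 / p)\<close> the integrand is singular but integrable; its
  value there (0 by the convention \<open>1 / 0 = 0\<close>) does not matter.
\<close>

definition F_p :: "real \<Rightarrow> real \<Rightarrow> real" where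
  "F_p p x = integral {0..x} (\<lambda>t. 1 / (1 - t powr p / (p - 1)) powr (1 / p))"

definition pi_p :: "real \<Rightarrow> real" where
  "pi_p p = 2 * F_p p ((p - 1) powr (1 / p))"

definition z_p :: "real \<Rightarrow> real \<Rightarrow> real" where
  "z_p p = inv_into {0..(p - 1) powr (1 / p)} (F_p p)"

definition sin_p_half :: "real \<Rightarrow> real \<Rightarrow> real" where
  "sin_p_half p t = (if t \<le> pi_p p / 2 then z_p p t else z_p p (pi_p p - t))"

text \<open>
  The argument is reduced to \<open>s \<in> [-pi_p, pi_p)\<close> by subtracting a multiple of the period
  \<open>2 * pi_p\<close>; there the function is the odd extension of \<open>sin_p_half\<close> from \<open>[0, pi_p]\<close>.
\<close>

definition sin_p :: "real \<Rightarrow> real \<Rightarrow> real" where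
  "sin_p p t =
     (let s = t - 2 * pi_p p * of_int \<lfloor>(t + pi_p p) / (2 * pi_p p)\<rfloor>
      in if 0 \<le> s then sin_p_half p s else - sin_p_half p (- s))"

section \<open>The critical value\<close>

text \<open>\<open>LEAST\<close> denotes the minimum of the (infinite) set of admissible \<open>\<alpha>\<close>.\<close>

definition alpha_C :: "real \<Rightarrow> real \<Rightarrow> real" where
  "alpha_C p r = (LEAST \<alpha>. eigval p r \<alpha> = pi_p p powr p)"

end

theory Submission
  imports Defs "HOL-Real_Asymp.Real_Asymp"
begin

text \<open>
  Write \<open>L = \<pi>\<^sub>p\<^sup>p / (p - 1)\<close>, \<open>y\<^bsup>[r]\<^esup> = |y|\<^bsup>r-1\<^esup>y\<close> and \<open>K(y) = e - L|y|\<^sup>p + c y\<^bsup>[r]\<^esup>\<close>.  If \<open>K \<ge> 0\<close> on the range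
  \<open>[-n, m]\<close> of \<open>u\<close>, Young's inequality for \<open>|u'|\<close> against \<open>h(u) = K(u)\<^bsup>1/p\<^esup>\<close>, together with the fact that
  \<open>u\<close> travels from \<open>0\<close> to both extreme values and back, bounds
  \<open>\<integral>|u'|\<^sup>p - \<pi>\<^sub>p\<^sup>p \<integral>|u|\<^sup>p + (p - 1) c \<integral>u\<^bsup>[r]\<^esup>\<close> from below by
  \<open>G = 2p \<integral>\<^bsub>-n\<^esub>\<^bsup>m\<^esup> K\<^bsup>1-1/p\<^esup> dy - 2(p - 1) e\<close>, with equality only if \<open>|u'| = h(u)\<close>.

  For positive \<open>u\<close> the optimal choice is \<open>e = L - c\<^sub>0\<close>, \<open>c = c\<^sub>0\<close> with \<open>\<integral>\<^bsub>0\<^esub>\<^bsup>1\<^esup> K\<^bsup>-1/p\<^esup> dy = 1\<close>: then the solution of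
  \<open>w' = h(w)\<close> reaches its maximum at the midpoint, and it is the positive minimizer for the value
  \<open>\<alpha>\<^sub>0\<close> of \<open>\<alpha>\<close> for which \<open>c\<^sub>0\<close> is its Lagrange multiplier.  For sign-changing \<open>u\<close>, \<open>c\<close> is kept fixed by rescaling
  \<open>u\<close>, and \<open>dG/de = 2(p - 1)(T(e) - 1)\<close> where \<open>T(e) = \<integral> K\<^bsup>-1/p\<^esup> dy\<close> is taken over \<open>{K > 0}\<close>.  The substitution
  \<open>t = y (e / (e + c y\<^bsup>[r]\<^esup>))\<^bsup>1/p\<^esup>\<close> and a comparison of the integrands at \<open>t\<close> and \<open>-t\<close> give \<open>T \<ge> 1\<close> for
  \<open>p/2 \<le> r \<le> p\<close>, strictly for \<open>c \<noteq> 0\<close> and \<open>r > p/2\<close>.  Hence sign-changing functions are no better than the positive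
  ones, and \<open>\<alpha>\<^sub>0 = \<alpha>\<^sub>C\<close>.  In the case of equality, \<open>|u'| = h(u)\<close> leaves no time to idle: \<open>u\<close> is positive, or \<open>m = n\<close>
  and \<open>u\<close> is the odd profile.
\<close>

section \<open>Test functions\<close>

text \<open>\<open>K\<close> is a first integral: along solutions of the Euler-Lagrange equation of
  the linearized functional, |u'|^p = K(u). Linearizing is legitimate from below because the
  exponent p/r is at least 1: the nonlocal term lies above its tangent at the value s0 of the
  positive minimizer, and the slope of that tangent is (p - 1) c0. For c = c0 it cancels the linear
  term of the energy inequality exactly, hence the wish to keep c. With c fixed, K can vanish at
  both extreme values of u only after a rescaling by some t, which enters the equation through t^(p
  - r). So r = p and m = n are exceptional; there c itself is adjusted to balance the two ends, and
  the level e is compared with 0 in place of L - c0. Two obstacles shape the rest. Sobolev functions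
  are given up to null sets, so an absolutely continuous representative and a chain rule for it come
  before any argument about travelling. And K^(-1/p) is singular at the zeros of K, so the formula
  for dG/de is used in integrated form, through Tonelli's theorem with values in
  [0, \<infinity>].\<close>

lemma deriv_closed_imp_differentiable:
  fixes f :: "real \<Rightarrow> real"
  assumes S: "\<And>g. g \<in> S \<Longrightarrow> \<exists>g'\<in>S. \<forall>x. (g has_real_derivative g' x) (at x)" and f: "f \<in> S"
  shows "((deriv ^^ k) f) differentiable (at x)"
proof -
  have d: "deriv g \<in> S \<and> g differentiable (at x)" if g: "g \<in> S" for g x
  proof -
    obtain g' where g': "g' \<in> S" "\<And>x. (g has_real_derivative g' x) (at x)"
      using S[OF g] by blast
    then have "deriv g = g'" by (auto simp: fun_eq_iff intro!: DERIV_imp_deriv)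
    with g' show ?thesis by (auto simp: real_differentiable_def)
  qed
  have "(deriv ^^ k) f \<in> S" by (induction k) (use d f in auto)
  with d show ?thesis by blast
qed

text \<open>Differentiation preserves the form and replaces \<open>P t\<close> by
  \<open>t\<^sup>2 * (P t - P' t)\<close>. Admitting every polynomial \<open>P\<close>, and not only
  the constant 1, therefore gives a family closed under derivatives.\<close>

definition flat :: "(real \<Rightarrow> real) \<Rightarrow> real \<Rightarrow> real" where
  "flat P x = (if x > 0 then P (1 / x) * exp (- (1 / x)) else 0)"

lemma polynomial_times_exp_tendsto_0:
  assumes "real_polynomial_function P"
  shows "((\<lambda>t. P t * exp (- t)) \<longlongrightarrow> 0) at_top"
proof -
  obtain a n where P: "P = (\<lambda>x. \<Sum>i\<le>n. a i * x ^ i)"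
    using assms by (auto simp: real_polynomial_function_iff_sum)
  have "((\<lambda>t::real. \<Sum>i\<le>n. a i * (t ^ i / exp t)) \<longlongrightarrow> (\<Sum>i\<le>n. a i * 0)) at_top"
    by (intro tendsto_intros tendsto_power_div_exp_0)
  moreover have "(\<lambda>t::real. \<Sum>i\<le>n. a i * (t ^ i / exp t)) = (\<lambda>t. P t * exp (- t))"
    by (simp add: P exp_minus field_simps sum_distrib_right sum_divide_distrib fun_eq_iff)
  ultimately show ?thesis by simp
qed

lemma flat_tendsto_0:
  assumes "real_polynomial_function P"
  shows "(flat P \<longlongrightarrow> 0) (at 0)"
proof -
  have "((\<lambda>x. P (inverse x) * exp (- inverse x)) \<longlongrightarrow> 0) (at_right 0)"
    using filterlim_compose[OF polynomial_times_exp_tendsto_0[OF assms] filterlim_inverse_at_top_right]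
    by simp
  then have "(flat P \<longlongrightarrow> 0) (at_right 0)"
    by (rule Lim_transform_eventually)
      (auto simp: flat_def inverse_eq_divide eventually_at_filter)
  moreover have "(flat P \<longlongrightarrow> 0) (at_left 0)"
    by (rule tendsto_eventually) (auto simp: flat_def eventually_at_filter)
  ultimately show ?thesis by (simp add: filterlim_split_at)
qed

lemma flat_has_derivative:
  assumes P: "real_polynomial_function P" and dP: "\<And>x. (P has_real_derivative P' x) (at x)"
  shows "(flat P has_real_derivative flat (\<lambda>t. t\<^sup>2 * (P t - P' t)) x) (at x)"
proof -
  consider "x > 0" | "x < 0" | "x = 0" by linarith
  then show ?thesis
  proof cases
    case 1
    have "((\<lambda>x. P (1 / x) * exp (- (1 / x))) has_real_derivative
        flat (\<lambda>t. t\<^sup>2 * (P t - P' t)) x) (at x)"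
      using 1 by (auto intro!: derivative_eq_intros DERIV_chain2[OF dP]
          simp: flat_def field_simps power2_eq_square)
    then show ?thesis
      by (rule has_field_derivative_transform_within_open[where S = "{0<..}"])
        (use 1 in \<open>auto simp: flat_def\<close>)
  next
    case 2
    have "((\<lambda>x. 0) has_real_derivative flat (\<lambda>t. t\<^sup>2 * (P t - P' t)) x) (at x)"
      using 2 by (auto simp: flat_def)
    then show ?thesis
      by (rule has_field_derivative_transform_within_open[where S = "{..<0}"])
        (use 2 in \<open>auto simp: flat_def\<close>)
  next
    case 3
    \<comment> \<open>At 0 the difference quotient of \<open>flat P\<close> is \<open>flat\<close>
      of the polynomial \<open>t * P t\<close>, which again tends to 0.\<close>
    have "real_polynomial_function (\<lambda>t. t * P t)"
      using P by (intro real_polynomial_function.intros(4)) (auto intro: real_polynomial_function.intros(1) bounded_linear_ident)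
    from flat_tendsto_0[OF this] have "((\<lambda>h. (flat P h - flat P 0) / (h - 0)) \<longlongrightarrow> 0) (at 0)"
      by (rule Lim_transform_eventually) (auto simp: flat_def eventually_at_filter)
    then show ?thesis
      using 3 by (simp add: has_field_derivative_iff flat_def)
  qed
qed

text \<open>Closed under differentiation, so all members have derivatives of every order. Affine
  arguments of \<open>flat\<close> supply cutoffs for both ends of an interval, and products allow
  polynomials to be cut off.\<close>

inductive_set smooth_algebra :: "(real \<Rightarrow> real) set" where
  poly: "real_polynomial_function q \<Longrightarrow> q \<in> smooth_algebra"
| flat: "real_polynomial_function P \<Longrightarrow> (\<lambda>x. flat P (a * x + b)) \<in> smooth_algebra"
| add: "f \<in> smooth_algebra \<Longrightarrow> g \<in> smooth_algebra \<Longrightarrow> (\<lambda>x. f x + g x) \<in> smooth_algebra"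
| mult: "f \<in> smooth_algebra \<Longrightarrow> g \<in> smooth_algebra \<Longrightarrow> (\<lambda>x. f x * g x) \<in> smooth_algebra"

lemma smooth_algebra_deriv:
  "f \<in> smooth_algebra \<Longrightarrow> \<exists>f'\<in>smooth_algebra. \<forall>x. (f has_real_derivative f' x) (at x)"
proof (induction rule: smooth_algebra.induct)
  case (poly q)
  then show ?case
    using has_real_derivative_polynomial_function smooth_algebra.poly by blast
next
  case (flat P a b)
  obtain P' where P': "real_polynomial_function P'" "\<And>x. (P has_real_derivative P' x) (at x)"
    using has_real_derivative_polynomial_function[OF flat] by blast
  have r: "real_polynomial_function (\<lambda>t. t\<^sup>2 * (P t - P' t))"
    using flat P'
    by (intro real_polynomial_function.intros(4) real_polynomial_function_power
        real_polynomial_function_diff real_polynomial_function.intros(1)[OF bounded_linear_ident])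
  have "((\<lambda>x. flat P (a * x + b)) has_real_derivative
      a * flat (\<lambda>t. t\<^sup>2 * (P t - P' t)) (a * x + b)) (at x)" for x
  proof -
    have "((\<lambda>x. a * x + b) has_real_derivative a) (at x)" by (auto intro!: derivative_eq_intros)
    from DERIV_chain2[OF flat_has_derivative[OF flat P'(2)] this] show ?thesis
      by (simp add: mult.commute)
  qed
  moreover have "(\<lambda>x. a * flat (\<lambda>t. t\<^sup>2 * (P t - P' t)) (a * x + b)) \<in> smooth_algebra"
    using smooth_algebra.mult[OF smooth_algebra.poly smooth_algebra.flat[OF r], of "\<lambda>x. a"]
    by (simp add: real_polynomial_function.intros(2))
  ultimately show ?case by (intro bexI allI)
next
  case (add f g)
  then obtain f' g' where "f' \<in> smooth_algebra" "g' \<in> smooth_algebra"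
    "\<And>x. (f has_real_derivative f' x) (at x)" "\<And>x. (g has_real_derivative g' x) (at x)" by blast
  then show ?case
    by (intro bexI[of _ "\<lambda>x. f' x + g' x"]) (auto intro: derivative_intros smooth_algebra.add)
next
  case (mult f g)
  then obtain f' g' where "f' \<in> smooth_algebra" "g' \<in> smooth_algebra"
    "\<And>x. (f has_real_derivative f' x) (at x)" "\<And>x. (g has_real_derivative g' x) (at x)" by blast
  then show ?case using mult
    by (intro bexI[of _ "\<lambda>x. f' x * g x + g' x * f x"])
      (auto intro!: derivative_eq_intros smooth_algebra.add smooth_algebra.mult)
qed

lemma smooth_algebra_continuous: "f \<in> smooth_algebra \<Longrightarrow> continuous_on S f"
  using smooth_algebra_deriv DERIV_continuous_on has_field_derivative_at_within by metis

lemma smooth_algebra_diff_const: "f \<in> smooth_algebra \<Longrightarrow> (\<lambda>x. f x - c) \<in> smooth_algebra"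
  using smooth_algebra.add[OF _ smooth_algebra.poly, of f "\<lambda>x. - c"]
  by (simp add: real_polynomial_function.intros(2))

abbreviation "flat1 \<equiv> flat (\<lambda>_. 1)"

lemma flat1_bounds: "0 \<le> flat1 x" "flat1 x \<le> 1" "x \<le> 0 \<Longrightarrow> flat1 x = 0" "x > 0 \<Longrightarrow> flat1 x > 0"
  by (auto simp: flat_def)

lemma flat1_tendsto_1: "(flat1 \<longlongrightarrow> 1) at_top"
proof -
  have "((\<lambda>x::real. exp (- (1 / x))) \<longlongrightarrow> exp (- 0)) at_top"
    by (intro tendsto_intros tendsto_divide_0[OF tendsto_const] filterlim_at_top_imp_at_infinity filterlim_ident)
  then have "((\<lambda>x::real. exp (- (1 / x))) \<longlongrightarrow> 1) at_top" by simp
  then show ?thesis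
    by (rule Lim_transform_eventually)
      (use eventually_gt_at_top[of 0] in eventually_elim, auto simp: flat_def)
qed

text \<open>A cutoff for [a, b] without a plateau: its values stay below 1 and tend to 1 inside the
  interval as the steepness \<open>k\<close> grows, which suits dominated convergence.\<close>

definition bump :: "nat \<Rightarrow> real \<Rightarrow> real \<Rightarrow> real \<Rightarrow> real" where
  "bump k a b x = flat1 (k * (x - a)) * flat1 (k * (b - x))"

lemma bump_bounds: "0 \<le> bump k a b x" "bump k a b x \<le> 1" "x \<notin> {a..b} \<Longrightarrow> bump k a b x = 0"
proof -
  show "bump k a b x \<le> 1" unfolding bump_def by (intro mult_le_one flat1_bounds)
  show "bump k a b x = 0" if "x \<notin> {a..b}"
    using that by (auto simp: bump_def not_le mult_nonneg_nonpos intro!: flat1_bounds)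
qed (simp add: bump_def flat1_bounds)

lemma bump_smooth: "bump k a b \<in> smooth_algebra"
proof -
  have "(\<lambda>x. flat1 (real k * x + real k * (- a)) * flat1 (- real k * x + real k * b)) \<in> smooth_algebra"
    by (intro smooth_algebra.mult smooth_algebra.flat real_polynomial_function.intros(2))
  moreover have "bump k a b =
      (\<lambda>x. flat1 (real k * x + real k * (- a)) * flat1 (- real k * x + real k * b))"
    by (auto simp: bump_def fun_eq_iff algebra_simps)
  ultimately show ?thesis by simp
qed

lemma bump_tendsto_1:
  assumes "\<And>k. a k \<le> c" "\<And>k. d \<le> b k" "c < x" "x < d"
  shows "(\<lambda>k. bump k (a k) (b k) x) \<longlonglongrightarrow> 1"
proof -
  have *: "filterlim (\<lambda>k. real k * f k) at_top sequentially" if "\<And>k. e \<le> f k" "e > 0" for e f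
  proof (rule filterlim_at_top_mono)
    show "filterlim (\<lambda>k. e * real k) at_top sequentially"
      by (intro filterlim_tendsto_pos_mult_at_top[OF tendsto_const that(2)] filterlim_real_sequentially)
    show "\<forall>\<^sub>F k in sequentially. e * real k \<le> real k * f k"
      using that by (auto simp: mult.commute[of e] intro!: always_eventually mult_left_mono) (simp add: less_imp_le)?
  qed
  have "(\<lambda>k. flat1 (k * (x - a k)) * flat1 (k * (b k - x))) \<longlonglongrightarrow> 1 * 1"
    by (intro tendsto_mult filterlim_compose[OF flat1_tendsto_1] *[of "x - c"] *[of "d - x"])
      (use assms in \<open>auto simp: algebra_simps intro: diff_left_mono\<close>)
  then show ?thesis by (simp add: bump_def)
qed

lemma test_function_smooth_algebra:
  assumes "f \<in> smooth_algebra" "\<And>x. x \<notin> {a..b} \<Longrightarrow> f x = 0" "-1 < a" "b < 1"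
  shows "test_function f"
  unfolding test_function_def
  using deriv_closed_imp_differentiable[OF smooth_algebra_deriv assms(1)] assms(2-)
  by (auto intro!: exI[of _ "{a..b}"])

lemma test_functionD:
  assumes "test_function f"
  shows "(f has_real_derivative deriv f x) (at x)" "continuous_on S (deriv f)" "continuous_on S f"
    "x \<notin> I_open \<Longrightarrow> f x = 0"
proof -
  have d: "f differentiable (at x)" "deriv f differentiable (at x)" for x
    using assms[unfolded test_function_def, THEN conjunct1, rule_format, of 0 x]
      assms[unfolded test_function_def, THEN conjunct1, rule_format, of 1 x] by auto
  then show "(f has_real_derivative deriv f x) (at x)" for x
    by (simp add: DERIV_deriv_iff_real_differentiable)
  show "continuous_on S (deriv f)" "continuous_on S f"
    using d by (auto intro!: continuous_at_imp_continuous_on differentiable_imp_continuous_within)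
  show "x \<notin> I_open \<Longrightarrow> f x = 0"
    using assms unfolding test_function_def by blast
qed

text \<open>Zero mean is what makes the primitive vanish to the right of the support of
  \<open>f\<close>; to the left it vanishes by construction.\<close>

lemma test_function_primitive:
  assumes f: "f \<in> smooth_algebra" and z: "\<And>x. x \<notin> {a..b} \<Longrightarrow> f x = 0" and ab: "-1 < a" "a \<le> b" "b < 1"
    and int: "integral {-1..1} f = 0"
  shows "\<exists>\<phi>. test_function \<phi> \<and> deriv \<phi> = f"
proof -
  \<comment> \<open>Starting at -2 makes the support of \<open>f\<close> interior to {-2..2}, so the
    derivative of the integral is two-sided there.\<close>
  define \<phi> where "\<phi> x = integral {-2..x} f" for x
  have cont: "continuous_on S f" for S by (rule smooth_algebra_continuous[OF f])
  then have intg: "f integrable_on {s..t}" for s t by (rule integrable_continuous_real)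
  have z': "integral {s..t} f = 0" if "t < a \<or> b < s" for s t
    by (rule integral_unique, rule has_integral_is_0) (use that z in auto)
  have out: "\<phi> x = 0" if x: "x < a \<or> x > b" for x
  proof -
    consider "x < a" | "x > b" "x \<ge> a" using x by fastforce
    then show ?thesis
    proof cases
      case 1 then show ?thesis by (simp add: \<phi>_def z')
    next
      case 2
      have "integral {-2..x} f = integral {-2..b} f + integral {b..x} f"
        using 2 ab by (intro Henstock_Kurzweil_Integration.integral_combine[symmetric] intg) auto
      moreover have "integral {b..x} f = 0"
      proof (rule integral_unique, rule has_integral_spike_finite[of "{b}"])
        show "((\<lambda>x. 0) has_integral 0) {b..x}" by simp
      qed (use z in auto)
      moreover have "integral {b..1} f = 0"
      proof (rule integral_unique, rule has_integral_spike_finite[of "{b}"])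
        show "((\<lambda>x. 0) has_integral 0) {b..1}" by simp
      qed (use z in auto)
      moreover have "integral {-2..-1} f = 0" using ab by (intro z') auto
      moreover have "integral {-2..-1} f + integral {-1..b} f = integral {-2..b} f"
        "integral {-1..b} f + integral {b..1} f = integral {-1..1} f"
        using ab by (auto intro!: Henstock_Kurzweil_Integration.integral_combine intg)
      ultimately show ?thesis using int by (simp add: \<phi>_def)
    qed
  qed
  have "(\<phi> has_real_derivative f x) (at x)" for x
  proof (cases "x \<in> {-2<..<2}")
    case True
    have "(\<phi> has_real_derivative f x) (at x within {-2..2})"
      unfolding \<phi>_def using True by (intro integral_has_real_derivative cont) auto
    then show ?thesis using True by (simp add: at_within_Icc_at)
  next
    case False
    have "((\<lambda>x. 0) has_real_derivative f x) (at x)" using False ab z by auto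
    then show ?thesis
      by (rule has_field_derivative_transform_within_open[where S = "{..<a} \<union> {b<..}"])
        (use False ab out in auto)
  qed
  then have d: "\<And>x. (\<phi> has_real_derivative f x) (at x)" .
  have "((deriv ^^ k) \<phi>) differentiable (at x)" for k x
    \<comment> \<open>The primitive is adjoined to the family; its derivative \<open>f\<close> lies
      in \<open>smooth_algebra\<close>, which is all that closure asks of it.\<close>
    by (rule deriv_closed_imp_differentiable[of "insert \<phi> smooth_algebra"])
      (use d f smooth_algebra_deriv in blast)+
  moreover have "deriv \<phi> = f" using d by (auto simp: fun_eq_iff intro!: DERIV_imp_deriv)
  ultimately show ?thesis
    unfolding test_function_def using out ab
    by (intro exI[of _ \<phi>]) (auto intro!: exI[of _ "{a..b}"])
qed

section \<open>Weak derivatives\<close>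

text \<open>The positive and negative parts of a Borel representative \<open>g\<close> are densities
  of two measures that agree on all half lines, hence agree. Uniqueness of densities gives
  \<open>ennreal (g x) = ennreal (- g x)\<close>, and since \<open>ennreal\<close> clips negative
  values to 0, both parts vanish.\<close>

lemma integral_Ioi_zero_imp_AE_zero:
  fixes f :: "real \<Rightarrow> real"
  assumes f: "integrable lebesgue f"
    and 0: "\<And>t. (LINT x|lebesgue. indicator {t<..} x * f x) = 0"
  shows "AE x in lebesgue. f x = 0"
proof -
  obtain g where g[measurable]: "g \<in> borel_measurable lborel" and fg: "AE x in lborel. f x = g x"
    using completion_ex_borel_measurable_real[OF borel_measurable_integrable[OF f]] by blast
  have fg': "AE x in lebesgue. f x = g x" using fg by (rule AE_completion)
  have "integrable lebesgue g"
    using f fg' by (subst integrable_cong_AE[of g _ f]) (auto simp: measurable_completion)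
  then have ig: "integrable lborel g" by (simp add: integrable_completion)
  have eq: "emeasure (density lborel (\<lambda>x. ennreal (g x))) {t<..} =
      emeasure (density lborel (\<lambda>x. ennreal (- g x))) {t<..} \<and>
      emeasure (density lborel (\<lambda>x. ennreal (g x))) {t<..} < \<infinity>" for t
  proof -
    let ?h = "\<lambda>x. indicator {t<..} x * g x"
    have ih: "integrable lborel ?h"
      using integrable_real_mult_indicator[OF _ ig, of "{t<..}"] by (simp add: mult.commute)
    have "0 = (LINT x|lebesgue. ?h x)"
      unfolding 0[of t, symmetric]
    proof (rule integral_cong_AE)
      show "(\<lambda>x. indicator {t<..} x * f x) \<in> borel_measurable lebesgue"
        using f by (intro borel_measurable_times borel_measurable_indicator) auto
      show "AE x in lebesgue. indicator {t<..} x * f x = indicator {t<..} x * g x"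
        using fg' by eventually_elim simp
    qed (auto intro!: measurable_completion)
    also have "\<dots> = (LINT x|lborel. ?h x)" by (simp add: integral_completion)
    also have "\<dots> = enn2real (\<integral>\<^sup>+x. ?h x \<partial>lborel) - enn2real (\<integral>\<^sup>+x. - ?h x \<partial>lborel)"
      by (rule real_lebesgue_integral_def[OF ih])
    finally have "enn2real (\<integral>\<^sup>+x. ?h x \<partial>lborel) = enn2real (\<integral>\<^sup>+x. - ?h x \<partial>lborel)" by simp
    moreover have "(\<integral>\<^sup>+x. ?h x \<partial>lborel) < \<infinity>" "(\<integral>\<^sup>+x. - ?h x \<partial>lborel) < \<infinity>"
      using ih by (auto simp: real_integrable_def less_top)
    ultimately have "(\<integral>\<^sup>+x. ?h x \<partial>lborel) = (\<integral>\<^sup>+x. - ?h x \<partial>lborel)"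
      by (metis ennreal_enn2real infinity_ennreal_def)
    moreover have "emeasure (density lborel (\<lambda>x. ennreal (g x))) {t<..} = (\<integral>\<^sup>+x. ?h x \<partial>lborel)"
      "emeasure (density lborel (\<lambda>x. ennreal (- g x))) {t<..} = (\<integral>\<^sup>+x. - ?h x \<partial>lborel)"
      by (auto simp: emeasure_density indicator_def intro!: nn_integral_cong)
    ultimately show ?thesis using \<open>(\<integral>\<^sup>+x. ?h x \<partial>lborel) < \<infinity>\<close> by simp
  qed
  then have "density lborel (\<lambda>x. ennreal (g x)) = density lborel (\<lambda>x. ennreal (- g x))"
  proof (intro measure_eqI_lessThan)
    show "emeasure (density lborel (\<lambda>x. ennreal (g x))) {t<..} =
      emeasure (density lborel (\<lambda>x. ennreal (- g x))) {t<..}" for t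
      using eq[of t] by blast
  qed (use eq in auto)
  then have "AE x in lborel. ennreal (g x) = ennreal (- g x)"
    by (intro sigma_finite_measure.density_unique[OF sigma_finite_lborel]) auto
  then have "AE x in lborel. g x = 0"
  proof eventually_elim
    case (elim x)
    then show ?case
      by (cases "g x \<ge> 0") (auto simp: ennreal_neg ennreal_eq_0_iff dest: sym)
  qed
  then have "AE x in lebesgue. g x = 0" by (rule AE_completion)
  with fg' show ?thesis by eventually_elim simp
qed

lemma AE_I_open_iff: "(AE x in lebesgue_on I_open. P x) \<longleftrightarrow> (AE x in lebesgue. x \<in> I_open \<longrightarrow> P x)"
  by (simp add: AE_restrict_space_iff)

lemma compact_subset_I_open:
  assumes "compact K" "K \<subseteq> I_open"
  obtains a b where "-1 < a" "a \<le> b" "b < 1" "K \<subseteq> {a..b}"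
proof (cases "K = {}")
  case True
  show ?thesis by (rule that[of 0 0]) (auto simp: True)
next
  case False
  obtain a b where "a \<in> K" "b \<in> K" "\<forall>x\<in>K. a \<le> x" "\<forall>x\<in>K. x \<le> b"
    using compact_attains_inf[OF assms(1) False] compact_attains_sup[OF assms(1) False] by blast
  with assms show ?thesis by (intro that[of a b]) auto
qed

lemma locally_integrableD:
  assumes "locally_integrable d" "-1 < a" "b < 1"
  shows "d absolutely_integrable_on {a..b}"
proof -
  have "integrable (lebesgue_on {a..b}) d"
    using assms(1)[unfolded locally_integrable_def, rule_format, of "{a..b}"] assms(2,3)
    by (auto simp: subset_eq)
  then show ?thesis
    by (simp add: integrable_restrict_space set_integrable_def)
qed

lemma locally_integrableI:
  assumes "d absolutely_integrable_on I_open"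
  shows "locally_integrable d"
  unfolding locally_integrable_def
proof (intro allI impI)
  fix K :: "real set" assume K: "compact K \<and> K \<subseteq> I_open"
  then have "K \<in> sets lebesgue" by (simp add: borel_compact)
  then show "integrable (lebesgue_on K) d"
    using K set_integrable_subset[OF assms] absolutely_integrable_imp_integrable by blast
qed

lemma LINT_I_open_mult:
  assumes d: "locally_integrable d" and \<phi>: "continuous_on UNIV \<phi>" "\<And>x. x \<notin> {a..b} \<Longrightarrow> \<phi> x = (0::real)"
    and ab: "-1 < a" "b < 1"
  shows "(\<lambda>x. d x * \<phi> x) absolutely_integrable_on {a..b}"
    "(LINT x|lebesgue_on I_open. d x * \<phi> x) = integral {a..b} (\<lambda>x. d x * \<phi> x)"
    "integrable (lebesgue_on I_open) (\<lambda>x. d x * \<phi> x)"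
proof -
  have bd: "bounded (\<phi> ` {a..b})"
    by (intro compact_imp_bounded compact_continuous_image continuous_on_subset[OF \<phi>(1)]) auto
  have "\<phi> \<in> borel_measurable (lebesgue_on {a..b})"
    by (intro continuous_imp_measurable_on_sets_lebesgue continuous_on_subset[OF \<phi>(1)]) auto
  with bd have "(\<lambda>x. \<phi> x * d x) absolutely_integrable_on {a..b}"
    by (intro absolutely_integrable_bounded_measurable_product_real locally_integrableD[OF d ab]) auto
  then show i: "(\<lambda>x. d x * \<phi> x) absolutely_integrable_on {a..b}" by (simp add: mult.commute)
  have e: "(\<lambda>x. indicator I_open x *\<^sub>R (d x * \<phi> x)) = (\<lambda>x. indicator {a..b} x *\<^sub>R (d x * \<phi> x))"
    using \<phi>(2) ab by (force simp: indicator_def fun_eq_iff)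
  have "(LINT x|lebesgue_on I_open. d x * \<phi> x) = set_lebesgue_integral lebesgue {a..b} (\<lambda>x. d x * \<phi> x)"
    by (simp add: integral_restrict_space set_lebesgue_integral_def e[simplified])
  with i show "(LINT x|lebesgue_on I_open. d x * \<phi> x) = integral {a..b} (\<lambda>x. d x * \<phi> x)"
    by (simp add: set_lebesgue_integral_eq_integral)
  show "integrable (lebesgue_on I_open) (\<lambda>x. d x * \<phi> x)"
    using i by (simp add: integrable_restrict_space set_integrable_def e[simplified])
qed

text \<open>The fundamental lemma of the calculus of variations. Bumps on [a, b] tend to the
  indicator of the open interval and are bounded by 1, so the integral of \<open>d\<close> over
  every compact subinterval vanishes; the criterion with half lines then applies to \<open>d\<close>
  cut off to [a, b].\<close>

lemma weakly_zero_imp_AE_zero: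
  assumes d: "locally_integrable d"
    and 0: "\<And>\<phi>. test_function \<phi> \<Longrightarrow> (LINT x|lebesgue_on I_open. d x * \<phi> x) = 0"
  shows "AE x in lebesgue_on I_open. d x = 0"
proof -
  have int0: "integral {a..b} d = 0" if ab: "-1 < a" "b < 1" for a b
  proof -
    note id = locally_integrableD[OF d ab]
    have b0: "integral {a..b} (\<lambda>x. d x * bump k a b x) = 0" for k
      using 0[OF test_function_smooth_algebra[OF bump_smooth bump_bounds(3)[where a = a and b = b] ab], of k]
        LINT_I_open_mult(2)[OF d smooth_algebra_continuous[OF bump_smooth] bump_bounds(3)[where a = a and b = b] ab, of k]
      by simp
    have "(\<lambda>k. integral {a<..<b} (\<lambda>x. d x * bump k a b x)) \<longlonglongrightarrow> integral {a<..<b} d"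
    proof (rule dominated_convergence(2)[where h = "\<lambda>x. \<bar>d x\<bar>"])
      show "(\<lambda>x. d x * bump k a b x) integrable_on {a<..<b}" for k
        using LINT_I_open_mult(1)[OF d smooth_algebra_continuous[OF bump_smooth] bump_bounds(3)[where a = a and b = b] ab, of k]
        by (simp add: integrable_on_open_interval_real set_lebesgue_integral_eq_integral)
      show "(\<lambda>x. \<bar>d x\<bar>) integrable_on {a<..<b}"
        using id absolutely_integrable_on_def[of "{a..b}" d] by (simp add: integrable_on_open_interval_real)
      show "norm (d x * bump k a b x) \<le> \<bar>d x\<bar>" for k x
        using bump_bounds[where k = k and a = a and b = b and x = x] by (simp add: abs_mult mult_left_le)
      show "(\<lambda>k. d x * bump k a b x) \<longlonglongrightarrow> d x" if "x \<in> {a<..<b}" for x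
        using tendsto_mult[OF tendsto_const bump_tendsto_1[of "\<lambda>_. a" a b "\<lambda>_. b" x], of "d x"] that by simp
    qed
    then show ?thesis using b0 by (simp add: integral_open_interval_real LIMSEQ_const_iff)
  qed
  have "AE x in lebesgue. x \<in> {a..b} \<longrightarrow> d x = 0" if ab: "-1 < a" "b < 1" for a b
  proof -
    note id = locally_integrableD[OF d ab]
    have "AE x in lebesgue. indicator {a..b} x * d x = 0"
    proof (rule integral_Ioi_zero_imp_AE_zero)
      show i: "integrable lebesgue (\<lambda>x. indicator {a..b} x * d x)"
        using id by (simp add: set_integrable_def)
      fix t
      have "-1 < max t a" using ab by simp
      note id' = locally_integrableD[OF d this ab(2)]
      have "AE x in lebesgue. x \<noteq> t" by (intro AE_completion AE_lborel_singleton)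
      then have "AE x in lebesgue. indicator {t<..} x * (indicator {a..b} x * d x) = indicator {max t a..b} x * d x"
        by eventually_elim (auto simp: indicator_def)
      then have "(LINT x|lebesgue. indicator {t<..} x * (indicator {a..b} x * d x)) =
         (LINT x|lebesgue. indicator {max t a..b} x * d x)"
      proof (rule integral_cong_AE[rotated 2])
        show "(\<lambda>x. indicator {t<..} x * (indicator {a..b} x * d x)) \<in> borel_measurable lebesgue"
          by (intro borel_measurable_times borel_measurable_indicator borel_measurable_integrable[OF i]) simp
        show "(\<lambda>x. indicator {max t a..b} x * d x) \<in> borel_measurable lebesgue"
          using borel_measurable_integrable[OF id'[unfolded set_integrable_def]] by simp
      qed
      also have "\<dots> = integral {max t a..b} d"
        using id' by (simp add: set_lebesgue_integral_eq_integral(2)[symmetric] set_lebesgue_integral_def)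
      finally show "(LINT x|lebesgue. indicator {t<..} x * (indicator {a..b} x * d x)) = 0"
        using int0[of "max t a" b] ab by simp
    qed
    then show ?thesis by eventually_elim (auto simp: indicator_def split: if_splits)
  qed
  then have "AE x in lebesgue. \<forall>n. x \<in> {-1 + 1 / Suc n .. 1 - 1 / Suc n} \<longrightarrow> d x = 0"
    by (subst AE_all_countable) (auto simp del: of_nat_Suc)
  then show ?thesis unfolding AE_I_open_iff
  proof eventually_elim
    case (elim x)
    show ?case
    proof
      assume x: "x \<in> I_open"
      then obtain n where "inverse (real (Suc n)) < min (x + 1) (1 - x)"
        using reals_Archimedean[of "min (x + 1) (1 - x)"] by auto
      then have "x \<in> {-1 + 1 / Suc n .. 1 - 1 / Suc n}" by (simp add: inverse_eq_divide del: of_nat_Suc)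
      with elim show "d x = 0" by blast
    qed
  qed
qed

lemma integrable_I_open_iff:
  fixes f :: "real \<Rightarrow> real"
  shows "integrable (lebesgue_on I_open) f \<longleftrightarrow> f absolutely_integrable_on {-1..1}"
  using absolutely_integrable_on_Icc_iff_Ioo[of "-1" 1 f]
  by (simp add: integrable_restrict_space set_integrable_def)

lemma LINT_I_open_eq:
  fixes f :: "real \<Rightarrow> real"
  assumes "f absolutely_integrable_on {-1..1}"
  shows "(LINT x|lebesgue_on I_open. f x) = integral {-1..1} f"
  using assms lebesgue_integral_eq_integral[where f = f and S = I_open]
  by (simp add: integrable_I_open_iff integral_open_interval_real)

text \<open>Makes the choice in \<open>weak_deriv\<close> harmless: integrals that involve it may be
  computed with any weak derivative at hand.\<close>

lemma has_weak_derivative_AE_unique: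
  assumes "has_weak_derivative u v1" "has_weak_derivative u v2"
  shows "AE x in lebesgue_on I_open. v1 x = v2 x"
proof -
  have v: "locally_integrable v1" "locally_integrable v2"
    using assms by (auto simp: has_weak_derivative_def)
  have "AE x in lebesgue_on I_open. v1 x - v2 x = 0"
  proof (rule weakly_zero_imp_AE_zero)
    show "locally_integrable (\<lambda>x. v1 x - v2 x)"
      using v by (auto simp: locally_integrable_def intro!: Bochner_Integration.integrable_diff)
    fix \<phi> assume t: "test_function \<phi>"
    then obtain K where K: "compact K" "K \<subseteq> I_open" "\<And>x. x \<notin> K \<Longrightarrow> \<phi> x = 0"
      unfolding test_function_def by blast
    obtain a b where ab: "-1 < a" "b < 1" "K \<subseteq> {a..b}" by (rule compact_subset_I_open[OF K(1,2)])
    then have z: "x \<notin> {a..b} \<Longrightarrow> \<phi> x = 0" for x using K(3) by blast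
    note c = test_functionD(3)[OF t, of UNIV]
    have "(LINT x|lebesgue_on I_open. (v1 x - v2 x) * \<phi> x) =
        (LINT x|lebesgue_on I_open. v1 x * \<phi> x) - (LINT x|lebesgue_on I_open. v2 x * \<phi> x)"
      unfolding left_diff_distrib
      by (intro Bochner_Integration.integral_diff LINT_I_open_mult(3)[OF _ c z ab(1,2)] v)
    also have "\<dots> = 0" using assms t by (simp add: has_weak_derivative_def)
    finally show "(LINT x|lebesgue_on I_open. (v1 x - v2 x) * \<phi> x) = 0" .
  qed
  then show ?thesis by simp
qed

text \<open>In the definition of \<open>W01p\<close> the norm applies \<open>weak_deriv\<close> to a
  difference \<open>u - \<phi>\<close>; this identifies the result with the difference of the
  derivatives.\<close>

lemma has_weak_derivative_diff:
  assumes "has_weak_derivative u v" "has_weak_derivative u' v'"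
  shows "has_weak_derivative (\<lambda>x. u x - u' x) (\<lambda>x. v x - v' x)"
proof -
  have l: "locally_integrable u" "locally_integrable v" "locally_integrable u'" "locally_integrable v'"
    using assms by (auto simp: has_weak_derivative_def)
  show ?thesis unfolding has_weak_derivative_def
  proof (intro conjI allI impI)
    show "locally_integrable (\<lambda>x. u x - u' x)" "locally_integrable (\<lambda>x. v x - v' x)"
      using l by (auto simp: locally_integrable_def intro!: Bochner_Integration.integrable_diff)
    fix \<phi> assume t: "test_function \<phi>"
    then obtain K where K: "compact K" "K \<subseteq> I_open" "\<And>x. x \<notin> K \<Longrightarrow> \<phi> x = 0"
      unfolding test_function_def by blast
    obtain a b where ab: "-1 < a" "b < 1" "K \<subseteq> {a..b}" by (rule compact_subset_I_open[OF K(1,2)])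
    then have z: "x \<notin> {a..b} \<Longrightarrow> \<phi> x = 0" for x using K(3) by blast
    have z': "x \<notin> {a..b} \<Longrightarrow> deriv \<phi> x = 0" for x
    proof -
      assume x: "x \<notin> {a..b}"
      have "((\<lambda>x. 0) has_real_derivative deriv \<phi> x) (at x)"
        by (rule has_field_derivative_transform_within_open[OF test_functionD(1)[OF t], where S = "- {a..b}"])
          (use x z in auto)
      then show "deriv \<phi> x = 0" using DERIV_unique[OF _ DERIV_const] by blast
    qed
    note c = test_functionD(3)[OF t, of UNIV] and c' = test_functionD(2)[OF t, of UNIV]
    have *: "(LINT x|lebesgue_on I_open. f x * \<psi> x - g x * \<psi> x) =
        (LINT x|lebesgue_on I_open. f x * \<psi> x) - (LINT x|lebesgue_on I_open. g x * \<psi> x)"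
      if "locally_integrable f" "locally_integrable g" "continuous_on UNIV \<psi>"
        "\<And>x. x \<notin> {a..b} \<Longrightarrow> \<psi> x = 0" for f g \<psi>
      by (intro Bochner_Integration.integral_diff LINT_I_open_mult(3)[OF _ that(3,4) ab(1,2)] that)
    have 1: "(LINT x|lebesgue_on I_open. v x * \<phi> x - v' x * \<phi> x) =
        (LINT x|lebesgue_on I_open. v x * \<phi> x) - (LINT x|lebesgue_on I_open. v' x * \<phi> x)"
      "(LINT x|lebesgue_on I_open. u x * deriv \<phi> x - u' x * deriv \<phi> x) =
        (LINT x|lebesgue_on I_open. u x * deriv \<phi> x) - (LINT x|lebesgue_on I_open. u' x * deriv \<phi> x)"
      by (rule *; use l c z c' z' in auto)+
    show "(LINT x|lebesgue_on I_open. (u x - u' x) * deriv \<phi> x) =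
        - (LINT x|lebesgue_on I_open. (v x - v' x) * \<phi> x)"
      unfolding left_diff_distrib 1
      using assms t by (simp add: has_weak_derivative_def)
  qed
qed

section \<open>Functions of class C^1 that vanish at the endpoints\<close>

lemma continuous_locally_integrable:
  assumes "continuous_on {-1..1} (v :: real \<Rightarrow> real)"
  shows "locally_integrable v"
  using absolutely_integrable_continuous_real[OF assms]
  by (intro locally_integrableI) (simp add: absolutely_integrable_on_Icc_iff_Ioo)

text \<open>The class of all explicit competitors. Derivatives at -1 and 1 are one-sided, and
  carrying \<open>v\<close> along replaces the chosen weak derivative by a continuous
  function.\<close>

definition C1_pair :: "(real \<Rightarrow> real) \<Rightarrow> (real \<Rightarrow> real) \<Rightarrow> bool" where
  "C1_pair w v \<longleftrightarrow> (\<forall>x\<in>{-1..1}. (w has_real_derivative v x) (at x within {-1..1})) \<and>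
     continuous_on {-1..1} v \<and> w (-1) = 0 \<and> w 1 = 0"

lemma C1_pair_continuous: "C1_pair w v \<Longrightarrow> continuous_on {-1..1} w"
  unfolding C1_pair_def using DERIV_continuous_on by blast

lemma C1_pair_integral:
  assumes "C1_pair w v" "x \<in> {-1..1}"
  shows "(v has_integral w x) {-1..x}"
proof -
  have "(v has_integral w x - w (-1)) {-1..x}"
  proof (rule fundamental_theorem_of_calculus)
    fix y assume "y \<in> {-1..x}"
    then have "(w has_real_derivative v y) (at y within {-1..1})"
      using assms by (auto simp: C1_pair_def)
    then show "(w has_vector_derivative v y) (at y within {-1..x})"
      using assms(2) by (auto simp: has_real_derivative_iff_has_vector_derivative[symmetric]
          intro: has_field_derivative_subset)
  qed (use assms in auto)
  with assms show ?thesis by (simp add: C1_pair_def)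
qed

lemma C1_pair_weak_derivative:
  assumes w: "C1_pair w v"
  shows "has_weak_derivative w v"
  unfolding has_weak_derivative_def
proof (intro conjI allI impI)
  have cw: "continuous_on {-1..1} w" and cv: "continuous_on {-1..1} v"
    using w C1_pair_continuous by (auto simp: C1_pair_def)
  show "locally_integrable w" "locally_integrable v"
    using cw cv by (auto intro: continuous_locally_integrable)
  fix \<phi> assume t: "test_function \<phi>"
  have "((\<lambda>x. v x * \<phi> x + w x * deriv \<phi> x) has_integral w 1 * \<phi> 1 - w (-1) * \<phi> (-1)) {-1..1}"
  proof (rule fundamental_theorem_of_calculus)
    fix y :: real assume y: "y \<in> {-1..1}"
    then have "(w has_real_derivative v y) (at y within {-1..1})" using w by (auto simp: C1_pair_def)
    moreover have "(\<phi> has_real_derivative deriv \<phi> y) (at y within {-1..1})"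
      using test_functionD(1)[OF t] by (rule has_field_derivative_at_within)
    ultimately show "((\<lambda>x. w x * \<phi> x) has_vector_derivative v y * \<phi> y + w y * deriv \<phi> y) (at y within {-1..1})"
      unfolding has_real_derivative_iff_has_vector_derivative[symmetric]
      by (auto intro!: derivative_eq_intros)
  qed simp
  then have "integral {-1..1} (\<lambda>x. v x * \<phi> x + w x * deriv \<phi> x) = 0"
    using w by (simp add: C1_pair_def integral_unique)
  moreover have a: "(\<lambda>x. v x * \<phi> x) absolutely_integrable_on {-1..1}"
    "(\<lambda>x. w x * deriv \<phi> x) absolutely_integrable_on {-1..1}"
    by (intro absolutely_integrable_continuous_real continuous_intros cv cw test_functionD[OF t])+
  ultimately show "(LINT x|lebesgue_on I_open. w x * deriv \<phi> x) = - (LINT x|lebesgue_on I_open. v x * \<phi> x)"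
    by (simp add: LINT_I_open_eq Henstock_Kurzweil_Integration.integral_add set_lebesgue_integral_eq_integral)
qed

lemma test_function_C1_pair: "test_function \<phi> \<Longrightarrow> C1_pair \<phi> (deriv \<phi>)"
  by (simp add: C1_pair_def test_functionD has_field_derivative_at_within)

lemma weak_deriv_AE:
  assumes "has_weak_derivative u v"
  shows "has_weak_derivative u (weak_deriv u)" "AE x in lebesgue_on I_open. weak_deriv u x = v x"
proof -
  show "has_weak_derivative u (weak_deriv u)"
    unfolding weak_deriv_def using assms by (rule someI[where P = "has_weak_derivative u"])
  from has_weak_derivative_AE_unique[OF this assms]
  show "AE x in lebesgue_on I_open. weak_deriv u x = v x" .
qed

lemma measurable_I_open_AE:
  assumes "f \<in> borel_measurable (lebesgue_on I_open)" "AE x in lebesgue_on I_open. f x = (g x :: real)"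
  shows "g \<in> borel_measurable (lebesgue_on I_open)"
proof -
  have "(\<lambda>x. indicator I_open x * f x) \<in> borel_measurable lebesgue"
    using assms(1) borel_measurable_restrict_space_iff[of I_open lebesgue f] by simp
  moreover have "AE x in lebesgue. indicator I_open x * f x = indicator I_open x * g x"
    using assms(2) unfolding AE_I_open_iff by eventually_elim (auto simp: indicator_def)
  ultimately have "(\<lambda>x. indicator I_open x * g x) \<in> borel_measurable lebesgue"
    by (rule borel_measurable_AE)
  then show ?thesis using borel_measurable_restrict_space_iff[of I_open lebesgue g] by simp
qed

lemma LINT_cong_I_open:
  assumes "f \<in> borel_measurable (lebesgue_on I_open)" "AE x in lebesgue_on I_open. f x = (g x :: real)"
  shows "(LINT x|lebesgue_on I_open. f x) = (LINT x|lebesgue_on I_open. g x)"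
    "integrable (lebesgue_on I_open) f \<longleftrightarrow> integrable (lebesgue_on I_open) g"
  using assms measurable_I_open_AE[OF assms] by (auto intro: integral_cong_AE simp: integrable_cong_AE[OF _ _ assms(2)])

lemma continuous_I_open_integrable:
  assumes "continuous_on {-1..1} (f :: real \<Rightarrow> real)"
  shows "f \<in> borel_measurable (lebesgue_on I_open)" "f absolutely_integrable_on {-1..1}"
  using absolutely_integrable_continuous_real[OF assms]
    borel_measurable_integrable[of "lebesgue_on I_open" f]
  by (auto simp: integrable_I_open_iff)

lemma abs_powr_continuous:
  assumes "continuous_on S (f :: real \<Rightarrow> real)" "p > 0"
  shows "continuous_on S (\<lambda>x. \<bar>f x\<bar> powr p)"
  by (intro continuous_on_powr' continuous_intros assms) (use assms in auto)

lemma abs_powr_absolutely_integrable: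
  assumes "continuous_on {-1..1} (f :: real \<Rightarrow> real)" "p > 0"
  shows "(\<lambda>x. \<bar>f x\<bar> powr p) absolutely_integrable_on {-1..1}"
  by (intro absolutely_integrable_continuous_real abs_powr_continuous assms)

lemma continuous_in_Lp_space:
  assumes "continuous_on {-1..1} (f :: real \<Rightarrow> real)" "p > 0"
  shows "f \<in> Lp_space p"
  unfolding Lp_space_def integrable_I_open_iff
  using continuous_I_open_integrable(1)[OF assms(1)] abs_powr_absolutely_integrable[OF assms]
  by simp

text \<open>A Weierstrass polynomial \<open>q\<close>, diminished by its mean with respect to the
  cutoff, is multiplied by that cutoff; the product \<open>g k\<close> then has integral zero and
  its primitive is a test function. Since \<open>v\<close> has mean zero, the subtracted mean is in
  the limit no larger than the approximation error. Closeness in L^1 is recorded beside L^p because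
  it controls the primitive uniformly.\<close>

lemma test_function_dense:
  assumes v: "continuous_on {-1..1} v" and v0: "integral {-1..1} v = 0" and p: "p > 0" and \<delta>: "\<delta> > 0"
  shows "\<exists>\<phi>. test_function \<phi> \<and> integral {-1..1} (\<lambda>x. \<bar>v x - deriv \<phi> x\<bar> powr p) < \<delta> \<and>
    integral {-1..1} (\<lambda>x. \<bar>v x - deriv \<phi> x\<bar>) < \<delta>"
proof -
  \<comment> \<open>The limiting error is at most \<open>2 * \<eta>\<close> on an interval of length
    2; the two terms of the minimum keep its L^1 and its L^p integral below
    \<open>\<delta>\<close>.\<close>
  define \<eta> where "\<eta> = min (\<delta> / 8) ((\<delta> / 4) powr (1 / p) / 2)"
  have \<eta>: "2 * (2 * \<eta>) powr p < \<delta>" "4 * \<eta> < \<delta>" "\<eta> > 0"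
  proof -
    have "(2 * \<eta>) powr p \<le> ((\<delta> / 4) powr (1 / p)) powr p"
      using \<delta> p by (intro powr_mono2) (auto simp: \<eta>_def)
    then show "2 * (2 * \<eta>) powr p < \<delta>" using \<delta> p by (simp add: powr_powr)
  qed (use \<delta> in \<open>auto simp: \<eta>_def\<close>)
  obtain q where q: "real_polynomial_function q" "\<And>x. x \<in> {-1..1} \<Longrightarrow> \<bar>v x - q x\<bar> < \<eta>"
    using Stone_Weierstrass_real_polynomial_function[OF compact_Icc v \<eta>(3)] by blast
  have cq: "continuous_on S q" for S using smooth_algebra_continuous smooth_algebra.poly q by blast
  define a b where "a k = -1 + 1 / (real k + 2)" and "b k = 1 - 1 / (real k + 2)" for k
  have ab: "-1 < a k" "a k \<le> b k" "b k < 1" for k by (auto simp: a_def b_def field_simps)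
  define cut where "cut k = bump (k^2) (a k) (b k)" for k
  have cutb: "0 \<le> cut k x" "cut k x \<le> 1" "x \<notin> {a k..b k} \<Longrightarrow> cut k x = 0" for k x
    by (simp_all add: cut_def bump_bounds)
  have cuts: "cut k \<in> smooth_algebra" for k by (simp add: cut_def bump_smooth)
  have ccut: "continuous_on S (cut k)" for S k by (rule smooth_algebra_continuous[OF cuts])
  have cut1: "(\<lambda>k. cut k x) \<longlonglongrightarrow> 1" if x: "x \<in> {-1<..<1}" for x
  proof -
    have lim: "filterlim (\<lambda>k. real (k^2) * (c - 1 / (real k + 2))) at_top sequentially" if "c > 0" for c
      using that by real_asymp
    have "(\<lambda>k. flat1 (real (k^2) * ((1 + x) - 1 / (real k + 2))) * flat1 (real (k^2) * ((1 - x) - 1 / (real k + 2)))) \<longlonglongrightarrow> 1 * 1"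
      by (intro tendsto_mult filterlim_compose[OF flat1_tendsto_1] lim) (use x in auto)
    then show ?thesis by (simp add: cut_def bump_def[abs_def] a_def b_def algebra_simps)
  qed
  have B: "\<exists>B>0. \<forall>x\<in>{-1..1}. \<bar>f x\<bar> \<le> B" if "continuous_on {-1..1} f" for f :: "real \<Rightarrow> real"
    using compact_imp_bounded[OF compact_continuous_image[OF that compact_Icc]]
    by (auto simp: bounded_pos)
  obtain Bq where Bq: "Bq > 0" "\<And>x. x \<in> {-1..1} \<Longrightarrow> \<bar>q x\<bar> \<le> Bq" using B[OF cq] by blast
  obtain Bv where Bv: "Bv > 0" "\<And>x. x \<in> {-1..1} \<Longrightarrow> \<bar>v x\<bar> \<le> Bv" using B[OF v] by blast
  have icut: "(\<lambda>k. integral {-1<..<1} (cut k)) \<longlonglongrightarrow> integral {-1<..<1::real} (\<lambda>x. 1 :: real)"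
    by (rule dominated_convergence(2)[where h = "\<lambda>x. 1"])
      (use cutb cut1 ccut in \<open>auto simp: integrable_on_open_interval_real integrable_continuous_real\<close>)
  have icutq: "(\<lambda>k. integral {-1<..<1} (\<lambda>x. cut k x * q x)) \<longlonglongrightarrow> integral {-1<..<1} (\<lambda>x. 1 * q x)"
  proof (rule dominated_convergence(2)[where h = "\<lambda>x. Bq"])
    show "norm (cut k x * q x) \<le> Bq" if "x \<in> {-1<..<1}" for k x
      using mult_mono[of "cut k x" 1 "\<bar>q x\<bar>" Bq] Bq(2)[of x] cutb(1)[of k x] cutb(2)[of k x] that by (simp add: abs_mult)
    show "(\<lambda>k. cut k x * q x) \<longlonglongrightarrow> 1 * q x" if "x \<in> {-1<..<1}" for x
      by (intro tendsto_intros cut1 that)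
  qed (auto simp: integrable_on_open_interval_real intro!: integrable_continuous_real continuous_intros ccut cq)
  have one: "integral {-1<..<1} (\<lambda>x::real. c) = 2 * c" for c :: real
    by (simp flip: integral_open_interval_real)
  define \<mu> where "\<mu> k = integral {-1..1} (\<lambda>x. cut k x * q x) / integral {-1..1} (cut k)" for k
  define m where "m = integral {-1..1} q / 2"
  have \<mu>: "\<mu> \<longlonglongrightarrow> m"
    using tendsto_divide[OF icutq icut] by (simp add: \<mu>_def[abs_def] m_def integral_open_interval_real one)
  have m: "\<bar>m\<bar> \<le> \<eta>"
  proof -
    have "integral {-1..1} q = - integral {-1..1} (\<lambda>x. v x - q x)"
      by (subst Henstock_Kurzweil_Integration.integral_diff) (auto intro!: integrable_continuous_real v cq simp: v0)
    moreover have "norm (integral {-1..1} (\<lambda>x. v x - q x)) \<le> \<eta> * (1 - (-1))"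
      by (rule integral_bound) (use v cq q(2) in \<open>auto intro!: continuous_intros less_imp_le\<close>)
    ultimately show ?thesis by (simp add: m_def)
  qed
  obtain B\<mu> where B\<mu>: "\<And>k. \<bar>\<mu> k\<bar> \<le> B\<mu>"
    using convergent_imp_Bseq[OF convergentI[OF \<mu>]] unfolding Bseq_def by auto
  define g where "g k x = cut k x * (q x - \<mu> k)" for k x
  have cg: "continuous_on S (g k)" for S k unfolding g_def by (intro continuous_intros ccut cq)
  have lim: "(\<lambda>k. \<bar>v x - g k x\<bar>) \<longlonglongrightarrow> \<bar>v x - (q x - m)\<bar>" if "x \<in> {-1<..<1}" for x
    using tendsto_mult[OF cut1[OF that] tendsto_diff[OF tendsto_const \<mu>, of "q x"]]
    by (auto simp: g_def intro!: tendsto_intros)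
  have le: "\<bar>v x - (q x - m)\<bar> \<le> 2 * \<eta>" if "x \<in> {-1<..<1}" for x
    using q(2)[of x] m that by auto
  have bd: "\<bar>v x - g k x\<bar> \<le> Bv + (Bq + B\<mu>)" if "x \<in> {-1<..<1}" for k x
  proof -
    have "\<bar>g k x\<bar> \<le> 1 * (\<bar>q x\<bar> + \<bar>\<mu> k\<bar>)"
      unfolding g_def abs_mult using cutb(1)[of k x] cutb(2)[of k x] by (intro mult_mono) auto
    then show ?thesis using Bv(2)[of x] Bq(2)[of x] B\<mu>[of k] that by auto
  qed
  have main: "\<forall>\<^sub>F k in sequentially. integral {-1..1} (\<lambda>x. \<bar>v x - g k x\<bar> powr s) < \<delta>"
    if s: "s > 0" "2 * (2 * \<eta>) powr s < \<delta>" for s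
  proof -
    have L: "(\<lambda>k. integral {-1<..<1} (\<lambda>x. \<bar>v x - g k x\<bar> powr s)) \<longlonglongrightarrow>
        integral {-1<..<1} (\<lambda>x. \<bar>v x - (q x - m)\<bar> powr s)"
      by (rule dominated_convergence(2)[where h = "\<lambda>x. (Bv + (Bq + B\<mu>)) powr s"])
        (use s lim bd cg v in \<open>auto simp: integrable_on_open_interval_real
        intro!: integrable_continuous_real abs_powr_continuous continuous_intros powr_mono2 tendsto_powr'\<close>)
    have LE: "integral {-1<..<1} (\<lambda>x. \<bar>v x - (q x - m)\<bar> powr s) \<le> integral {-1<..<1::real} (\<lambda>x. (2 * \<eta>) powr s)"
      by (rule integral_le)
        (use s le cq v in \<open>auto simp: integrable_on_open_interval_real
        intro!: integrable_continuous_real abs_powr_continuous continuous_intros powr_mono2\<close>)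
    have "\<forall>\<^sub>F k in sequentially. integral {-1<..<1} (\<lambda>x. \<bar>v x - g k x\<bar> powr s) < \<delta>"
      by (rule order_tendstoD(2)[OF L]) (use LE s(2) one in auto)
    then show ?thesis by (simp add: integral_open_interval_real)
  qed
  have "\<forall>\<^sub>F k in sequentially. integral {-1<..<1} (cut k) > 0"
    using icut by (rule order_tendstoD(1)) (simp add: one)
  then have "\<forall>\<^sub>F k in sequentially. integral {-1..1} (\<lambda>x. \<bar>v x - g k x\<bar> powr p) < \<delta> \<and>
      integral {-1..1} (\<lambda>x. \<bar>v x - g k x\<bar> powr 1) < \<delta> \<and> integral {-1..1} (cut k) > 0"
    using main[of p] main[of 1] p \<eta> by (auto simp: integral_open_interval_real intro!: eventually_conj)
  then obtain k where k: "integral {-1..1} (\<lambda>x. \<bar>v x - g k x\<bar> powr p) < \<delta>"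
      "integral {-1..1} (\<lambda>x. \<bar>v x - g k x\<bar> powr 1) < \<delta>" "integral {-1..1} (cut k) > 0"
    using eventually_happens'[OF sequentially_bot] by blast
  have "integral {-1..1} (g k) = integral {-1..1} (\<lambda>x. cut k x * q x) - integral {-1..1} (\<lambda>x. cut k x * \<mu> k)"
    unfolding g_def right_diff_distrib
    by (intro Henstock_Kurzweil_Integration.integral_diff integrable_continuous_real continuous_intros ccut cq)
  also have "\<dots> = 0" using k(3) by (simp add: \<mu>_def)
  finally have "integral {-1..1} (g k) = 0" .
  moreover have "g k \<in> smooth_algebra" unfolding g_def
    by (intro smooth_algebra.mult cuts smooth_algebra_diff_const smooth_algebra.poly q)
  ultimately obtain \<phi> where "test_function \<phi>" "deriv \<phi> = g k"
    using test_function_primitive[of "g k" "a k" "b k"] ab cutb(3) by (auto simp: g_def)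
  then show ?thesis using k by auto
qed

lemma C1_pair_minus: "C1_pair w v \<Longrightarrow> C1_pair w' v' \<Longrightarrow> C1_pair (\<lambda>x. w x - w' x) (\<lambda>x. v x - v' x)"
  by (auto simp: C1_pair_def intro!: derivative_eq_intros continuous_intros)

lemma C1_pair_norm:
  assumes "C1_pair w v" "p > 0"
  shows "(LINT x|lebesgue_on I_open. \<bar>w x\<bar> powr p) = integral {-1..1} (\<lambda>x. \<bar>w x\<bar> powr p)"
    "(LINT x|lebesgue_on I_open. \<bar>weak_deriv w x\<bar> powr p) = integral {-1..1} (\<lambda>x. \<bar>v x\<bar> powr p)"
proof -
  have cw: "continuous_on {-1..1} w" and cv: "continuous_on {-1..1} v"
    using assms C1_pair_continuous by (auto simp: C1_pair_def)
  show "(LINT x|lebesgue_on I_open. \<bar>w x\<bar> powr p) = integral {-1..1} (\<lambda>x. \<bar>w x\<bar> powr p)"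
    by (intro LINT_I_open_eq abs_powr_absolutely_integrable cw assms)
  have "(LINT x|lebesgue_on I_open. \<bar>v x\<bar> powr p) = (LINT x|lebesgue_on I_open. \<bar>weak_deriv w x\<bar> powr p)"
  proof (rule LINT_cong_I_open)
    show "(\<lambda>x. \<bar>v x\<bar> powr p) \<in> borel_measurable (lebesgue_on I_open)"
      using continuous_I_open_integrable(1)[OF abs_powr_continuous[OF cv assms(2)]] .
    show "AE x in lebesgue_on I_open. \<bar>v x\<bar> powr p = \<bar>weak_deriv w x\<bar> powr p"
      using weak_deriv_AE(2)[OF C1_pair_weak_derivative[OF assms(1)]] by eventually_elim simp
  qed
  then show "(LINT x|lebesgue_on I_open. \<bar>weak_deriv w x\<bar> powr p) = integral {-1..1} (\<lambda>x. \<bar>v x\<bar> powr p)"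
    by (simp add: LINT_I_open_eq[OF abs_powr_absolutely_integrable[OF cv assms(2)]])
qed

text \<open>It suffices to approximate the derivative: \<open>w - \<phi>\<close> is the primitive of
  \<open>v - deriv \<phi>\<close> from -1, so it is bounded everywhere by the L^1 distance of the
  derivatives.\<close>

lemma C1_pair_W01p:
  assumes w: "C1_pair w v" and p: "p > 0"
  shows "w \<in> W01p p"
proof -
  have cw: "continuous_on {-1..1} w" and cv: "continuous_on {-1..1} v"
    using w C1_pair_continuous by (auto simp: C1_pair_def)
  have "w \<in> W1p p"
    unfolding W1p_def using cw cv p C1_pair_weak_derivative[OF w] by (auto intro!: continuous_in_Lp_space)
  moreover have "\<exists>\<phi>. test_function \<phi> \<and> W1p_norm p (\<lambda>x. w x - \<phi> x) < \<epsilon>" if \<epsilon>: "\<epsilon> > 0" for \<epsilon>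
  proof -
    define e where "e = \<epsilon> powr p / 2"
    have e: "e > 0" using \<epsilon> by (simp add: e_def)
    \<comment> \<open>\<open>e\<close> is half of the admissible p-th power of the norm.
      \<open>\<delta> \<le> e\<close> serves the derivative, and
      \<open>2 * \<delta> powr p \<le> e\<close> serves the function, which is at most
      \<open>\<delta>\<close> on an interval of length 2.\<close>
    define \<delta> where "\<delta> = min e ((e / 2) powr (1 / p))"
    have \<delta>: "\<delta> > 0" "\<delta> \<le> e" "2 * \<delta> powr p \<le> e"
    proof -
      have "\<delta> powr p \<le> ((e / 2) powr (1 / p)) powr p"
        using e p by (intro powr_mono2) (auto simp: \<delta>_def)
      then show "2 * \<delta> powr p \<le> e" using e p by (simp add: powr_powr)
    qed (use e in \<open>auto simp: \<delta>_def\<close>)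
    have "integral {-1..1} v = 0"
      using C1_pair_integral[OF w, of 1] w by (auto simp: C1_pair_def dest: integral_unique)
    from test_function_dense[OF cv this p \<delta>(1)] obtain \<phi> where \<phi>: "test_function \<phi>"
      "integral {-1..1} (\<lambda>x. \<bar>v x - deriv \<phi> x\<bar> powr p) < \<delta>" "integral {-1..1} (\<lambda>x. \<bar>v x - deriv \<phi> x\<bar>) < \<delta>" by blast
    have d: "C1_pair (\<lambda>x. w x - \<phi> x) (\<lambda>x. v x - deriv \<phi> x)"
      by (intro C1_pair_minus w test_function_C1_pair \<phi>)
    then have cd: "continuous_on S (\<lambda>x. v x - deriv \<phi> x)" if "S \<subseteq> {-1..1}" for S
      using that by (auto simp: C1_pair_def intro: continuous_on_subset)
    have sm: "\<bar>w x - \<phi> x\<bar> \<le> \<delta>" if x: "x \<in> {-1..1}" for x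
    proof -
      have "w x - \<phi> x = integral {-1..x} (\<lambda>x. v x - deriv \<phi> x)"
        using integral_unique[OF C1_pair_integral[OF d x]] by simp
      also have "norm \<dots> \<le> integral {-1..x} (\<lambda>x. \<bar>v x - deriv \<phi> x\<bar>)"
        using x by (intro integral_norm_bound_integral integrable_continuous_real continuous_intros cd) auto
      also have "\<dots> \<le> integral {-1..1} (\<lambda>x. \<bar>v x - deriv \<phi> x\<bar>)"
        using x by (intro integral_subset_le integrable_continuous_real continuous_on_rabs cd) auto
      finally show ?thesis using \<phi>(3) by simp
    qed
    have "integral {-1..1} (\<lambda>x. \<bar>w x - \<phi> x\<bar> powr p) \<le> integral {-1..1::real} (\<lambda>x. \<delta> powr p)"
      using C1_pair_continuous[OF d] p sm
      by (intro integral_le integrable_continuous_real abs_powr_continuous powr_mono2) auto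
    then have "integral {-1..1} (\<lambda>x. \<bar>w x - \<phi> x\<bar> powr p) + integral {-1..1} (\<lambda>x. \<bar>v x - deriv \<phi> x\<bar> powr p) < \<epsilon> powr p"
      using \<phi>(2) \<delta> by (simp add: e_def)
    moreover have "0 \<le> integral {-1..1} (\<lambda>x. \<bar>w x - \<phi> x\<bar> powr p)"
      "0 \<le> integral {-1..1} (\<lambda>x. \<bar>v x - deriv \<phi> x\<bar> powr p)"
      using cd[of "{-1..1}"] C1_pair_continuous[OF d] p
      by (auto intro!: Henstock_Kurzweil_Integration.integral_nonneg integrable_continuous_real abs_powr_continuous)
    ultimately have "W1p_norm p (\<lambda>x. w x - \<phi> x) < (\<epsilon> powr p) powr (1 / p)"
      unfolding W1p_norm_def C1_pair_norm[OF d p] using p by (intro powr_less_mono2) auto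
    with \<phi>(1) show ?thesis using p \<epsilon> by (auto simp: powr_powr)
  qed
  ultimately show ?thesis by (simp add: W01p_def)
qed

section \<open>Absolutely continuous representatives\<close>

text \<open>Absolute continuity is encoded as being the primitive of an integrable function; the
  boundary value at -1 is contained in the integral formula.\<close>

definition ac_pair :: "real \<Rightarrow> (real \<Rightarrow> real) \<Rightarrow> (real \<Rightarrow> real) \<Rightarrow> bool" where
  "ac_pair p w v \<longleftrightarrow> v absolutely_integrable_on {-1..1} \<and>
     (\<lambda>x. \<bar>v x\<bar> powr p) absolutely_integrable_on {-1..1} \<and>
     (\<forall>x\<in>{-1..1}. w x = integral {-1..x} v) \<and> w 1 = 0"

text \<open>For \<open>\<bar>t\<bar> > \<eta>\<close> the factor
  \<open>\<bar>t\<bar> powr (1 - p)\<close> is at most \<open>\<eta> powr (1 - p)\<close>. With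
  \<open>\<eta>\<close> free this takes the place of Hoelder's inequality: a small L^p integral
  gives a small L^1 norm.\<close>

lemma abs_le_powr_bound:
  fixes t \<eta> p :: real
  assumes "\<eta> > 0" "p \<ge> 1"
  shows "\<bar>t\<bar> \<le> \<eta> + \<eta> powr (1 - p) * \<bar>t\<bar> powr p"
proof (cases "\<bar>t\<bar> \<le> \<eta>")
  case True
  then show ?thesis by (simp add: add_increasing2)
next
  case False
  then have t: "\<bar>t\<bar> > \<eta>" by simp
  have "\<bar>t\<bar> = \<bar>t\<bar> powr (1 - p) * \<bar>t\<bar> powr p"
    using t assms by (simp flip: powr_add)
  also have "\<dots> \<le> \<eta> powr (1 - p) * \<bar>t\<bar> powr p"
    using t assms by (intro mult_right_mono powr_mono2') auto
  finally show ?thesis using assms by simp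
qed

lemma powr_integrable_imp_integrable:
  assumes "f \<in> borel_measurable (lebesgue_on I_open)"
    "integrable (lebesgue_on I_open) (\<lambda>x. \<bar>f x\<bar> powr p)" "p \<ge> (1::real)"
  shows "integrable (lebesgue_on I_open) f"
proof (rule Bochner_Integration.integrable_bound)
  show "integrable (lebesgue_on I_open) (\<lambda>x. 1 + \<bar>f x\<bar> powr p)"
    using assms(2) continuous_I_open_integrable(2)[of "\<lambda>x. 1"]
    by (intro Bochner_Integration.integrable_add) (auto simp: integrable_I_open_iff)
  show "AE x in lebesgue_on I_open. norm (f x) \<le> norm (1 + \<bar>f x\<bar> powr p)"
    using abs_le_powr_bound[of 1 p] assms(3) by (auto simp: abs_of_nonneg)
qed (use assms in auto)

lemma LINT_abs_le:
  assumes f: "f \<in> borel_measurable (lebesgue_on I_open)"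
    "integrable (lebesgue_on I_open) (\<lambda>x. \<bar>f x\<bar> powr p)" and p: "p \<ge> (1::real)" and \<eta>: "\<eta> > 0"
  shows "(LINT x|lebesgue_on I_open. \<bar>f x\<bar>) \<le> 2 * \<eta> + \<eta> powr (1 - p) * (LINT x|lebesgue_on I_open. \<bar>f x\<bar> powr p)"
proof -
  have c: "integrable (lebesgue_on I_open) (\<lambda>x. \<eta>)" "(LINT x|lebesgue_on I_open. \<eta>) = 2 * \<eta>"
    using continuous_I_open_integrable(2)[of "\<lambda>x. \<eta>"] LINT_I_open_eq[of "\<lambda>x. \<eta>"]
    by (auto simp: integrable_I_open_iff)
  have "(LINT x|lebesgue_on I_open. \<bar>f x\<bar>) \<le> (LINT x|lebesgue_on I_open. \<eta> + \<eta> powr (1 - p) * \<bar>f x\<bar> powr p)"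
    using f p c abs_le_powr_bound[OF \<eta> p] powr_integrable_imp_integrable[OF f p]
    by (intro integral_mono) auto
  also have "\<dots> = 2 * \<eta> + \<eta> powr (1 - p) * (LINT x|lebesgue_on I_open. \<bar>f x\<bar> powr p)"
    using f c by simp
  finally show ?thesis .
qed

lemma Lp_space_diff:
  assumes u: "u \<in> Lp_space p" and \<phi>: "continuous_on {-1..1} \<phi>" and p: "p \<ge> 1"
  shows "(\<lambda>x. u x - \<phi> x) \<in> Lp_space p"
proof -
  obtain B where B: "B > 0" "\<And>x. x \<in> {-1..1} \<Longrightarrow> \<bar>\<phi> x\<bar> \<le> B"
    using compact_imp_bounded[OF compact_continuous_image[OF \<phi> compact_Icc]] by (auto simp: bounded_pos)
  have um: "u \<in> borel_measurable (lebesgue_on I_open)"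
    and ui: "integrable (lebesgue_on I_open) (\<lambda>x. \<bar>u x\<bar> powr p)"
    using u by (auto simp: Lp_space_def)
  note \<phi>m = continuous_I_open_integrable(1)[OF \<phi>]
  have le: "\<bar>u x - \<phi> x\<bar> powr p \<le> 2 powr p * (B powr p + \<bar>u x\<bar> powr p)" if "x \<in> {-1..1}" for x
  proof -
    have "\<bar>u x - \<phi> x\<bar> powr p \<le> (2 * max B \<bar>u x\<bar>) powr p"
      using p B(2)[OF that] by (intro powr_mono2) auto
    also have "\<dots> = 2 powr p * (max B \<bar>u x\<bar>) powr p"
      using B by (simp add: powr_mult)
    also have "(max B \<bar>u x\<bar>) powr p \<le> B powr p + \<bar>u x\<bar> powr p"
      by (simp add: max_def)
    finally show ?thesis by simp
  qed
  have "integrable (lebesgue_on I_open) (\<lambda>x. \<bar>u x - \<phi> x\<bar> powr p)"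
  proof (rule Bochner_Integration.integrable_bound)
    show "integrable (lebesgue_on I_open) (\<lambda>x. 2 powr p * (B powr p + \<bar>u x\<bar> powr p))"
      using ui continuous_I_open_integrable(2)[of "\<lambda>x. B powr p"]
      by (intro integrable_mult_right Bochner_Integration.integrable_add) (auto simp: integrable_I_open_iff)
    show "AE x in lebesgue_on I_open. norm (\<bar>u x - \<phi> x\<bar> powr p) \<le> norm (2 powr p * (B powr p + \<bar>u x\<bar> powr p))"
      using le by (intro AE_I2) (auto simp: abs_of_nonneg)
  qed (use um \<phi>m in measurable)
  then show ?thesis using um \<phi>m by (simp add: Lp_space_def)
qed

lemma Lp_space_AE:
  assumes "f \<in> Lp_space p" "AE x in lebesgue_on I_open. f x = g x"
  shows "g \<in> Lp_space p"
proof -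
  have f: "f \<in> borel_measurable (lebesgue_on I_open)" using assms by (simp add: Lp_space_def)
  then have "(\<lambda>x. \<bar>f x\<bar> powr p) \<in> borel_measurable (lebesgue_on I_open)" by measurable
  moreover have "AE x in lebesgue_on I_open. \<bar>f x\<bar> powr p = \<bar>g x\<bar> powr p"
    using assms(2) by eventually_elim simp
  ultimately show ?thesis
    using LINT_cong_I_open(2) measurable_I_open_AE[OF f assms(2)] assms(1) by (simp add: Lp_space_def)
qed

lemma abs_integral_le_integral_abs:
  fixes f :: "real \<Rightarrow> real"
  assumes "f absolutely_integrable_on {-1..1}" "x \<in> {-1..1}"
  shows "\<bar>integral {-1..x} f\<bar> \<le> integral {-1..1} (\<lambda>x. \<bar>f x\<bar>)"
proof -
  have f: "f absolutely_integrable_on {-1..x}"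
    using assms by (intro absolutely_integrable_on_subinterval[OF assms(1)]) auto
  then have i: "f integrable_on {-1..x}" "(\<lambda>x. \<bar>f x\<bar>) integrable_on {-1..x}" "(\<lambda>x. \<bar>f x\<bar>) integrable_on {-1..1}"
    using assms by (auto simp: absolutely_integrable_on_def)
  have "norm (integral {-1..x} f) \<le> integral {-1..x} (\<lambda>x. \<bar>f x\<bar>)"
    using i by (intro integral_norm_bound_integral) auto
  also have "\<dots> \<le> integral {-1..1} (\<lambda>x. \<bar>f x\<bar>)"
    using i assms by (intro integral_subset_le) auto
  finally show ?thesis by simp
qed

text \<open>Test functions approximate \<open>u\<close> and its derivative simultaneously in L^1.
  The primitive \<open>w\<close> of the derivative differs from such a \<open>\<phi>\<close>,
  uniformly, by at most the L^1 distance of the derivatives. Hence \<open>w 1 = 0\<close>, because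
  \<open>\<phi> 1 = 0\<close>, and \<open>u - w\<close> has L^1 norm zero.\<close>

lemma W01p_ac_pair:
  assumes u: "u \<in> W01p p" and p: "p \<ge> 1"
  obtains w where "ac_pair p w (weak_deriv u)" "AE x in lebesgue_on I_open. u x = w x"
proof -
  let ?M = "lebesgue_on I_open"
  define v where "v = weak_deriv u"
  obtain v0 where v0: "v0 \<in> Lp_space p" "has_weak_derivative u v0" and uLp: "u \<in> Lp_space p"
    using u by (auto simp: W01p_def W1p_def)
  have hv: "has_weak_derivative u v" and AEv: "AE x in ?M. v x = v0 x"
    using weak_deriv_AE[OF v0(2)] by (auto simp: v_def)
  have vLp: "v \<in> Lp_space p"
    using AEv by (intro Lp_space_AE[OF v0(1)]) auto
  have vi: "integrable ?M v" and vp: "integrable ?M (\<lambda>x. \<bar>v x\<bar> powr p)"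
    using vLp p by (auto simp: Lp_space_def intro: powr_integrable_imp_integrable)
  have ui: "integrable ?M u"
    using uLp p by (auto simp: Lp_space_def intro: powr_integrable_imp_integrable)
  have va: "v absolutely_integrable_on {-1..1}" using vi by (simp add: integrable_I_open_iff)
  have approx: "\<exists>\<phi>. test_function \<phi> \<and> (LINT x|?M. \<bar>u x - \<phi> x\<bar>) < \<delta> \<and> (LINT x|?M. \<bar>v x - deriv \<phi> x\<bar>) < \<delta>"
    if \<delta>: "\<delta> > 0" for \<delta>
  proof -
    define \<eta> where "\<eta> = \<delta> / 4"
    have \<eta>: "\<eta> > 0" using \<delta> by (simp add: \<eta>_def)
    \<comment> \<open>Calibrated for \<open>LINT_abs_le\<close>: an L^p integral below
      \<open>e\<close> bounds the L^1 norm by \<open>3 * \<eta>\<close>, which is less than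
      \<open>\<delta> = 4 * \<eta>\<close>.\<close>
    define e where "e = \<eta> powr (p - 1) * \<eta>"
    have e: "e > 0" "\<eta> powr (1 - p) * e = \<eta>"
      using \<eta> by (auto simp: e_def mult.assoc[symmetric] simp flip: powr_add)
    obtain \<phi> where \<phi>: "test_function \<phi>" "W1p_norm p (\<lambda>x. u x - \<phi> x) < e powr (1 / p)"
      using u[unfolded W01p_def, simplified] e(1) by (metis less_numeral_extra(3) powr_gt_zero)
    have c\<phi>: "continuous_on {-1..1} \<phi>" "continuous_on {-1..1} (deriv \<phi>)" using \<phi> by (auto simp: test_functionD)
    have 1: "(\<lambda>x. u x - \<phi> x) \<in> Lp_space p" by (intro Lp_space_diff uLp c\<phi> p)
    have 2: "(\<lambda>x. v x - deriv \<phi> x) \<in> Lp_space p" by (intro Lp_space_diff vLp c\<phi> p)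
    have "AE x in ?M. weak_deriv (\<lambda>x. u x - \<phi> x) x = v x - deriv \<phi> x"
      by (intro weak_deriv_AE(2) has_weak_derivative_diff hv C1_pair_weak_derivative test_function_C1_pair \<phi>)
    then have AE: "AE x in ?M. v x - deriv \<phi> x = weak_deriv (\<lambda>x. u x - \<phi> x) x" by eventually_elim simp
    have m: "(\<lambda>x. \<bar>v x - deriv \<phi> x\<bar> powr p) \<in> borel_measurable ?M"
      using 2 unfolding Lp_space_def by (auto intro: borel_measurable_integrable)
    have "(LINT x|?M. \<bar>weak_deriv (\<lambda>x. u x - \<phi> x) x\<bar> powr p) = (LINT x|?M. \<bar>v x - deriv \<phi> x\<bar> powr p)"
      by (rule LINT_cong_I_open(1)[OF m, symmetric]) (use AE in eventually_elim, simp)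
    then have "((LINT x|?M. \<bar>u x - \<phi> x\<bar> powr p) + (LINT x|?M. \<bar>v x - deriv \<phi> x\<bar> powr p)) powr (1 / p) < e powr (1 / p)"
      using \<phi>(2) by (simp add: W1p_norm_def)
    moreover have nn: "0 \<le> (LINT x|?M. \<bar>u x - \<phi> x\<bar> powr p)" "0 \<le> (LINT x|?M. \<bar>v x - deriv \<phi> x\<bar> powr p)"
      by simp_all
    ultimately have "(LINT x|?M. \<bar>u x - \<phi> x\<bar> powr p) + (LINT x|?M. \<bar>v x - deriv \<phi> x\<bar> powr p) < e"
      using p e by (smt (verit) powr_mono2 zero_le_divide_1_iff)
    with nn have 3: "(LINT x|?M. \<bar>u x - \<phi> x\<bar> powr p) < e" "(LINT x|?M. \<bar>v x - deriv \<phi> x\<bar> powr p) < e" by linarith+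
    have "(LINT x|?M. \<bar>f x\<bar>) < \<delta>" if f: "f \<in> Lp_space p" "(LINT x|?M. \<bar>f x\<bar> powr p) < e" for f
    proof -
      have "(LINT x|?M. \<bar>f x\<bar>) \<le> 2 * \<eta> + \<eta> powr (1 - p) * (LINT x|?M. \<bar>f x\<bar> powr p)"
        using f(1) p \<eta> by (intro LINT_abs_le) (auto simp: Lp_space_def)
      also have "\<dots> \<le> 2 * \<eta> + \<eta> powr (1 - p) * e"
        using f(2) by (intro add_left_mono mult_left_mono) auto
      also have "\<dots> < \<delta>" using e \<delta> by (simp add: \<eta>_def)
      finally show ?thesis .
    qed
    with 1 2 3 \<phi>(1) show ?thesis by blast
  qed
  define w where "w x = integral {-1..x} v" for x
  have near: "\<bar>w x - \<phi> x\<bar> \<le> (LINT x|?M. \<bar>v x - deriv \<phi> x\<bar>)" if \<phi>: "test_function \<phi>" and x: "x \<in> {-1..1}" for \<phi> x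
  proof -
    have c\<phi>: "continuous_on {-1..1} (deriv \<phi>)" using \<phi> by (auto simp: test_functionD)
    have a: "(\<lambda>x. v x - deriv \<phi> x) absolutely_integrable_on {-1..1}"
      using va absolutely_integrable_continuous_real[OF c\<phi>] by auto
    have "\<phi> x = integral {-1..x} (deriv \<phi>)"
      using integral_unique[OF C1_pair_integral[OF test_function_C1_pair[OF \<phi>] x]] by simp
    moreover have "v integrable_on {-1..x}"
      using x absolutely_integrable_on_subinterval[OF va] by (auto simp: absolutely_integrable_on_def)
    moreover have "deriv \<phi> integrable_on {-1..x}"
      using x by (intro integrable_continuous_real continuous_on_subset[OF c\<phi>]) auto
    ultimately have "w x - \<phi> x = integral {-1..x} (\<lambda>x. v x - deriv \<phi> x)"
      by (simp add: w_def Henstock_Kurzweil_Integration.integral_diff)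
    also have "\<bar>\<dots>\<bar> \<le> integral {-1..1} (\<lambda>x. \<bar>v x - deriv \<phi> x\<bar>)"
      by (rule abs_integral_le_integral_abs[OF a x])
    also have "\<dots> = (LINT x|?M. \<bar>v x - deriv \<phi> x\<bar>)"
      using absolutely_integrable_abs[OF a] by (simp add: LINT_I_open_eq)
    finally show ?thesis .
  qed
  have w1: "w 1 = 0"
  proof (rule ccontr)
    assume "w 1 \<noteq> 0"
    then obtain \<phi> where "test_function \<phi>" "(LINT x|?M. \<bar>v x - deriv \<phi> x\<bar>) < \<bar>w 1\<bar>"
      using approx[of "\<bar>w 1\<bar>"] by auto
    with near[of \<phi> 1] test_functionD(4)[of \<phi> 1] show False by auto
  qed
  have cw: "continuous_on {-1..1} w"
    unfolding w_def using va by (intro indefinite_integral_continuous_1) (auto simp: absolutely_integrable_on_def)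
  have wi: "integrable ?M w" using continuous_I_open_integrable(2)[OF cw] by (simp add: integrable_I_open_iff)
  have "(LINT x|?M. \<bar>u x - w x\<bar>) \<le> \<delta>" if \<delta>: "\<delta> > 0" for \<delta>
  proof -
    obtain \<phi> where \<phi>: "test_function \<phi>" "(LINT x|?M. \<bar>u x - \<phi> x\<bar>) < \<delta> / 3" "(LINT x|?M. \<bar>v x - deriv \<phi> x\<bar>) < \<delta> / 3"
      using approx[of "\<delta> / 3"] \<delta> by auto
    have \<phi>i: "integrable ?M \<phi>"
      using continuous_I_open_integrable(2)[of \<phi>] test_functionD(3)[OF \<phi>(1)] by (simp add: integrable_I_open_iff)
    have ci: "integrable ?M (\<lambda>x. \<delta> / 3)" "(LINT x|?M. \<delta> / 3) = 2 * (\<delta> / 3)"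
      using continuous_I_open_integrable(2)[of "\<lambda>x. \<delta> / 3"] LINT_I_open_eq[of "\<lambda>x. \<delta> / 3"]
      by (auto simp: integrable_I_open_iff)
    have "(LINT x|?M. \<bar>u x - w x\<bar>) \<le> (LINT x|?M. \<bar>u x - \<phi> x\<bar> + \<delta> / 3)"
    proof (rule integral_mono)
      show "\<bar>u x - w x\<bar> \<le> \<bar>u x - \<phi> x\<bar> + \<delta> / 3" if "x \<in> space ?M" for x
        using near[OF \<phi>(1), of x] \<phi>(3) that by auto
    qed (use ui wi \<phi>i ci in auto)
    also have "\<dots> = (LINT x|?M. \<bar>u x - \<phi> x\<bar>) + 2 * (\<delta> / 3)"
      using ui \<phi>i ci by simp
    finally show ?thesis using \<phi> by simp
  qed
  then have "(LINT x|?M. \<bar>u x - w x\<bar>) \<le> 0" by (rule field_le_epsilon[of _ 0, simplified])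
  then have "(LINT x|?M. \<bar>u x - w x\<bar>) = 0" by (simp add: antisym)
  then have "AE x in ?M. \<bar>u x - w x\<bar> = 0"
    using ui wi by (subst (asm) integral_nonneg_eq_0_iff_AE) auto
  then have "AE x in ?M. u x = w x" by eventually_elim simp
  moreover have "ac_pair p w v"
    unfolding ac_pair_def using va vp w1 by (auto simp: w_def integrable_I_open_iff)
  ultimately show ?thesis using that unfolding v_def by blast
qed

lemma ac_pairD:
  assumes "ac_pair p w v"
  shows "v absolutely_integrable_on {-1..1}" "(\<lambda>x. \<bar>v x\<bar> powr p) absolutely_integrable_on {-1..1}"
    "w (-1) = 0" "w 1 = 0" "continuous_on {-1..1} w"
    "-1 \<le> a \<Longrightarrow> a \<le> b \<Longrightarrow> b \<le> 1 \<Longrightarrow> integral {a..b} v = w b - w a"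
proof -
  show 1: "v absolutely_integrable_on {-1..1}" "(\<lambda>x. \<bar>v x\<bar> powr p) absolutely_integrable_on {-1..1}"
    "w (-1) = 0" "w 1 = 0" using assms by (auto simp: ac_pair_def)
  have i: "v integrable_on {-1..1}" using 1 by (auto simp: absolutely_integrable_on_def)
  have "continuous_on {-1..1} (\<lambda>x. integral {-1..x} v)"
    by (intro indefinite_integral_continuous_1 i)
  then show "continuous_on {-1..1} w"
    by (rule continuous_on_eq) (use assms in \<open>auto simp: ac_pair_def\<close>)
  show "integral {a..b} v = w b - w a" if "-1 \<le> a" "a \<le> b" "b \<le> 1"
  proof -
    have "v integrable_on {-1..b}" by (rule integrable_subinterval_real[OF i]) (use that in auto)
    then show ?thesis
      using Henstock_Kurzweil_Integration.integral_combine[of "-1" a b v] that assms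
      by (auto simp: ac_pair_def)
  qed
qed

section \<open>Chain rule and weighted variation of absolutely continuous functions\<close>

lemma AE_I_open_negligible:
  assumes "AE x in lebesgue_on I_open. P x"
  shows "negligible {x \<in> {-1..1}. \<not> P x}"
proof -
  have "AE x in lebesgue. x \<in> I_open \<longrightarrow> P x" using assms by (simp add: AE_I_open_iff)
  then obtain N where N: "N \<in> null_sets lebesgue" "{x. \<not> (x \<in> I_open \<longrightarrow> P x)} \<subseteq> N"
    by (auto simp: eventually_ae_filter)
  have "negligible (N \<union> {-1, 1})" using N(1) by (simp add: negligible_iff_null_sets)
  then show ?thesis by (rule negligible_subset) (use N(2) in force)
qed

text \<open>As \<open>w\<close> is merely the primitive of an integrable function, no pointwise
  derivative of \<open>w\<close> is used. On a short interval the primitive of \<open>g\<close> is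
  nearly linear, and the error is a small multiple of the integral of \<open>\<bar>v\<bar>\<close>;
  a bound of this form is additive over adjacent intervals.\<close>

lemma chain_rule_absolutely_continuous:
  fixes w v g :: "real \<Rightarrow> real"
  assumes w: "ac_pair p w v" and rng': "w ` {-1..1} \<subseteq> {c..d}" and g: "continuous_on {c..d} g"
  shows "(\<lambda>x. g (w x) * v x) absolutely_integrable_on {-1..1}"
    "-1 \<le> a \<Longrightarrow> a \<le> b \<Longrightarrow> b \<le> 1 \<Longrightarrow>
       integral {a..b} (\<lambda>x. g (w x) * v x) = integral {c..w b} g - integral {c..w a} g"
proof -
  have rng: "w x \<in> {c..d}" if "x \<in> {-1..1}" for x using rng' that by blast
  note wD = ac_pairD[OF w]
  have gw: "continuous_on {-1..1} (\<lambda>x. g (w x))"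
    by (rule continuous_on_compose2[OF g wD(5)]) (use rng in auto)
  have "bounded ((\<lambda>x. g (w x)) ` {-1..1})"
    by (intro compact_imp_bounded compact_continuous_image[OF gw]) auto
  moreover have "(\<lambda>x. g (w x)) \<in> borel_measurable (lebesgue_on {-1..1})"
    by (intro continuous_imp_measurable_on_sets_lebesgue[OF gw]) auto
  ultimately show I: "(\<lambda>x. g (w x) * v x) absolutely_integrable_on {-1..1}"
    by (intro absolutely_integrable_bounded_measurable_product_real wD) auto
  define G where "G y = integral {c..y} g" for y
  have dG: "(G has_real_derivative g y) (at y within {c..d})" if "y \<in> {c..d}" for y
    unfolding G_def by (rule integral_has_real_derivative[OF g that])
  have int: "f integrable_on {s..t}" "(\<lambda>x. \<bar>f x\<bar>) integrable_on {s..t}"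
    if "f absolutely_integrable_on {-1..1}" "-1 \<le> s" "t \<le> 1" for f :: "real \<Rightarrow> real" and s t
  proof -
    have "f absolutely_integrable_on {s..t}"
      by (rule absolutely_integrable_on_subinterval[OF that(1)]) (use that in auto)
    then show "f integrable_on {s..t}" "(\<lambda>x. \<bar>f x\<bar>) integrable_on {s..t}"
      by (auto simp: absolutely_integrable_on_def)
  qed
  let ?f = "\<lambda>x. g (w x) * v x"
  assume ab: "-1 \<le> a" "a \<le> b" "b \<le> 1"
  have eps: "\<bar>G (w b) - G (w a) - integral {a..b} ?f\<bar> \<le> 2 * \<epsilon> * integral {a..b} (\<lambda>x. \<bar>v x\<bar>)"
    if \<epsilon>: "\<epsilon> > 0" for \<epsilon>
  proof -
    define P where "P s t \<longleftrightarrow> (a \<le> s \<longrightarrow> t \<le> b \<longrightarrow>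
      \<bar>G (w t) - G (w s) - integral {s..t} ?f\<bar> \<le> 2 * \<epsilon> * integral {s..t} (\<lambda>x. \<bar>v x\<bar>))" for s t
    have "P a b" using ab(2)
    \<comment> \<open>Bisection: the error bound survives concatenation and holds on all short
      intervals around any given point, hence on [a, b].\<close>
    proof (induction rule: Bolzano)
      case (trans s t r)
      show ?case unfolding P_def
      proof (intro impI)
        assume b: "a \<le> s" "r \<le> b"
        have 1: "integral {s..r} ?f = integral {s..t} ?f + integral {t..r} ?f"
          "integral {s..r} (\<lambda>x. \<bar>v x\<bar>) = integral {s..t} (\<lambda>x. \<bar>v x\<bar>) + integral {t..r} (\<lambda>x. \<bar>v x\<bar>)"
          using trans b ab by (auto intro!: Henstock_Kurzweil_Integration.integral_combine[symmetric] int(1)[OF I] int(2)[OF wD(1)])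
        have "\<bar>G (w t) - G (w s) - integral {s..t} ?f\<bar> \<le> 2 * \<epsilon> * integral {s..t} (\<lambda>x. \<bar>v x\<bar>)"
          "\<bar>G (w r) - G (w t) - integral {t..r} ?f\<bar> \<le> 2 * \<epsilon> * integral {t..r} (\<lambda>x. \<bar>v x\<bar>)"
          using trans b by (auto simp: P_def)
        then show "\<bar>G (w r) - G (w s) - integral {s..r} ?f\<bar> \<le> 2 * \<epsilon> * integral {s..r} (\<lambda>x. \<bar>v x\<bar>)"
          unfolding 1 distrib_left by linarith
      qed
    next
      case (local x)
      then have x: "x \<in> {-1..1}" using ab by auto
      obtain \<delta> where \<delta>: "\<delta> > 0" "\<And>y. y \<in> {c..d} \<Longrightarrow> \<bar>y - w x\<bar> < \<delta> \<Longrightarrow> \<bar>g y - g (w x)\<bar> < \<epsilon>"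
        using g rng[OF x] \<epsilon> unfolding continuous_on_iff dist_real_def by blast
      obtain \<rho> where \<rho>: "\<rho> > 0" "\<And>z. z \<in> {-1..1} \<Longrightarrow> \<bar>z - x\<bar> < \<rho> \<Longrightarrow> \<bar>w z - w x\<bar> < \<delta>"
        using wD(5) x \<delta>(1) unfolding continuous_on_iff dist_real_def by blast
      show ?case
      proof (intro exI[of _ \<rho>] conjI allI impI \<rho>(1))
        fix s t assume st: "s \<le> x \<and> x \<le> t \<and> t - s < \<rho>"
        show "P s t" unfolding P_def
        proof (intro impI)
          assume b: "a \<le> s" "t \<le> b"
          then have b': "-1 \<le> s" "t \<le> 1" "s \<le> t" using ab st by auto
          have near: "\<bar>w z - w x\<bar> < \<delta>" if "z \<in> {s..t}" for z
            using \<rho>(2)[of z] that st b' by auto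
          have vI: "v integrable_on {s..t}" "(\<lambda>x. \<bar>v x\<bar>) integrable_on {s..t}" "?f integrable_on {s..t}"
            using int[OF wD(1)] int[OF I] b' by auto
          have wv: "\<bar>w t - w s\<bar> \<le> integral {s..t} (\<lambda>x. \<bar>v x\<bar>)"
            using integral_norm_bound_integral[OF vI(1,2)] wD(6)[OF b'(1,3,2)] by auto
          have seg: "y \<in> {c..d} \<and> \<bar>y - w x\<bar> < \<delta>" if "y \<in> closed_segment (w s) (w t)" for y
            using that near[of s] near[of t] rng[of s] rng[of t] b'
            by (auto simp: closed_segment_eq_real_ivl split: if_splits)
          \<comment> \<open>\<open>G y - g (w x) * y\<close> has derivative
            \<open>g y - g (w x)\<close>, which is at most \<open>\<epsilon>\<close> in modulus
            between \<open>w s\<close> and \<open>w t\<close>.\<close>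
          have "norm ((G (w t) - g (w x) * w t) - (G (w s) - g (w x) * w s)) \<le> \<epsilon> * norm (w t - w s)"
          proof (rule field_differentiable_bound[where S = "closed_segment (w s) (w t)" and f' = "\<lambda>y. g y - g (w x)"])
            show "((\<lambda>y. G y - g (w x) * y) has_real_derivative g y - g (w x)) (at y within closed_segment (w s) (w t))"
              if y: "y \<in> closed_segment (w s) (w t)" for y
            proof -
              have "(G has_real_derivative g y) (at y within closed_segment (w s) (w t))"
                by (rule has_field_derivative_subset[OF dG]) (use seg y in auto)
              then show ?thesis by (auto intro!: derivative_eq_intros)
            qed
            show "norm (g y - g (w x)) \<le> \<epsilon>" if "y \<in> closed_segment (w s) (w t)" for y
              using \<delta>(2)[of y] seg[OF that] by auto
          qed auto
          also have "\<dots> \<le> \<epsilon> * integral {s..t} (\<lambda>x. \<bar>v x\<bar>)"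
            using wv \<epsilon> by (intro mult_left_mono) auto
          finally have 1: "\<bar>(G (w t) - G (w s)) - g (w x) * (w t - w s)\<bar> \<le> \<epsilon> * integral {s..t} (\<lambda>x. \<bar>v x\<bar>)"
            by (simp add: algebra_simps)
          have "norm (integral {s..t} (\<lambda>z. ?f z - g (w x) * v z)) \<le> integral {s..t} (\<lambda>z. \<epsilon> * \<bar>v z\<bar>)"
          proof (rule integral_norm_bound_integral)
            show "norm (?f z - g (w x) * v z) \<le> \<epsilon> * \<bar>v z\<bar>" if z: "z \<in> {s..t}" for z
            proof -
              have "\<bar>g (w z) - g (w x)\<bar> \<le> \<epsilon>"
                using \<delta>(2)[OF rng near[OF z]] z b' by (auto intro: less_imp_le)
              then have "\<bar>g (w z) - g (w x)\<bar> * \<bar>v z\<bar> \<le> \<epsilon> * \<bar>v z\<bar>" by (intro mult_right_mono) auto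
              then show ?thesis by (simp add: abs_mult flip: left_diff_distrib)
            qed
          qed (use vI in \<open>auto intro!: integrable_diff integrable_on_mult_right\<close>)
          also have "integral {s..t} (\<lambda>z. ?f z - g (w x) * v z) = integral {s..t} ?f - g (w x) * (w t - w s)"
            using vI wD(6)[OF b'(1,3,2)]
            by (subst Henstock_Kurzweil_Integration.integral_diff) (auto intro!: integrable_on_mult_right)
          finally have 2: "\<bar>integral {s..t} ?f - g (w x) * (w t - w s)\<bar> \<le> \<epsilon> * integral {s..t} (\<lambda>x. \<bar>v x\<bar>)"
            by simp
          show "\<bar>G (w t) - G (w s) - integral {s..t} ?f\<bar> \<le> 2 * \<epsilon> * integral {s..t} (\<lambda>x. \<bar>v x\<bar>)"
            using 1 2 by linarith
        qed
      qed
    qed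
    then show ?thesis by (simp add: P_def)
  qed
  have "G (w b) - G (w a) = integral {a..b} ?f"
  proof (rule ccontr)
    assume ne: "G (w b) - G (w a) \<noteq> integral {a..b} ?f"
    define D where "D = \<bar>G (w b) - G (w a) - integral {a..b} ?f\<bar>"
    define V where "V = integral {a..b} (\<lambda>x. \<bar>v x\<bar>)"
    have D: "D > 0" and V: "V \<ge> 0"
      using ne int(2)[OF wD(1)] ab by (auto simp: D_def V_def intro: Henstock_Kurzweil_Integration.integral_nonneg)
    have "D \<le> 2 * (D / (4 * (V + 1))) * V"
      using eps[of "D / (4 * (V + 1))"] D V by (auto simp: D_def V_def)
    also have "\<dots> = D / 2 * (V / (V + 1))" using V by (simp add: divide_simps)
    also have "\<dots> \<le> D / 2 * 1" using D V by (intro mult_left_mono) (auto simp: divide_simps)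
    also have "\<dots> < D" using D by simp
    finally show False by simp
  qed
  then show "integral {a..b} ?f = integral {c..w b} g - integral {c..w a} g" by (simp add: G_def)
qed

text \<open>The path starts at 0, visits \<open>w x1\<close> and \<open>w x2\<close> in some order
  and returns to 0. In terms of a primitive \<open>G\<close> of \<open>g\<close>, the three pieces
  contribute at least the distances between \<open>G 0\<close>, \<open>G (w x1)\<close> and
  \<open>G (w x2)\<close>, and by the triangle inequality their sum is at least twice the distance
  of the last two.\<close>

lemma weighted_variation_bound:
  assumes w: "ac_pair p w v" and rng': "w ` {-1..1} \<subseteq> {c..d}"
    and g: "continuous_on {c..d} g" "\<And>y. y \<in> {c..d} \<Longrightarrow> g y \<ge> 0"
    and x: "x1 \<in> {-1..1}" "x2 \<in> {-1..1}" and le: "w x2 \<le> w x1"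
  shows "(\<lambda>x. g (w x) * \<bar>v x\<bar>) absolutely_integrable_on {-1..1}"
    "2 * integral {w x2..w x1} g \<le> integral {-1..1} (\<lambda>x. g (w x) * \<bar>v x\<bar>)"
proof -
  have rng: "w x \<in> {c..d}" if "x \<in> {-1..1}" for x using rng' that by blast
  note ch = chain_rule_absolutely_continuous[OF w rng' g(1)]
  have eq: "\<bar>g (w x) * v x\<bar> = g (w x) * \<bar>v x\<bar>" if "x \<in> {-1..1}" for x
    using g(2)[OF rng[OF that]] by (simp add: abs_mult)
  have "(\<lambda>x. \<bar>g (w x) * v x\<bar>) absolutely_integrable_on {-1..1}"
    using ch(1) by (rule set_integrable_abs)
  then show I: "(\<lambda>x. g (w x) * \<bar>v x\<bar>) absolutely_integrable_on {-1..1}"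
    by (rule set_integrable_cong[THEN iffD1, rotated 3]) (use eq in auto)
  have i: "(\<lambda>x. g (w x) * \<bar>v x\<bar>) integrable_on {a..b}" if "-1 \<le> a" "b \<le> 1" for a b
    using absolutely_integrable_on_subinterval[OF I, of a b] that by (auto simp: absolutely_integrable_on_def)
  define G where "G y = integral {c..y} g" for y
  have seg: "\<bar>G (w b) - G (w a)\<bar> \<le> integral {a..b} (\<lambda>x. g (w x) * \<bar>v x\<bar>)" if ab: "-1 \<le> a" "a \<le> b" "b \<le> 1" for a b
  proof -
    have "(\<lambda>x. g (w x) * v x) integrable_on {a..b}"
      using absolutely_integrable_on_subinterval[OF ch(1), of a b] ab by (auto simp: absolutely_integrable_on_def)
    then have "norm (integral {a..b} (\<lambda>x. g (w x) * v x)) \<le> integral {a..b} (\<lambda>x. g (w x) * \<bar>v x\<bar>)"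
      by (rule integral_norm_bound_integral) (use i ab eq in auto)
    then show ?thesis using ch(2)[OF ab] by (simp add: G_def)
  qed
  have split: "integral {-1..1} (\<lambda>x. g (w x) * \<bar>v x\<bar>) = integral {-1..a} (\<lambda>x. g (w x) * \<bar>v x\<bar>) +
     integral {a..b} (\<lambda>x. g (w x) * \<bar>v x\<bar>) + integral {b..1} (\<lambda>x. g (w x) * \<bar>v x\<bar>)"
    if "-1 \<le> a" "a \<le> b" "b \<le> 1" for a b
    using Henstock_Kurzweil_Integration.integral_combine[of "-1" a b "\<lambda>x. g (w x) * \<bar>v x\<bar>"]
      Henstock_Kurzweil_Integration.integral_combine[of "-1" b 1 "\<lambda>x. g (w x) * \<bar>v x\<bar>"] that i by auto
  have "integral {c..w x2} g + integral {w x2..w x1} g = integral {c..w x1} g"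
    using rng[OF x(1)] rng[OF x(2)] le
    by (intro Henstock_Kurzweil_Integration.integral_combine integrable_continuous_real continuous_on_subset[OF g(1)]) auto
  then have d: "integral {w x2..w x1} g = G (w x1) - G (w x2)" by (simp add: G_def)
  have wb: "w (-1) = 0" "w 1 = 0" using ac_pairD[OF w] by auto
  show "2 * integral {w x2..w x1} g \<le> integral {-1..1} (\<lambda>x. g (w x) * \<bar>v x\<bar>)"
  proof (cases "x1 \<le> x2")
    case True
    then show ?thesis
      using split[of x1 x2] seg[of "-1" x1] seg[of x1 x2] seg[of x2 1] x unfolding d wb by (auto simp: abs_le_iff)
  next
    case False
    then show ?thesis
      using split[of x2 x1] seg[of "-1" x2] seg[of x2 x1] seg[of x1 1] x unfolding d wb by (auto simp: abs_le_iff)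
  qed
qed

section \<open>The energy inequality and traversal times\<close>

text \<open>Strict convexity of the power, from the mean value theorem. It serves twice: for the
  speed of \<open>u\<close> against \<open>h(u)\<close>, where the equality case fixes the speed,
  and for the nonlocal term with exponent \<open>p / r\<close>.\<close>

lemma powr_tangent:
  fixes a b p :: real
  assumes p: "p > 1" and ab: "a \<ge> 0" "b \<ge> 0"
  shows "a powr p \<ge> p * b powr (p - 1) * a - (p - 1) * b powr p"
    "a powr p = p * b powr (p - 1) * a - (p - 1) * b powr p \<Longrightarrow> a = b"
proof -
  have strict: "a powr p > p * b powr (p - 1) * a - (p - 1) * b powr p" if ne: "a \<noteq> b"
  proof (cases "a = 0 \<or> b = 0")
    case True
    then show ?thesis using ne ab p by auto
  next
    case False
    then have pos: "a > 0" "b > 0" using ab by auto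
    have b: "b powr p = b powr (p - 1) * b" using pos by (simp add: powr_mult_base mult.commute)
    have *: "\<exists>z. min a b < z \<and> z < max a b \<and> a powr p - b powr p = (a - b) * (p * z powr (p - 1))"
    proof -
      have d: "((\<lambda>x. x powr p) has_real_derivative p * z powr (p - 1)) (at z)" if "z > 0" for z
        using that by (auto intro!: derivative_eq_intros)
      show ?thesis
      proof (cases "a < b")
        case True
        then obtain z where "a < z" "z < b" "b powr p - a powr p = (b - a) * (p * z powr (p - 1))"
          using MVT2[OF True, of "\<lambda>x. x powr p" "\<lambda>z. p * z powr (p - 1)"] d pos by auto
        then show ?thesis by (intro exI[of _ z]) (auto simp: algebra_simps)
      next
        case False
        then have "b < a" using ne by simp
        then obtain z where "b < z" "z < a" "a powr p - b powr p = (a - b) * (p * z powr (p - 1))"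
          using MVT2[of b a "\<lambda>x. x powr p" "\<lambda>z. p * z powr (p - 1)"] d pos by auto
        then show ?thesis by (intro exI[of _ z]) auto
      qed
    qed
    then obtain z where z: "min a b < z" "z < max a b" "a powr p - b powr p = (a - b) * (p * z powr (p - 1))" by blast
    have "(a - b) * b powr (p - 1) < (a - b) * z powr (p - 1)"
    proof (cases "a < b")
      case True
      then show ?thesis using z p pos by (intro mult_strict_left_mono_neg powr_less_mono2) auto
    next
      case False
      then show ?thesis using z p pos ne by (intro mult_strict_left_mono powr_less_mono2) auto
    qed
    then have "p * ((a - b) * b powr (p - 1)) < p * ((a - b) * z powr (p - 1))"
      using p by simp
    then show ?thesis using z(3) b by (simp add: algebra_simps)
  qed
  have eq: "b powr p = p * b powr (p - 1) * b - (p - 1) * b powr p"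
  proof (cases "b = 0")
    case False
    then have "b powr p = b powr (p - 1) * b" using ab by (simp add: powr_mult_base mult.commute)
    then have "p * b powr (p - 1) * b = p * b powr p" by simp
    then show ?thesis by (simp add: left_diff_distrib)
  qed (use p in simp)
  show "a powr p \<ge> p * b powr (p - 1) * a - (p - 1) * b powr p"
    using strict eq by (cases "a = b") auto
  show "a powr p = p * b powr (p - 1) * a - (p - 1) * b powr p \<Longrightarrow> a = b"
    using strict by force
qed

definition spow :: "real \<Rightarrow> real \<Rightarrow> real" where
  "spow r y = sgn y * \<bar>y\<bar> powr r"

lemma spow_simps [simp]: "spow r 0 = 0" "spow r (- y) = - spow r y"
  by (auto simp: spow_def)

lemma spow_nonneg: "y \<ge> 0 \<Longrightarrow> spow r y = y powr r"
  by (auto simp: spow_def sgn_if)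

lemma spow_eq: "\<bar>y\<bar> powr (r - 1) * y = spow r y"
proof (cases "y = 0")
  case False
  then have "\<bar>y\<bar> powr r = \<bar>y\<bar> powr (r - 1) * \<bar>y\<bar>" by (simp add: powr_mult_base mult.commute)
  then show ?thesis by (auto simp: spow_def sgn_if)
qed simp

lemma abs_spow: "\<bar>spow r y\<bar> = \<bar>y\<bar> powr r"
  by (auto simp: spow_def abs_mult sgn_if)

lemma continuous_spow:
  assumes "continuous_on S (f :: real \<Rightarrow> real)" "r > 0"
  shows "continuous_on S (\<lambda>x. spow r (f x))"
proof -
  have "continuous_on UNIV (spow r)"
    unfolding continuous_on_eq_continuous_at[OF open_UNIV] isCont_def
  proof
    fix y :: real
    show "spow r \<midarrow>y\<rightarrow> spow r y"
    proof (cases "y = 0")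
      case True
      have "(\<lambda>y. \<bar>y\<bar> powr r) \<midarrow>0\<rightarrow> \<bar>0::real\<bar> powr r"
        by (intro tendsto_powr' tendsto_intros) (use assms in auto)
      then have "(\<lambda>y. \<bar>spow r y\<bar>) \<midarrow>0\<rightarrow> 0" by (simp add: abs_spow)
      then show ?thesis using True tendsto_rabs_zero_iff by auto
    next
      case False
      have "isCont (\<lambda>y. sgn y * \<bar>y\<bar> powr r) y"
        using False by (intro continuous_intros) auto
      then show ?thesis by (simp add: isCont_def spow_def[abs_def])
    qed
  qed
  then show ?thesis using assms(1) by (rule continuous_on_compose2) auto
qed

definition potential :: "real \<Rightarrow> real \<Rightarrow> real \<Rightarrow> real \<Rightarrow> real \<Rightarrow> real \<Rightarrow> real" where
  "potential p r L e c y = e - L * \<bar>y\<bar> powr p + c * spow r y"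

lemma continuous_potential:
  "p > 0 \<Longrightarrow> r > 0 \<Longrightarrow> continuous_on S (f :: real \<Rightarrow> real) \<Longrightarrow> continuous_on S (\<lambda>x. potential p r L e c (f x))"
  unfolding potential_def by (intro continuous_intros continuous_spow abs_powr_continuous)

lemma continuous_max_powr:
  assumes "continuous_on S (f :: real \<Rightarrow> real)" "s > 0"
  shows "continuous_on S (\<lambda>x. max 0 (f x) powr s)"
proof -
  have "continuous_on S (\<lambda>x. \<bar>max 0 (f x)\<bar> powr s)"
    by (intro abs_powr_continuous continuous_on_max assms continuous_intros)
  then show ?thesis by simp
qed

text \<open>\<open>E - B\<close> is the integral of the pointwise deficit \<open>Y\<close> plus
  \<open>p\<close> times the surplus of the weighted variation over its minimal value. Both are
  nonnegative, so \<open>E = B\<close> makes \<open>Y\<close> vanish almost everywhere. The term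
  \<open>2 * (p - 1) * e\<close> is \<open>p - 1\<close> times the integral of the constant
  \<open>e\<close> over (-1, 1).\<close>

lemma energy_lower_bound:
  assumes w: "ac_pair p w v" and p: "p > 1" and r: "r > 0"
    and rng: "w ` {-1..1} \<subseteq> {a..b}" and x: "x1 \<in> {-1..1}" "x2 \<in> {-1..1}" "w x1 = b" "w x2 = a"
    and K: "\<And>y. y \<in> {a..b} \<Longrightarrow> potential p r L e c y \<ge> 0"
  defines "E \<equiv> integral {-1..1} (\<lambda>x. \<bar>v x\<bar> powr p) - (p - 1) * L * integral {-1..1} (\<lambda>x. \<bar>w x\<bar> powr p) +
      (p - 1) * c * integral {-1..1} (\<lambda>x. spow r (w x))"
    and "B \<equiv> 2 * p * integral {a..b} (\<lambda>y. max 0 (potential p r L e c y) powr (1 - 1 / p)) - 2 * (p - 1) * e"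
  shows "E \<ge> B"
    "E = B \<Longrightarrow> AE x in lebesgue_on I_open. \<bar>v x\<bar> = max 0 (potential p r L e c (w x)) powr (1 / p)"
proof -
  let ?K = "potential p r L e c"
  note wD = ac_pairD[OF w]
  have rng': "w x \<in> {a..b}" if "x \<in> {-1..1}" for x using rng that by blast
  have p': "1 - 1 / p > 0" using p by simp
  define g where "g y = max 0 (?K y) powr (1 - 1 / p)" for y
  define Y where "Y x = \<bar>v x\<bar> powr p - p * (g (w x) * \<bar>v x\<bar>) + (p - 1) * ?K (w x)" for x
  have cg: "continuous_on {a..b} g" unfolding g_def
    using p p' r by (intro continuous_max_powr continuous_potential continuous_intros) auto
  have hp: "(max 0 (?K y) powr (1 / p)) powr p = ?K y" "(max 0 (?K y) powr (1 / p)) powr (p - 1) = g y"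
    if "y \<in> {a..b}" for y
    using K[OF that] p by (auto simp: powr_powr g_def diff_divide_distrib)
  have Y0: "Y x \<ge> 0" "Y x = 0 \<Longrightarrow> \<bar>v x\<bar> = max 0 (?K (w x)) powr (1 / p)" if x: "x \<in> {-1..1}" for x
    using powr_tangent[OF p abs_ge_zero[of "v x"] powr_ge_zero[of "max 0 (?K (w x))" "1 / p"]] hp[OF rng'[OF x]]
    by (auto simp: Y_def mult.assoc)
  have le: "w x2 \<le> w x1" using x rng' by auto
  note var = weighted_variation_bound[OF w rng cg _ x(1,2) le]
  have gv: "(\<lambda>x. g (w x) * \<bar>v x\<bar>) absolutely_integrable_on {-1..1}"
    and tv: "2 * integral {a..b} g \<le> integral {-1..1} (\<lambda>x. g (w x) * \<bar>v x\<bar>)"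
    using var x by (auto simp: g_def)
  have c: "continuous_on {-1..1} (\<lambda>x. \<bar>w x\<bar> powr p)" "continuous_on {-1..1} (\<lambda>x. spow r (w x))"
     "continuous_on {-1..1} (\<lambda>x. ?K (w x))"
    using p r wD(5) by (auto intro!: abs_powr_continuous continuous_spow continuous_potential)
  have Ya: "Y absolutely_integrable_on {-1..1}"
    unfolding Y_def using wD(2) gv absolutely_integrable_continuous_real[OF c(3)] by auto
  have i: "(\<lambda>x. \<bar>v x\<bar> powr p) integrable_on {-1..1}" "(\<lambda>x. g (w x) * \<bar>v x\<bar>) integrable_on {-1..1}"
    "(\<lambda>x. \<bar>w x\<bar> powr p) integrable_on {-1..1}" "(\<lambda>x. spow r (w x)) integrable_on {-1..1}"
    "(\<lambda>x. ?K (w x)) integrable_on {-1..1}"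
    using wD(2) gv c by (auto simp: absolutely_integrable_on_def intro: integrable_continuous_real)
  have ce: "((\<lambda>x::real. e) has_integral 2 * e) {-1..1}"
    using has_integral_const_real[of e "-1" 1] by simp
  have IK: "((\<lambda>x. ?K (w x)) has_integral (2 * e - L * integral {-1..1} (\<lambda>x. \<bar>w x\<bar> powr p) +
      c * integral {-1..1} (\<lambda>x. spow r (w x)))) {-1..1}"
    unfolding potential_def
    by (intro has_integral_add has_integral_diff has_integral_mult_right integrable_integral i ce)
  have "(Y has_integral (integral {-1..1} (\<lambda>x. \<bar>v x\<bar> powr p) - p * integral {-1..1} (\<lambda>x. g (w x) * \<bar>v x\<bar>) +
     (p - 1) * (2 * e - L * integral {-1..1} (\<lambda>x. \<bar>w x\<bar> powr p) + c * integral {-1..1} (\<lambda>x. spow r (w x))))) {-1..1}"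
    unfolding Y_def
    by (intro has_integral_add has_integral_diff has_integral_mult_right integrable_integral i IK)
  then have IY: "integral {-1..1} Y = E + 2 * (p - 1) * e - p * integral {-1..1} (\<lambda>x. g (w x) * \<bar>v x\<bar>)"
    unfolding E_def by (simp add: integral_unique algebra_simps)
  have Yn: "integral {-1..1} Y \<ge> 0"
    using Y0(1) Ya by (intro Henstock_Kurzweil_Integration.integral_nonneg) (auto simp: absolutely_integrable_on_def)
  have "p * (2 * integral {a..b} g) \<le> p * integral {-1..1} (\<lambda>x. g (w x) * \<bar>v x\<bar>)"
    using tv p by (intro mult_left_mono) auto
  then have EB: "E - B \<ge> integral {-1..1} Y"
    using IY by (simp add: B_def g_def[abs_def])
  with Yn show "E \<ge> B" by simp
  assume "E = B"
  then have "integral {-1..1} Y = 0" using EB Yn by simp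
  then have "(LINT x|lebesgue_on I_open. Y x) = 0" using LINT_I_open_eq[OF Ya] by simp
  then have "AE x in lebesgue_on I_open. Y x = 0"
    using Ya Y0(1) by (subst (asm) integral_nonneg_eq_0_iff_AE) (auto simp: integrable_I_open_iff)
  then show "AE x in lebesgue_on I_open. \<bar>v x\<bar> = max 0 (?K (w x)) powr (1 / p)"
    unfolding AE_I_open_iff
  proof eventually_elim
    case (elim x)
    then show ?case using Y0(2)[of x] by auto
  qed
qed

text \<open>At height \<open>y\<close> the speed is at most \<open>h y\<close>, so a height element
  dy takes at least dy / h(y) of time.\<close>

lemma traversal_time_bound:
  assumes w: "ac_pair p w v" and rng: "w ` {-1..1} \<subseteq> {c..d}"
    and h: "continuous_on {c..d} h" "\<And>y. y \<in> {c..d} \<Longrightarrow> h y \<ge> 0" "\<And>y. y \<in> {c<..<d} \<Longrightarrow> h y > 0"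
    and vh: "AE x in lebesgue_on I_open. \<bar>v x\<bar> \<le> h (w x)"
    and int: "(\<lambda>y. 1 / h y) integrable_on {c..d}"
    and st: "s \<in> {-1..1}" "t \<in> {-1..1}" "w s \<le> w t"
  shows "integral {w s..w t} (\<lambda>y. 1 / h y) \<le> \<bar>t - s\<bar>"
proof -
  have rng': "w x \<in> {c..d}" if "x \<in> {-1..1}" for x using rng that by blast
  note wD = ac_pairD[OF w]
  define N where "N = {x \<in> {-1..1}. \<not> \<bar>v x\<bar> \<le> h (w x)}"
  have N: "negligible N" unfolding N_def by (rule AE_I_open_negligible[OF vh])
  have sub: "{w s..w t} \<subseteq> {c..d}" using rng'[OF st(1)] rng'[OF st(2)] by auto
  \<comment> \<open>\<open>1 / h\<close> may be singular at the endpoints, so the chain rule is applied to this regularization.\<close>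
  define f where "f n y = 1 / (h y + inverse (real (Suc n)))" for n y
  have hpos: "h y + inverse (real (Suc n)) > 0" if "y \<in> {c..d}" for y n
    using h(2)[OF that] by (simp add: add_nonneg_pos)
  have cf: "continuous_on {c..d} (f n)" for n
    unfolding f_def using hpos by (intro continuous_intros h) (metis less_irrefl)
  have bound: "integral {w s..w t} (f n) \<le> \<bar>t - s\<bar>" for n
  proof -
    note ch = chain_rule_absolutely_continuous[OF w rng cf[of n]]
    have seg: "\<bar>integral {a..b} (\<lambda>x. f n (w x) * v x)\<bar> \<le> b - a" if ab: "-1 \<le> a" "a \<le> b" "b \<le> 1" for a b
    proof -
      have i: "(\<lambda>x. f n (w x) * v x) integrable_on {a..b}"
        using absolutely_integrable_on_subinterval[OF ch(1), of a b] ab by (auto simp: absolutely_integrable_on_def)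
      define k where "k x = (if x \<in> N then 0 else f n (w x) * v x)" for x
      have e: "integral {a..b} (\<lambda>x. f n (w x) * v x) = integral {a..b} k"
        by (rule integral_spike[OF N]) (auto simp: k_def)
      have ki: "k integrable_on {a..b}"
        by (rule integrable_spike[OF i N]) (auto simp: k_def)
      have "norm (integral {a..b} k) \<le> integral {a..b} (\<lambda>x. 1)"
      proof (rule integral_norm_bound_integral[OF ki])
        show "norm (k x) \<le> 1" if x: "x \<in> {a..b}" for x
        proof (cases "x \<in> N")
          case False
          then have v: "\<bar>v x\<bar> \<le> h (w x)" using x ab by (auto simp: N_def)
          have pos: "h (w x) + inverse (real (Suc n)) > 0" using hpos[OF rng'] x ab by auto
          have "\<bar>f n (w x) * v x\<bar> = \<bar>v x\<bar> / (h (w x) + inverse (real (Suc n)))"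
            using pos by (simp add: f_def abs_mult)
          also have "\<dots> \<le> 1" using v pos by (simp add: add_increasing2)
          finally show ?thesis using False by (simp add: k_def)
        qed (simp add: k_def)
      qed auto
      then show ?thesis using e ab by simp
    qed
    have "integral {c..w s} (f n) + integral {w s..w t} (f n) = integral {c..w t} (f n)"
      using rng'[OF st(1)] rng'[OF st(2)] st(3)
      by (intro Henstock_Kurzweil_Integration.integral_combine integrable_continuous_real continuous_on_subset[OF cf]) auto
    then have d: "integral {w s..w t} (f n) = integral {c..w t} (f n) - integral {c..w s} (f n)" by simp
    show ?thesis
    proof (cases "s \<le> t")
      case True
      then show ?thesis using ch(2)[of s t] seg[of s t] st d by auto
    next
      case False
      then show ?thesis using ch(2)[of t s] seg[of t s] st d by auto
    qed
  qed
  have "(\<lambda>n. integral {w s<..<w t} (f n)) \<longlonglongrightarrow> integral {w s<..<w t} (\<lambda>y. 1 / h y)"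
  proof (rule dominated_convergence(2)[where h = "\<lambda>y. 1 / h y"])
    have in': "y \<in> {c<..<d}" if "y \<in> {w s<..<w t}" for y
      using that rng'[OF st(1)] rng'[OF st(2)] by auto
    show "f n integrable_on {w s<..<w t}" for n
      using integrable_continuous_real[OF continuous_on_subset[OF cf sub]] by (simp add: integrable_on_open_interval_real)
    show "(\<lambda>y. 1 / h y) integrable_on {w s<..<w t}"
      using integrable_subinterval_real[OF int sub] by (simp add: integrable_on_open_interval_real)
    fix y assume y: "y \<in> {w s<..<w t}"
    note hy = h(3)[OF in'[OF y]]
    show "norm (f n y) \<le> 1 / h y" for n
      using hy by (auto simp: f_def intro!: divide_left_mono mult_pos_pos add_pos_pos)
    have "(\<lambda>n. 1 / (h y + inverse (real (Suc n)))) \<longlonglongrightarrow> 1 / (h y + 0)"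
      by (intro tendsto_intros LIMSEQ_inverse_real_of_nat) (use hy in auto)
    then show "(\<lambda>n. f n y) \<longlonglongrightarrow> 1 / h y" by (simp add: f_def)
  qed
  then have "integral {w s<..<w t} (\<lambda>y. 1 / h y) \<le> \<bar>t - s\<bar>"
    by (rule LIMSEQ_le_const2) (use bound in \<open>auto simp flip: integral_open_interval_real\<close>)
  then show ?thesis by (simp flip: integral_open_interval_real)
qed

text \<open>The climb from 0 to \<open>d\<close> lasts at least 1, so \<open>x1\<close> is at
  distance at least 1 from every zero of \<open>w\<close>. The zeros -1 and 1 force
  \<open>x1 = 0\<close>, and no interior point is that far from 0.\<close>

lemma positive_of_full_traversal:
  assumes w: "ac_pair p w v" and rng: "w ` {-1..1} \<subseteq> {0..d}"
    and h: "continuous_on {0..d} h" "\<And>y. y \<in> {0..d} \<Longrightarrow> h y \<ge> 0" "\<And>y. y \<in> {0<..<d} \<Longrightarrow> h y > 0"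
    and vh: "AE x in lebesgue_on I_open. \<bar>v x\<bar> \<le> h (w x)"
    and int: "((\<lambda>y. 1 / h y) has_integral 1) {0..d}"
    and x1: "x1 \<in> {-1..1}" "w x1 = d" and x: "x \<in> I_open"
  shows "0 < w x"
proof (rule ccontr)
  assume "\<not> 0 < w x"
  have "x \<in> {-1..1}" using x by auto
  with rng have "w x \<in> {0..d}" by blast
  with \<open>\<not> 0 < w x\<close> have wx: "w x = 0" by simp
  have wb: "w (-1) = 0" "w 1 = 0" using ac_pairD[OF w] by auto
  have d0: "0 \<le> d" using rng x1 by (metis atLeastAtMost_iff image_subset_iff)
  have i: "(\<lambda>y. 1 / h y) integrable_on {0..d}" "integral {0..d} (\<lambda>y. 1 / h y) = 1"
    using int by auto
  have b: "1 \<le> \<bar>x1 - s\<bar>" if "s \<in> {-1..1}" "w s = 0" for s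
    using traversal_time_bound[OF w rng h vh i(1) that(1) x1(1)] that x1 i d0 by auto
  show False using b[of "-1"] b[of 1] b[of x] wb wx x1(1) x by auto
qed

text \<open>In the time coordinate \<open>\<theta> = F (w x)\<close> the speed is at most 1. From 0
  to one extreme, on to the other and back to 0 costs 1/2 + 1 + 1/2 = 2, the whole length of the
  interval. So \<open>\<theta>\<close> is forced to be piecewise linear with slopes of modulus 1 and
  turning points -1/2 and 1/2, which is an odd function; \<open>F\<close> is odd and injective and
  transfers this to \<open>w\<close>.\<close>

lemma odd_of_full_traversal:
  assumes w: "ac_pair p w v" and rng: "w ` {-1..1} \<subseteq> {-d..d}"
    and h: "continuous_on {-d..d} h" "\<And>y. y \<in> {-d..d} \<Longrightarrow> h y \<ge> 0" "\<And>y. y \<in> {-d<..<d} \<Longrightarrow> h y > 0"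
    and even: "\<And>y. h (- y) = h y"
    and vh: "AE x in lebesgue_on I_open. \<bar>v x\<bar> \<le> h (w x)"
    and int: "((\<lambda>y. 1 / h y) has_integral 1 / 2) {0..d}" and d: "d > 0"
    and x: "x1 \<in> {-1..1}" "w x1 = d" "x2 \<in> {-1..1}" "w x2 = - d"
    and xx: "xx \<in> {-1..1}"
  shows "w (- xx) = - w xx"
proof -
  have int': "((\<lambda>y. 1 / h y) has_integral 1 / 2) {-d..0}"
    using has_integral_reflect_real[of "\<lambda>y. 1 / h y" "1/2" d 0] int even by simp
  have "((\<lambda>y. 1 / h y) has_integral 1 / 2 + 1 / 2) {-d..d}"
    by (rule has_integral_combine[OF _ _ int' int]) (use d in auto)
  then have i: "(\<lambda>y. 1 / h y) integrable_on {-d..d}" by auto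
  have ab: "(\<lambda>y. 1 / h y) integrable_on {a..b}" if "{a..b} \<subseteq> {-d..d}" for a b
    by (rule integrable_subinterval_real[OF i that])
  \<comment> \<open>Normalized to vanish at height 0, hence odd because \<open>h\<close> is
    even.\<close>
  define F where "F y = integral {-d..y} (\<lambda>y. 1 / h y) - 1 / 2" for y
  have Fd: "F b - F a = integral {a..b} (\<lambda>y. 1 / h y)" if "-d \<le> a" "a \<le> b" "b \<le> d" for a b
    using Henstock_Kurzweil_Integration.integral_combine[of "-d" a b "\<lambda>y. 1 / h y"] that ab[of "-d" b]
    by (auto simp: F_def)
  have F0: "F 0 = 0" using integral_unique[OF int'] by (simp add: F_def)
  have F1: "F (- d) = - 1 / 2" by (simp add: F_def)
  have F2: "F d = 1 / 2" using Fd[of 0 d] F0 d integral_unique[OF int] by simp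
  have Fodd: "F (- y) = - F y" if "y \<in> {-d..d}" for y
  proof -
    have *: "F (- y) = - F y" if "0 \<le> y" "y \<le> d" for y
    proof -
      have "integral {-y..0} (\<lambda>y. 1 / h (- y)) = integral {0..y} (\<lambda>y. 1 / h y)"
        using Henstock_Kurzweil_Integration.integral_reflect_real[of y 0 "\<lambda>y. 1 / h y"] by simp
      then show ?thesis using Fd[of "-y" 0] Fd[of 0 y] F0 that d even by simp
    qed
    show ?thesis using *[of y] *[of "-y"] that by (cases "0 \<le> y") auto
  qed
  have strict: "F a < F b" if ab': "-d \<le> a" "a < b" "b \<le> d" for a b
  proof -
    obtain M where M: "M > 0" "\<And>y. y \<in> {-d..d} \<Longrightarrow> h y \<le> M"
    proof -
      have "bounded (h ` {-d..d})" by (intro compact_imp_bounded compact_continuous_image h) auto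
      then show ?thesis using that by (auto simp: bounded_pos abs_le_iff)
    qed
    have "0 < (b - a) * (1 / M)" using ab' M by simp
    also have "\<dots> = integral {a<..<b} (\<lambda>y. 1 / M)" using ab' by (simp flip: integral_open_interval_real)
    also have "\<dots> \<le> integral {a<..<b} (\<lambda>y. 1 / h y)"
    proof (rule integral_le)
      show "(\<lambda>y. 1 / h y) integrable_on {a<..<b}" using ab[of a b] ab' by (simp add: integrable_on_open_interval_real)
      show "1 / M \<le> 1 / h y" if "y \<in> {a<..<b}" for y
        using h(3)[of y] M(2)[of y] that ab' by (intro divide_left_mono) auto
    qed (auto simp: integrable_on_open_interval_real intro: integrable_continuous_real)
    also have "\<dots> = F b - F a" using Fd[of a b] ab' by (simp flip: integral_open_interval_real)
    finally show ?thesis by simp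
  qed
  have rng': "-d \<le> w x" "w x \<le> d" if "x \<in> {-1..1}" for x using rng that by (auto simp: image_subset_iff)
  define \<theta> where "\<theta> x = F (w x)" for x
  have L: "\<bar>\<theta> t - \<theta> s\<bar> \<le> \<bar>t - s\<bar>" if "s \<in> {-1..1}" "t \<in> {-1..1}" for s t
  proof -
    have "\<bar>\<theta> t - \<theta> s\<bar> \<le> \<bar>t - s\<bar>" if le: "w s \<le> w t" "s \<in> {-1..1}" "t \<in> {-1..1}" for s t
      using traversal_time_bound[OF w rng h vh i le(2,3,1)] Fd[of "w s" "w t"] rng'[OF le(2)] rng'[OF le(3)] le
        Henstock_Kurzweil_Integration.integral_nonneg[OF ab[of "w s" "w t"]] h(2) by (auto simp: \<theta>_def)
    from this[of s t] this[of t s] that show ?thesis by (cases "w s \<le> w t") auto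
  qed
  have \<theta>b: "\<theta> (-1) = 0" "\<theta> 1 = 0" using ac_pairD[OF w] by (auto simp: \<theta>_def F0)
  have \<theta>x: "\<theta> x1 = 1 / 2" "\<theta> x2 = - 1 / 2" using x by (auto simp: \<theta>_def F1 F2)
  have "\<theta> (- xx) = - \<theta> xx"
  proof -
    have main: "f (- xx) = - f xx"
      if f: "\<And>s t. s \<in> {-1..1} \<Longrightarrow> t \<in> {-1..1} \<Longrightarrow> \<bar>f t - f s\<bar> \<le> \<bar>t - s\<bar>" "f (-1) = 0" "f 1 = 0"
        "f a = 1 / 2" "f b = - 1 / 2" "a \<in> {-1..1}" "b \<in> {-1..1}" "a \<le> b" for f :: "real \<Rightarrow> real" and a b
    proof -
      have ab: "a = - 1 / 2" "b = 1 / 2"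
        using f(1)[of "-1" a] f(1)[of a b] f(1)[of b 1] f(2-) by auto
      have *: "f s = (if s \<le> - 1 / 2 then s + 1 else if s \<le> 1 / 2 then - s else s - 1)" if "s \<in> {-1..1}" for s
        using f(1)[of "-1" s] f(1)[of s a] f(1)[of s b] f(1)[of s 1] that f(2-) ab by (auto simp: abs_if split: if_splits)
      show ?thesis using *[of xx] *[of "- xx"] xx by auto
    qed
    show ?thesis
    proof (cases "x1 \<le> x2")
      case True
      show ?thesis by (rule main[of \<theta> x1 x2]) (use L \<theta>b \<theta>x x True in auto)
    next
      case False
      \<comment> \<open>If the minimum comes before the maximum, the same argument applies to
        \<open>- \<theta>\<close>.\<close>
      have "- \<theta> (- xx) = - (- \<theta> xx)"
        by (rule main[of "\<lambda>x. - \<theta> x" x2 x1]) (use L \<theta>b \<theta>x x False in \<open>auto simp: abs_minus_commute\<close>)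
      then show ?thesis by simp
    qed
  qed
  then have "F (w (- xx)) = F (- w xx)"
    using Fodd[of "w xx"] rng'[OF xx] by (simp add: \<theta>_def)
  then show ?thesis
    using strict[of "w (- xx)" "- w xx"] strict[of "- w xx" "w (- xx)"] rng'[of "- xx"] rng'[of xx] xx
    by (cases "w (- xx)" "- w xx" rule: linorder_cases) auto
qed

section \<open>The time map of the extremal equation\<close>

lemma borel_imp_lebesgue_on:
  "f \<in> borel_measurable borel \<Longrightarrow> f \<in> borel_measurable (lebesgue_on S)"
  for f :: "real \<Rightarrow> real"
  by (intro measurable_restrict_space1 measurable_completion) simp

lemma integral_pos_Ioo:
  fixes f :: "real \<Rightarrow> real"
  assumes f: "f integrable_on {a<..<b}" and pos: "\<And>x. x \<in> {a<..<b} \<Longrightarrow> f x > 0" and ab: "a < b"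
  shows "integral {a<..<b} f > 0"
proof -
  have fa: "f absolutely_integrable_on {a<..<b}"
    using f pos by (intro nonnegative_absolutely_integrable_1) (auto intro: less_imp_le)
  then have fi: "integrable (lebesgue_on {a<..<b}) f" by (simp add: absolutely_integrable_imp_integrable)
  have ge: "integral {a<..<b} f \<ge> 0"
    using f pos by (intro Henstock_Kurzweil_Integration.integral_nonneg) (auto intro: less_imp_le)
  have "integral {a<..<b} f \<noteq> 0"
  proof
    assume "integral {a<..<b} f = 0"
    then have "(LINT x|lebesgue_on {a<..<b}. f x) = 0"
      using lebesgue_integral_eq_integral[OF fi] by simp
    then have "AE x in lebesgue_on {a<..<b}. f x = 0"
      using fi pos by (subst (asm) integral_nonneg_eq_0_iff_AE) (auto simp: less_imp_le)
    then have "AE x in lebesgue_on {a<..<b}. False"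
      by (rule AE_mp) (use pos in \<open>force intro!: AE_I2\<close>)
    then have "emeasure (lebesgue_on {a<..<b}) {a<..<b} = 0"
      by (subst (asm) AE_iff_measurable[where N = "{a<..<b}"]) (auto simp: sets_restrict_space)
    then show False using ab by (simp add: emeasure_restrict_space)
  qed
  with ge show ?thesis by simp
qed

text \<open>On [0, 1] one has \<open>s powr p \<le> s\<close>, so the integrand is dominated by
  \<open>(1 - s) powr (- (1 / p))\<close>, whose exponent exceeds -1.\<close>

lemma arc_integrand_integrable:
  assumes p: "p \<ge> (2::real)"
  shows "(\<lambda>s. (1 - s powr p) powr (- (1 / p))) integrable_on {0..1}"
proof -
  define q where "q = 1 - 1 / p"
  have q: "q > 0" "q - 1 = - (1 / p)" using p by (auto simp: q_def)
  have "((\<lambda>s. (1 - s) powr (- (1 / p))) has_integral (- ((1 - 1) powr q / q) - (- ((1 - 0) powr q / q)))) {0..1}"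
  proof (rule fundamental_theorem_of_calculus_interior)
    show "continuous_on {0..1} (\<lambda>s. - ((1 - s) powr q / q))"
      using q by (intro continuous_intros continuous_on_powr') auto
    fix x :: real assume x: "x \<in> {0<..<1}"
    have "((\<lambda>s. - ((1 - s) powr q / q)) has_real_derivative (1 - x) powr (q - 1)) (at x)"
      using x q(1) by (auto intro!: derivative_eq_intros)
    then show "((\<lambda>s. - ((1 - s) powr q / q)) has_vector_derivative (1 - x) powr (- (1 / p))) (at x)"
      by (simp add: has_real_derivative_iff_has_vector_derivative q)
  qed simp
  then have i: "(\<lambda>s. (1 - s) powr (- (1 / p))) integrable_on {0..1}" by blast
  show ?thesis
  proof (rule measurable_bounded_by_integrable_imp_integrable[OF _ i])
    show "(\<lambda>s. (1 - s powr p) powr (- (1 / p))) \<in> borel_measurable (lebesgue_on {0..1})"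
      by (intro borel_imp_lebesgue_on) measurable
    show "norm ((1 - s powr p) powr (- (1 / p))) \<le> (1 - s) powr (- (1 / p))" if s: "s \<in> {0..1}" for s :: real
    proof (cases "s = 1")
      case False
      have "s powr p \<le> s powr 1" using s p by (intro powr_mono') auto
      then show ?thesis using s p False by (auto intro!: powr_mono2')
    qed simp
  qed simp
qed

definition arc_const :: "real \<Rightarrow> real" where
  "arc_const p = integral {0..1} (\<lambda>s. (1 - s powr p) powr (- (1 / p)))"

lemma arc_const_pos: "p \<ge> 2 \<Longrightarrow> arc_const p > 0"
proof -
  assume p: "p \<ge> 2"
  have "integral {0<..<1} (\<lambda>s::real. (1 - s powr p) powr (- (1 / p))) > 0"
  proof (rule integral_pos_Ioo)
    show "(\<lambda>s. (1 - s powr p) powr (- (1 / p))) integrable_on {0<..<1}"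
      using arc_integrand_integrable[OF p] by (simp add: integrable_on_open_interval_real)
    show "(1 - s powr p) powr (- (1 / p)) > 0" if "s \<in> {0<..<1}" for s :: real
      using that p powr_less_mono2[of p s 1] by simp
  qed simp
  then show ?thesis by (simp add: arc_const_def flip: integral_open_interval_real)
qed

text \<open>Stretching by the amplitude \<open>m\<close> reduces the integral to
  \<open>arc_const\<close>, and the powers of \<open>\<tau>\<close> cancel: without the term in
  \<open>c\<close> the motion is isochronous, every level takes the same time.\<close>

lemma scaled_arc_has_integral:
  assumes p: "p \<ge> 2" and L: "L > 0" and \<tau>: "\<tau> > 0"
  shows "((\<lambda>y. (\<tau> - L * y powr p) powr (- (1 / p))) has_integral arc_const p / L powr (1 / p)) {0..(\<tau> / L) powr (1 / p)}"
proof -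
  define m where "m = (\<tau> / L) powr (1 / p)"
  have m: "m > 0" "L * m powr p = \<tau>" using L \<tau> p by (auto simp: m_def powr_powr)
  have "((\<lambda>s. (1 - s powr p) powr (- (1 / p))) has_integral arc_const p) {0..1}"
    unfolding arc_const_def using arc_integrand_integrable[OF p] by (rule integrable_integral)
  from has_integral_stretch_real[OF this, of "1 / m"] m
  have "((\<lambda>y. (1 - (y / m) powr p) powr (- (1 / p))) has_integral m * arc_const p) ((\<lambda>x. x * m) ` {0..1})"
    by simp
  moreover have "(\<lambda>x. x * m) ` {0..1} = {0..m}"
  proof (intro equalityI subsetI)
    show "y \<in> (\<lambda>x. x * m) ` {0..1}" if "y \<in> {0..m}" for y
      using that m by (intro image_eqI[of _ _ "y / m"]) auto
  qed (use m in \<open>auto intro: mult_left_le_one_le simp: mult.commute\<close>)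
  ultimately have "((\<lambda>y. \<tau> powr (- (1 / p)) * (1 - (y / m) powr p) powr (- (1 / p))) has_integral
      \<tau> powr (- (1 / p)) * (m * arc_const p)) {0..m}"
    by (intro has_integral_mult_right) simp
  moreover have "\<tau> powr (- (1 / p)) * (1 - (y / m) powr p) powr (- (1 / p)) = (\<tau> - L * y powr p) powr (- (1 / p))"
    if y: "y \<in> {0..m}" for y
  proof -
    have "(y / m) powr p \<le> 1 powr p" using y m p by (intro powr_mono2) auto
    then have "\<tau> powr (- (1 / p)) * (1 - (y / m) powr p) powr (- (1 / p)) = (\<tau> * (1 - (y / m) powr p)) powr (- (1 / p))"
      using \<tau> by (simp add: powr_mult)
    also have "\<tau> * (1 - (y / m) powr p) = \<tau> - L * y powr p"
      using y m by (simp add: powr_divide algebra_simps flip: m(2))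
    finally show ?thesis .
  qed
  ultimately have "((\<lambda>y. (\<tau> - L * y powr p) powr (- (1 / p))) has_integral \<tau> powr (- (1 / p)) * (m * arc_const p)) {0..m}"
    by (rule has_integral_eq[rotated])
  moreover have "\<tau> powr (- (1 / p)) * (m * arc_const p) = arc_const p / L powr (1 / p)"
    using L \<tau> by (simp add: m_def powr_divide powr_minus field_simps)
  ultimately show ?thesis by (simp add: m_def)
qed

section \<open>The constants \<open>pi_p\<close> and \<open>L\<close>\<close>

lemma F_p_eq:
  assumes p: "p \<ge> 2" and x: "0 \<le> x" "x \<le> (p - 1) powr (1 / p)"
  shows "F_p p x = integral {0..x} (\<lambda>t. (1 - t powr p / (p - 1)) powr (- (1 / p)))"
  unfolding F_p_def
  by (intro integral_cong) (simp add: powr_minus divide_inverse)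

lemma pi_p_eq:
  assumes p: "p \<ge> 2"
  shows "pi_p p = 2 * ((p - 1) powr (1 / p) * arc_const p)" "pi_p p > 0"
proof -
  have "integral {0..(p - 1) powr (1 / p)} (\<lambda>t. (1 - t powr p / (p - 1)) powr (- (1 / p))) =
      arc_const p / (1 / (p - 1)) powr (1 / p)"
    using scaled_arc_has_integral[OF p, of "1 / (p - 1)" 1] p
    by (simp add: integral_unique)
  then show "pi_p p = 2 * ((p - 1) powr (1 / p) * arc_const p)"
    using p by (simp add: pi_p_def F_p_eq powr_divide)
  then show "pi_p p > 0" using p arc_const_pos[OF p] by simp
qed

text \<open>The \<open>L\<close> of the overview. Its p-th root is \<open>2 * arc_const p\<close>,
  so an arc from 0 to its maximum takes time 1/2 when the term in \<open>c\<close> is absent, and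
  four such arcs fill (-1, 1).\<close>

definition eig_const :: "real \<Rightarrow> real" where
  "eig_const p = pi_p p powr p / (p - 1)"

lemma eig_const:
  assumes p: "p \<ge> 2"
  shows "eig_const p > 0" "pi_p p powr p = (p - 1) * eig_const p" "eig_const p powr (1 / p) = 2 * arc_const p"
proof -
  have "pi_p p powr p = (p - 1) * (2 * arc_const p) powr p"
    using p arc_const_pos[OF p] by (simp add: pi_p_eq powr_mult powr_powr)
  then have *: "eig_const p = (2 * arc_const p) powr p" using p by (simp add: eig_const_def)
  show "eig_const p > 0" using arc_const_pos[OF p] by (simp add: *)
  show "eig_const p powr (1 / p) = 2 * arc_const p" using arc_const_pos[OF p] p by (simp add: * powr_powr)
  show "pi_p p powr p = (p - 1) * eig_const p" using p by (simp add: eig_const_def)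
qed

lemma half_period_integral:
  assumes p: "p \<ge> 2" and \<tau>: "\<tau> > 0"
  shows "((\<lambda>y. (\<tau> - eig_const p * y powr p) powr (- (1 / p))) has_integral 1 / 2) {0..(\<tau> / eig_const p) powr (1 / p)}"
  using scaled_arc_has_integral[OF p eig_const(1)[OF p] \<tau>] arc_const_pos[OF p] by (simp add: eig_const[OF p])

text \<open>\<open>A\<close> and \<open>B\<close> arise as
  \<open>\<tau> / (\<tau> + c * y powr r)\<close> and
  \<open>\<tau> / (\<tau> - c * z powr r)\<close> at the two points, one on each half line, that the
  substitution sends to the same \<open>t\<close>, with \<open>\<rho> = r / p\<close>. The two
  reciprocals in the conclusion are the factors by which the substitution distorts the time
  integrand.\<close>

lemma pairing_inequality:
  fixes A B \<rho> :: real
  assumes \<rho>: "1 / 2 \<le> \<rho>" "\<rho> \<le> 1" and A: "0 < A" "A < 1" and B: "1 < B"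
    and eq: "(1 - A) * A powr (\<rho> - 1) = (B - 1) * B powr (\<rho> - 1)"
  shows "1 / (1 - \<rho> + \<rho> * A) + 1 / (1 - \<rho> + \<rho> * B) \<ge> 2"
    "1 / 2 < \<rho> \<Longrightarrow> 1 / (1 - \<rho> + \<rho> * A) + 1 / (1 - \<rho> + \<rho> * B) > 2"
proof -
  \<comment> \<open>In these variables the hypothesis is \<open>X\<^bsup>\<rho>\<^esup>(X - 1)\<^bsup>1-\<rho>\<^esup> = Y\<^bsup>\<rho>\<^esup>(Y + 1)\<^bsup>1-\<rho>\<^esup>\<close> and the claim is \<open>X \<le> Y + 2\<rho>\<close>.\<close>
  define X Y where "X = 1 / (1 - A)" and "Y = 1 / (B - 1)"
  have X: "X > 1" "A = (X - 1) / X" "1 - A = 1 / X" using A by (auto simp: X_def field_simps)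
  have Y: "Y > 0" "B = (Y + 1) / Y" "B - 1 = 1 / Y" using B by (auto simp: Y_def field_simps)
  have pX: "X powr \<rho> * (X - 1) powr (1 - \<rho>) * ((1 - A) * A powr (\<rho> - 1)) = 1"
  proof -
    have "A powr (\<rho> - 1) = (X - 1) powr (\<rho> - 1) * X powr (1 - \<rho>)"
      using X by (simp add: powr_divide powr_minus_divide[of X "\<rho> - 1", simplified])
    then have "X powr \<rho> * (X - 1) powr (1 - \<rho>) * ((1 - A) * A powr (\<rho> - 1)) =
       (X powr \<rho> * X powr (1 - \<rho>)) * ((X - 1) powr (1 - \<rho>) * (X - 1) powr (\<rho> - 1)) * (1 - A)" by simp
    also have "\<dots> = 1" using X by (simp add: X(3) flip: powr_add)
    finally show ?thesis .
  qed
  have pY: "Y powr \<rho> * (Y + 1) powr (1 - \<rho>) * ((B - 1) * B powr (\<rho> - 1)) = 1"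
  proof -
    have "B powr (\<rho> - 1) = (Y + 1) powr (\<rho> - 1) * Y powr (1 - \<rho>)"
      using Y by (simp add: powr_divide powr_minus_divide[of Y "\<rho> - 1", simplified])
    then have "Y powr \<rho> * (Y + 1) powr (1 - \<rho>) * ((B - 1) * B powr (\<rho> - 1)) =
       (Y powr \<rho> * Y powr (1 - \<rho>)) * ((Y + 1) powr (1 - \<rho>) * (Y + 1) powr (\<rho> - 1)) * (B - 1)" by simp
    also have "\<dots> = 1" using Y by (simp add: Y(3) flip: powr_add)
    finally show ?thesis .
  qed
  have eq': "X powr \<rho> * (X - 1) powr (1 - \<rho>) = Y powr \<rho> * (Y + 1) powr (1 - \<rho>)"
  proof -
    have "(1 - A) * A powr (\<rho> - 1) \<noteq> 0" using A by simp
    then show ?thesis using pX pY eq by (metis mult_right_cancel)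
  qed
  \<comment> \<open>The hypothesis \<open>\<rho> \<ge> 1 / 2\<close> enters twice: here it makes the
    exponent \<open>2 * \<rho> - 1\<close> nonnegative, and afterwards it gives
    \<open>Y + 1 \<le> Y + 2 * \<rho>\<close>, strictly for \<open>\<rho> > 1 / 2\<close>.\<close>
  have XY: "\<not> X > Y + 1"
  proof
    assume gt: "X > Y + 1"
    have "Y powr \<rho> * (Y + 1) powr (1 - \<rho>) = (Y powr (2 * \<rho> - 1) * Y powr (1 - \<rho>)) * (Y + 1) powr (1 - \<rho>)"
      using Y by (simp flip: powr_add)
    also have "\<dots> \<le> ((Y + 1) powr (2 * \<rho> - 1) * Y powr (1 - \<rho>)) * (Y + 1) powr (1 - \<rho>)"
      using Y \<rho> by (intro mult_right_mono powr_mono2) auto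
    also have "\<dots> = (Y + 1) powr \<rho> * Y powr (1 - \<rho>)"
      using Y by (simp add: mult.commute mult.left_commute flip: powr_add)
    also have "\<dots> < X powr \<rho> * Y powr (1 - \<rho>)"
      using gt Y \<rho> by (intro mult_strict_right_mono powr_less_mono2) auto
    also have "\<dots> \<le> X powr \<rho> * (X - 1) powr (1 - \<rho>)"
      using gt Y \<rho> by (intro mult_left_mono powr_mono2) auto
    finally show False using eq' by simp
  qed
  have e: "1 / (1 - \<rho> + \<rho> * A) + 1 / (1 - \<rho> + \<rho> * B) = 2 + \<rho> * (1 / (X - \<rho>) - 1 / (Y + \<rho>))"
  proof -
    have d: "X - \<rho> > 0" "Y + \<rho> > 0" using X Y \<rho> by auto
    have "1 - \<rho> + \<rho> * A = 1 - \<rho> * (1 - A)" by (simp add: algebra_simps)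
    also have "\<dots> = (X - \<rho>) / X" unfolding X(3) using X(1) by (simp add: diff_divide_distrib)
    finally have a: "1 - \<rho> + \<rho> * A = (X - \<rho>) / X" .
    have "1 - \<rho> + \<rho> * B = 1 + \<rho> * (B - 1)" by (simp add: algebra_simps)
    also have "\<dots> = (Y + \<rho>) / Y" unfolding Y(3) using Y(1) by (simp add: add_divide_distrib)
    finally have b: "1 - \<rho> + \<rho> * B = (Y + \<rho>) / Y" .
    have "1 / (1 - \<rho> + \<rho> * A) = 1 + \<rho> * (1 / (X - \<rho>))" unfolding a using d by (simp add: field_simps)
    moreover have "1 / (1 - \<rho> + \<rho> * B) = 1 - \<rho> * (1 / (Y + \<rho>))" unfolding b using d by (simp add: field_simps)
    ultimately show ?thesis by (simp add: algebra_simps)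
  qed
  show "1 / (1 - \<rho> + \<rho> * A) + 1 / (1 - \<rho> + \<rho> * B) \<ge> 2"
  proof -
    have "1 / (Y + \<rho>) \<le> 1 / (X - \<rho>)" using XY X Y \<rho> by (intro divide_left_mono) auto
    then show ?thesis unfolding e using \<rho> by simp
  qed
  show "1 / (1 - \<rho> + \<rho> * A) + 1 / (1 - \<rho> + \<rho> * B) > 2" if "1 / 2 < \<rho>"
  proof -
    have "1 / (Y + \<rho>) < 1 / (X - \<rho>)" using XY X Y \<rho> that by (intro divide_strict_left_mono) auto
    then show ?thesis unfolding e using \<rho> by simp
  qed
qed

text \<open>The substitution is \<open>t = y A(y)\<^bsup>1/p\<^esup>\<close>; it satisfies \<open>\<tau> - L t\<^sup>p = A(y) (\<tau> - L y\<^sup>p + c y\<^sup>r)\<close>.\<close>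

lemma half_line_substitution:
  fixes p r L \<tau> c m :: real
  assumes p: "p \<ge> 2" and r: "r > 0" "r \<le> p" and L: "L > 0" and \<tau>: "\<tau> > 0" and m: "m > 0"
    and root: "\<tau> - L * m powr p + c * m powr r = 0"
    and int: "(\<lambda>y. (\<tau> - L * y powr p + c * y powr r) powr (- (1 / p))) absolutely_integrable_on {0<..<m}"
  defines "A \<equiv> \<lambda>y. \<tau> / (\<tau> + c * y powr r)" and "m0 \<equiv> (\<tau> / L) powr (1 / p)"
  obtains \<psi> where
    "\<And>t. t \<in> {0<..<m0} \<Longrightarrow> \<exists>y\<in>{0<..<m}. \<tau> + c * y powr r > 0 \<and> y * A y powr (1 / p) = t \<and>
       \<psi> t = 1 / (1 - r / p + r / p * A y)"
    "((\<lambda>t. (\<tau> - L * t powr p) powr (- (1 / p)) * \<psi> t) has_integral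
        integral {0<..<m} (\<lambda>y. (\<tau> - L * y powr p + c * y powr r) powr (- (1 / p)))) {0<..<m0}"
proof -
  \<comment> \<open>For \<open>c < 0\<close> this denominator decreases on [0, m] and, by the root
    equation, ends at \<open>L * m powr p > 0\<close>.\<close>
  define D where "D y = \<tau> + c * y powr r" for y
  have D: "D y > 0" if "y \<in> {0..m}" for y
  proof (cases "c \<ge> 0")
    case True then show ?thesis using \<tau> by (simp add: D_def add_pos_nonneg)
  next
    case False
    have "c * m powr r \<le> c * y powr r"
      using that False r by (intro mult_left_mono_neg powr_mono2) auto
    moreover have "L * m powr p > 0" using L m by simp
    ultimately show ?thesis using root by (simp add: D_def)
  qed
  have A: "A y > 0" if "y \<in> {0..m}" for y using D[OF that] \<tau> by (simp add: A_def D_def)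
  define g where "g y = y * A y powr (1 / p)" for y
  \<comment> \<open>The derivative of \<open>g\<close>. Its last factor, positive because
    \<open>r \<le> p\<close>, measures how far \<open>g\<close> departs from a scaling and is the
    reciprocal of \<open>\<psi>\<close>.\<close>
  define g' where "g' y = A y powr (1 / p) * (1 - r / p + r / p * A y)" for y
  have rp: "0 < 1 - r / p + r / p * A y" if "y \<in> {0..m}" for y
  proof -
    have "r / p \<le> 1" using p r by simp
    then show ?thesis using A[OF that] p r by (cases "r / p = 1") (auto simp: add_pos_nonneg)
  qed
  have g'pos: "g' y > 0" if "y \<in> {0..m}" for y
    using A[OF that] rp[OF that] by (simp add: g'_def)
  have dg: "(g has_real_derivative g' y) (at y)" if y: "y \<in> {0<..<m}" for y
  proof -
    have y': "y > 0" "y \<in> {0..m}" using y by auto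
    have dD: "(D has_real_derivative c * (r * y powr (r - 1))) (at y)"
      unfolding D_def using y' by (auto intro!: derivative_eq_intros)
    have "(A has_real_derivative - (\<tau> * (c * (r * y powr (r - 1)))) / (D y)\<^sup>2) (at y)"
      unfolding A_def D_def[symmetric] using dD D[OF y'(2)]
      by (auto intro!: derivative_eq_intros simp: power2_eq_square)
    from DERIV_fun_powr[OF this A[OF y'(2)], of "1 / p"]
    have "((\<lambda>y. A y powr (1 / p)) has_real_derivative
        1 / p * A y powr (1 / p - 1) * (- (\<tau> * (c * (r * y powr (r - 1)))) / (D y)\<^sup>2)) (at y)" by simp
    from DERIV_mult[OF DERIV_ident this]
    have "(g has_real_derivative 1 * A y powr (1 / p) +
        1 / p * A y powr (1 / p - 1) * (- (\<tau> * (c * (r * y powr (r - 1)))) / (D y)\<^sup>2) * y) (at y)"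
      unfolding g_def by simp
    moreover have "1 * A y powr (1 / p) +
        1 / p * A y powr (1 / p - 1) * (- (\<tau> * (c * (r * y powr (r - 1)))) / (D y)\<^sup>2) * y = g' y"
    proof -
      have 1: "A y powr (1 / p - 1) = A y powr (1 / p) * (D y / \<tau>)"
        using A[OF y'(2)] D[OF y'(2)] \<tau> by (simp add: powr_diff A_def flip: D_def)
      have 2: "y powr (r - 1) * y = y powr r" using y' by (simp add: powr_mult_base mult.commute)
      have 3: "c * y powr r / D y = 1 - A y" using D[OF y'(2)] by (simp add: A_def D_def field_simps)
      have "1 / p * A y powr (1 / p - 1) * (- (\<tau> * (c * (r * y powr (r - 1)))) / (D y)\<^sup>2) * y
         = - (r / p * A y powr (1 / p) * (c * (y powr (r - 1) * y) / D y))"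
        unfolding 1 using D[OF y'(2)] \<tau> by (simp add: power2_eq_square field_simps)
      also have "\<dots> = - (r / p * A y powr (1 / p) * (1 - A y))" unfolding 2 3 ..
      finally have e: "1 / p * A y powr (1 / p - 1) * (- (\<tau> * (c * (r * y powr (r - 1)))) / (D y)\<^sup>2) * y =
        - (r / p * A y powr (1 / p) * (1 - A y))" .
      show ?thesis unfolding e g'_def by (simp only: algebra_simps mult_1)
    qed
    ultimately show ?thesis by simp
  qed
  have cg: "continuous_on {0..m} g"
  proof -
    have pr: "continuous_on {0..m} (\<lambda>y. y powr r)"
      using r by (intro continuous_on_powr' continuous_intros) auto
    have "continuous_on {0..m} A"
      unfolding A_def using D
      by (intro continuous_on_divide continuous_on_add continuous_on_mult continuous_on_const pr) (force simp: D_def)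
    then show ?thesis unfolding g_def
      using A by (intro continuous_intros) force+
  qed
  have mono: "g a < g b" if "0 \<le> a" "a < b" "b \<le> m" for a b
  proof (rule DERIV_pos_imp_increasing_open[OF that(2)])
    show "\<exists>y. (g has_real_derivative y) (at x) \<and> 0 < y" if "a < x" "x < b" for x
      using dg[of x] g'pos[of x] that \<open>0 \<le> a\<close> \<open>b \<le> m\<close> by auto
    show "continuous_on {a..b} g" by (rule continuous_on_subset[OF cg]) (use that in auto)
  qed
  have gm: "g m = m0"
  proof -
    have Am: "A m = (\<tau> / L) * m powr (- p)"
    proof -
      have "D m = L * m powr p" using root by (simp add: D_def)
      then show ?thesis by (simp add: A_def D_def powr_minus field_simps)
    qed
    have "A m powr (1 / p) = m0 * (m powr (- p)) powr (1 / p)"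
      unfolding Am m0_def by (rule powr_mult)
    then have "A m powr (1 / p) = m0 * m powr (- 1)" using p by (simp add: powr_powr)
    then show ?thesis using m by (simp add: g_def powr_minus)
  qed
  have img: "g ` {0<..<m} = {0<..<m0}"
  proof (intro equalityI subsetI)
    fix t assume "t \<in> g ` {0<..<m}"
    then show "t \<in> {0<..<m0}" using mono[of 0] mono[of _ m] gm by (auto simp: g_def)
  next
    fix t assume t: "t \<in> {0<..<m0}"
    have "\<exists>y. 0 \<le> y \<and> y \<le> m \<and> g y = t"
      by (rule IVT') (use t m gm cg in \<open>auto simp: g_def\<close>)
    then obtain y where y: "0 \<le> y" "y \<le> m" "g y = t" by blast
    moreover have "y \<noteq> 0" "y \<noteq> m" using y t gm by (auto simp: g_def)
    ultimately show "t \<in> g ` {0<..<m}" by force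
  qed
  have inj: "inj_on g {0<..<m}"
  proof (rule linorder_inj_onI)
    show "g x \<noteq> g y" if "x < y" "x \<in> {0<..<m}" "y \<in> {0<..<m}" for x y
      using mono[of x y] that by auto
  qed auto
  define \<psi> where "\<psi> t = 1 / (1 - r / p + r / p * A (inv_into {0<..<m} g t))" for t
  let ?k = "\<lambda>y. (\<tau> - L * y powr p + c * y powr r) powr (- (1 / p))"
  define f where "f t = (\<tau> - L * t powr p) powr (- (1 / p)) * \<psi> t" for t
  \<comment> \<open>The power of \<open>A y\<close> in \<open>g'\<close> cancels the one from the
    transformed potential, and \<open>\<psi>\<close> cancels the last factor of \<open>g'\<close>,
    so what remains is the original time integrand.\<close>
  have eq: "\<bar>g' y\<bar> * f (g y) = ?k y" if y: "y \<in> {0<..<m}" for y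
  proof -
    have y': "y \<in> {0..m}" "y > 0" using y by auto
    have inv: "inv_into {0<..<m} g (g y) = y" by (rule inv_into_f_f[OF inj y])
    have "g y powr p = y powr p * A y"
      using y' A[OF y'(1)] p by (simp add: g_def powr_mult powr_powr)
    then have K: "\<tau> - L * g y powr p = A y * (\<tau> - L * y powr p + c * y powr r)"
      using D[OF y'(1)] by (simp add: A_def D_def field_simps)
    have "g y < m0" "0 < g y" using img y by auto
    then have "g y powr p < m0 powr p" using p by (intro powr_less_mono2) auto
    then have "\<tau> - L * g y powr p > 0" using L \<tau> p by (simp add: m0_def powr_powr field_simps)
    then have "\<tau> - L * y powr p + c * y powr r > 0"
      unfolding K using A[OF y'(1)] by (simp add: zero_less_mult_iff)
    then have "f (g y) = A y powr (- (1 / p)) * ?k y / (1 - r / p + r / p * A y)"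
      unfolding f_def K \<psi>_def inv using A[OF y'(1)] by (simp add: powr_mult)
    then have "\<bar>g' y\<bar> * f (g y) = (A y powr (1 / p) * A y powr (- (1 / p))) * ?k y *
        ((1 - r / p + r / p * A y) / (1 - r / p + r / p * A y))"
      using g'pos[OF y'(1)] by (simp only: g'_def abs_of_pos times_divide_eq_left times_divide_eq_right mult_ac)
    moreover have "A y powr (1 / p) * A y powr (- (1 / p)) = 1" using A[OF y'(1)] by (simp flip: powr_add)
    ultimately show ?thesis using rp[OF y'(1)] by simp
  qed
  have "(\<lambda>y. \<bar>g' y\<bar> * f (g y)) absolutely_integrable_on {0<..<m} \<and>
      integral {0<..<m} (\<lambda>y. \<bar>g' y\<bar> * f (g y)) = integral {0<..<m} ?k"
  proof
    show "(\<lambda>y. \<bar>g' y\<bar> * f (g y)) absolutely_integrable_on {0<..<m}"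
      using int by (rule set_integrable_cong[THEN iffD1, rotated 3]) (use eq in auto)
    show "integral {0<..<m} (\<lambda>y. \<bar>g' y\<bar> * f (g y)) = integral {0<..<m} ?k"
      by (intro integral_cong eq)
  qed
  moreover have "(g has_real_derivative g' y) (at y within {0<..<m})" if "y \<in> {0<..<m}" for y
    using dg[OF that] by (rule has_field_derivative_at_within)
  ultimately have "f absolutely_integrable_on (g ` {0<..<m}) \<and> integral (g ` {0<..<m}) f = integral {0<..<m} ?k"
    using has_absolute_integral_change_of_variables_1'[of "{0<..<m}" g g' f "integral {0<..<m} ?k"] inj by simp
  then have "(f has_integral integral {0<..<m} ?k) {0<..<m0}"
    unfolding img by (auto simp: absolutely_integrable_on_def has_integral_iff)
  then show ?thesis
  proof (intro that[of \<psi>])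
    fix t assume "t \<in> {0<..<m0}"
    then obtain y where y: "y \<in> {0<..<m}" "g y = t" unfolding img[symmetric] by auto
    moreover have "\<psi> t = 1 / (1 - r / p + r / p * A y)"
      unfolding \<psi>_def y(2)[symmetric] inv_into_f_f[OF inj y(1)] ..
    ultimately show "\<exists>y\<in>{0<..<m}. \<tau> + c * y powr r > 0 \<and> y * A y powr (1 / p) = t \<and>
       \<psi> t = 1 / (1 - r / p + r / p * A y)"
      using D[of y] by (intro bexI[of _ y]) (auto simp: g_def D_def)
  qed (simp add: f_def[abs_def])
qed

text \<open>Both half lines are carried to the same interval (0, m0), on which the weight without
  \<open>\<psi>\<close> integrates to 1/2. By the pairing inequality the two factors add up to at
  least 2 at every \<open>t\<close>, so the total is at least 1.\<close>

lemma two_sided_time: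
  fixes p r \<tau> c m n :: real
  assumes p: "p \<ge> 2" and r: "p / 2 \<le> r" "r \<le> p" and \<tau>: "\<tau> > 0" and mn: "m > 0" "n > 0" and c: "c \<ge> 0"
  defines "L \<equiv> eig_const p"
  defines "k \<equiv> \<lambda>c y. (\<tau> - L * y powr p + c * y powr r) powr (- (1 / p))"
  assumes root: "\<tau> - L * m powr p + c * m powr r = 0" "\<tau> - L * n powr p + (- c) * n powr r = 0"
    and int: "k c absolutely_integrable_on {0<..<m}" "k (- c) absolutely_integrable_on {0<..<n}"
  shows "1 \<le> integral {0<..<m} (k c) + integral {0<..<n} (k (- c))"
    "c > 0 \<Longrightarrow> p / 2 < r \<Longrightarrow> 1 < integral {0<..<m} (k c) + integral {0<..<n} (k (- c))"
proof -
  have L: "L > 0" using eig_const(1)[OF p] by (simp add: L_def)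
  have r0: "r > 0" using r p by simp
  define m0 where "m0 = (\<tau> / L) powr (1 / p)"
  have m0: "m0 > 0" using L \<tau> by (simp add: m0_def)
  define A B where "A y = \<tau> / (\<tau> + c * y powr r)" and "B y = \<tau> / (\<tau> + (- c) * y powr r)" for y
  obtain \<psi>1 where \<psi>1: "\<And>t. t \<in> {0<..<m0} \<Longrightarrow> \<exists>y\<in>{0<..<m}. \<tau> + c * y powr r > 0 \<and> y * A y powr (1 / p) = t \<and>
       \<psi>1 t = 1 / (1 - r / p + r / p * A y)"
    "((\<lambda>t. (\<tau> - L * t powr p) powr (- (1 / p)) * \<psi>1 t) has_integral integral {0<..<m} (k c)) {0<..<m0}"
    using half_line_substitution[OF p r0 r(2) L \<tau> mn(1) root(1) int(1)[unfolded k_def]]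
    unfolding m0_def A_def k_def by blast
  obtain \<psi>2 where \<psi>2: "\<And>t. t \<in> {0<..<m0} \<Longrightarrow> \<exists>y\<in>{0<..<n}. \<tau> + (- c) * y powr r > 0 \<and> y * B y powr (1 / p) = t \<and>
       \<psi>2 t = 1 / (1 - r / p + r / p * B y)"
    "((\<lambda>t. (\<tau> - L * t powr p) powr (- (1 / p)) * \<psi>2 t) has_integral integral {0<..<n} (k (- c))) {0<..<m0}"
    using half_line_substitution[OF p r0 r(2) L \<tau> mn(2) root(2) int(2)[unfolded k_def]]
    unfolding m0_def B_def k_def by blast
  let ?K = "\<lambda>t. (\<tau> - L * t powr p) powr (- (1 / p))"
  have \<rho>: "1 / 2 \<le> r / p" "r / p \<le> 1" using r p by (auto simp: field_simps)
  have pair: "\<psi>1 t + \<psi>2 t \<ge> 2 \<and> (c > 0 \<longrightarrow> p / 2 < r \<longrightarrow> \<psi>1 t + \<psi>2 t > 2)" if t: "t \<in> {0<..<m0}" for t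
  proof -
    obtain y where y: "y \<in> {0<..<m}" "\<tau> + c * y powr r > 0" "y * A y powr (1 / p) = t"
      "\<psi>1 t = 1 / (1 - r / p + r / p * A y)" using \<psi>1(1)[OF t] by blast
    obtain z where z: "z \<in> {0<..<n}" "\<tau> + (- c) * z powr r > 0" "z * B z powr (1 / p) = t"
      "\<psi>2 t = 1 / (1 - r / p + r / p * B z)" using \<psi>2(1)[OF t] by blast
    show ?thesis
    proof (cases "c = 0")
      case True
      then show ?thesis using y z \<tau> by (simp add: A_def B_def)
    next
      case False
      then have c: "c > 0" using c by simp
      have A: "0 < A y" "A y < 1" using y c \<tau> by (auto simp: A_def divide_less_eq)
      have B: "1 < B z" using z c \<tau> by (auto simp: B_def)
      have ty: "t powr r = y powr r * A y powr (r / p)"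
        using y A by (simp add: powr_mult powr_powr flip: y(3))
      have tz: "t powr r = z powr r * B z powr (r / p)"
        using z B by (simp add: powr_mult powr_powr flip: z(3))
      have "(1 - A y) / A y = (\<tau> + c * y powr r) / \<tau> - 1"
        using y(2) \<tau> by (simp add: A_def diff_divide_distrib add_divide_distrib left_diff_distrib)
      then have cy: "y powr r = \<tau> / c * ((1 - A y) / A y)" using c \<tau> by (simp add: add_divide_distrib)
      have "(B z - 1) / B z = 1 - (\<tau> + (- c) * z powr r) / \<tau>"
        using z(2) \<tau> by (simp add: B_def diff_divide_distrib add_divide_distrib left_diff_distrib)
      then have cz: "z powr r = \<tau> / c * ((B z - 1) / B z)" using c \<tau> by (simp add: diff_divide_distrib)
      \<comment> \<open>Both preimages give the same \<open>t powr r\<close>; writing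
        \<open>y powr r\<close> and \<open>z powr r\<close> through \<open>A y\<close> and
        \<open>B z\<close> eliminates \<open>t\<close> and leaves the hypothesis of the pairing
        inequality.\<close>
      have "\<tau> / c * ((1 - A y) / A y * A y powr (r / p)) = \<tau> / c * ((B z - 1) / B z * B z powr (r / p))"
        using ty tz unfolding cy cz by (simp only: mult.assoc)
      then have "(1 - A y) / A y * A y powr (r / p) = (B z - 1) / B z * B z powr (r / p)"
        using c \<tau> by (metis divide_pos_pos less_irrefl mult_left_cancel)
      then have "(1 - A y) * A y powr (r / p - 1) = (B z - 1) * B z powr (r / p - 1)"
        using A B by (simp add: powr_diff)
      from pairing_inequality[OF \<rho> A B this] show ?thesis
        using y(4) z(4) p by (auto simp: field_simps)
    qed
  qed
  have K: "(?K has_integral 1 / 2) {0<..<m0}"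
    using half_period_integral[OF p \<tau>] by (simp add: m0_def L_def has_integral_iff integrable_on_open_interval_real flip: integral_open_interval_real)
  have S: "((\<lambda>t. ?K t * \<psi>1 t + ?K t * \<psi>2 t) has_integral (integral {0<..<m} (k c) + integral {0<..<n} (k (- c)))) {0<..<m0}"
    by (intro has_integral_add \<psi>1(2) \<psi>2(2))
  have K2: "((\<lambda>t. 2 * ?K t) has_integral 2 * (1 / 2)) {0<..<m0}"
    by (intro has_integral_mult_right K)
  have "2 * (1 / 2) \<le> integral {0<..<m} (k c) + integral {0<..<n} (k (- c))"
  proof (rule has_integral_le[OF K2 S])
    fix t assume "t \<in> {0<..<m0}"
    then have "?K t * 2 \<le> ?K t * (\<psi>1 t + \<psi>2 t)" using pair by (intro mult_left_mono) auto
    then show "2 * ?K t \<le> ?K t * \<psi>1 t + ?K t * \<psi>2 t" by (simp add: algebra_simps)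
  qed
  then show "1 \<le> integral {0<..<m} (k c) + integral {0<..<n} (k (- c))" by simp
  assume strict: "c > 0" "p / 2 < r"
  have D: "((\<lambda>t. (?K t * \<psi>1 t + ?K t * \<psi>2 t) - 2 * ?K t) has_integral
      (integral {0<..<m} (k c) + integral {0<..<n} (k (- c))) - 2 * (1 / 2)) {0<..<m0}"
    by (intro has_integral_diff S K2)
  have "0 < integral {0<..<m0} (\<lambda>t. (?K t * \<psi>1 t + ?K t * \<psi>2 t) - 2 * ?K t)"
  proof (rule integral_pos_Ioo[OF _ _ m0])
    show "(\<lambda>t. (?K t * \<psi>1 t + ?K t * \<psi>2 t) - 2 * ?K t) integrable_on {0<..<m0}" using D by blast
    fix t assume t: "t \<in> {0<..<m0}"
    then have "t powr p < m0 powr p" using p by (intro powr_less_mono2) auto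
    then have "\<tau> - L * t powr p > 0" using L \<tau> p by (simp add: m0_def powr_powr field_simps)
    then have "?K t * 2 < ?K t * (\<psi>1 t + \<psi>2 t)" using pair[OF t] strict by (intro mult_strict_left_mono) auto
    then show "(?K t * \<psi>1 t + ?K t * \<psi>2 t) - 2 * ?K t > 0" by (simp add: algebra_simps)
  qed
  then show "1 < integral {0<..<m} (k c) + integral {0<..<n} (k (- c))"
    using integral_unique[OF D] by simp
qed

section \<open>From traversal times to the gain\<close>

lemma potential_half_pos:
  fixes p r L e c y m :: real
  assumes r: "0 < r" "r \<le> p" and L: "L > 0" and e: "e > 0" and y: "0 \<le> y" "y < m"
    and m: "e - L * m powr p + c * m powr r \<ge> 0"
  shows "e - L * y powr p + c * y powr r > 0"
proof (rule ccontr)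
  assume neg: "\<not> ?thesis"
  \<comment> \<open>The potential is \<open>e - y powr r * (L * y powr (p - r) - c)\<close>. Where
    it is nonpositive the bracket is positive, and as \<open>r \<le> p\<close> the product increases
    strictly from there on, so the potential could not be nonnegative at the later point
    \<open>m\<close>.\<close>
  have split: "L * x powr p = x powr r * (L * x powr (p - r))" for x
    by (simp flip: powr_add)
  have *: "e \<le> y powr r * (L * y powr (p - r) - c)"
    using neg by (simp add: split algebra_simps)
  then have y0: "y > 0" using e y r by (cases "y = 0") auto
  have pos: "L * y powr (p - r) - c > 0"
    using * e y0 by (smt (verit) mult_nonneg_nonpos powr_ge_zero)
  have "y powr r * (L * y powr (p - r) - c) < m powr r * (L * y powr (p - r) - c)"
    using y0 y r pos by (intro mult_strict_right_mono powr_less_mono2) auto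
  also have "\<dots> \<le> m powr r * (L * m powr (p - r) - c)"
    using y y0 r L by (intro mult_left_mono diff_right_mono powr_mono2) auto
  also have "\<dots> = - (e - L * m powr p + c * m powr r) + e"
    by (simp add: split algebra_simps)
  finally show False using * m by linarith
qed

lemma potential_half_nonneg:
  fixes p r L e c y m :: real
  assumes r: "0 < r" "r \<le> p" and L: "L > 0" and e: "e \<ge> 0" and y: "0 \<le> y" "y \<le> m"
    and m: "e - L * m powr p + c * m powr r \<ge> 0"
  shows "e - L * y powr p + c * y powr r \<ge> 0"
proof (cases "y = m")
  case False
  have "\<epsilon> + (e - L * y powr p + c * y powr r) \<ge> 0" if "\<epsilon> > 0" for \<epsilon>
    using potential_half_pos[OF r L, of "e + \<epsilon>" y m c] e y m that False by auto
  then have "0 \<le> (e - L * y powr p + c * y powr r) + \<epsilon>" if "\<epsilon> > 0" for \<epsilon>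
    using that by (simp add: add.commute)
  then show ?thesis by (rule field_le_epsilon)
qed (use m in simp)

lemma set_nn_integral_finite_imp:
  fixes f :: "real \<Rightarrow> real"
  assumes [measurable]: "f \<in> borel_measurable borel" "A \<in> sets borel" and pos: "\<And>x. f x \<ge> 0"
    and fin: "(\<integral>\<^sup>+x\<in>A. ennreal (f x) \<partial>lborel) < \<infinity>"
  shows "f absolutely_integrable_on A" "(\<integral>\<^sup>+x\<in>A. ennreal (f x) \<partial>lborel) = ennreal (integral A f)"
proof -
  have "(\<integral>\<^sup>+x. ennreal (indicator A x * f x) \<partial>lborel) = (\<integral>\<^sup>+x\<in>A. ennreal (f x) \<partial>lborel)"
    by (intro nn_integral_cong) (auto simp: indicator_def)
  then have "integrable lborel (\<lambda>x. indicator A x * f x)"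
    using fin pos by (intro integrableI_nonneg) auto
  then show "f absolutely_integrable_on A"
    by (simp add: set_integrable_def integrable_completion)
  show "(\<integral>\<^sup>+x\<in>A. ennreal (f x) \<partial>lborel) = ennreal (integral A f)"
    using fin pos by (intro set_nn_integral_lborel_eq_integral) (auto simp: set_borel_measurable_def)
qed

text \<open>The half line \<open>y < 0\<close> is always reflected to \<open>y > 0\<close>, where it carries \<open>- c\<close> instead of \<open>c\<close>.\<close>

definition half_time :: "real \<Rightarrow> real \<Rightarrow> real \<Rightarrow> real \<Rightarrow> real \<Rightarrow> real \<Rightarrow> ennreal" where
  "half_time p r L \<tau> c b = (\<integral>\<^sup>+y\<in>{0..b}. ennreal (max 0 (\<tau> - L * y powr p + c * y powr r) powr (- (1 / p))) \<partial>lborel)"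

text \<open>Where the potential is negative, \<open>max 0\<close> leads to
  \<open>0 powr (- (1 / p)) = 0\<close>, so \<open>half_time\<close> counts only the set where the
  potential is positive. This set contains (0, m) for the zero \<open>m\<close> found by the
  intermediate value theorem.\<close>

lemma half_time_ge:
  fixes p r L \<tau> c b :: real
  assumes r: "0 < r" "r \<le> p" and L: "L > 0" and \<tau>: "\<tau> > 0" and b: "b > 0"
    and neg: "\<tau> - L * b powr p + c * b powr r \<le> 0"
  obtains m where "m > 0" "\<tau> - L * m powr p + c * m powr r = 0"
    "half_time p r L \<tau> c b \<ge> (\<integral>\<^sup>+y\<in>{0<..<m}. ennreal ((\<tau> - L * y powr p + c * y powr r) powr (- (1 / p))) \<partial>lborel)"
proof -
  have "continuous_on {0..b} (\<lambda>y. \<tau> - L * y powr p + c * y powr r)"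
    using r by (intro continuous_intros continuous_on_powr') auto
  then have "\<exists>m\<ge>0. m \<le> b \<and> \<tau> - L * m powr p + c * m powr r = 0"
    using \<tau> b neg r by (intro IVT2') auto
  then obtain m where m: "m \<ge> 0" "m \<le> b" "\<tau> - L * m powr p + c * m powr r = 0" by blast
  have "m \<noteq> 0" using m \<tau> r by auto
  then have m0: "m > 0" using m by simp
  have pos: "\<tau> - L * y powr p + c * y powr r > 0" if "y \<in> {0<..<m}" for y
    using potential_half_pos[OF r L \<tau>, of y m c] m that by auto
  have "(\<integral>\<^sup>+y\<in>{0<..<m}. ennreal ((\<tau> - L * y powr p + c * y powr r) powr (- (1 / p))) \<partial>lborel)
     \<le> half_time p r L \<tau> c b"
    unfolding half_time_def
  proof (rule nn_integral_mono)
    fix y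
    show "ennreal ((\<tau> - L * y powr p + c * y powr r) powr (- (1 / p))) * indicator {0<..<m} y
      \<le> ennreal (max 0 (\<tau> - L * y powr p + c * y powr r) powr (- (1 / p))) * indicator {0..b} y"
      using pos[of y] m by (auto simp: indicator_def max_def)
  qed
  with m0 m(3) show ?thesis by (rule that)
qed

text \<open>An infinite time satisfies the bounds in \<open>ennreal\<close> at once; in the finite
  case the integrands are integrable, as \<open>two_sided_time\<close> demands.\<close>

lemma two_sided_time_nn:
  fixes p r \<tau> c a b :: real
  assumes p: "p \<ge> 2" and r: "p / 2 \<le> r" "r \<le> p" and \<tau>: "\<tau> > 0" and c: "c \<ge> 0" and ab: "a > 0" "b > 0"
  defines "L \<equiv> eig_const p"
  assumes neg: "\<tau> - L * b powr p + c * b powr r \<le> 0" "\<tau> - L * a powr p + (- c) * a powr r \<le> 0"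
  shows "1 \<le> half_time p r L \<tau> c b + half_time p r L \<tau> (- c) a"
    "c > 0 \<Longrightarrow> p / 2 < r \<Longrightarrow> 1 < half_time p r L \<tau> c b + half_time p r L \<tau> (- c) a"
proof -
  have r0: "r > 0" and L: "L > 0" using p r eig_const(1)[OF p] by (auto simp: L_def)
  define k where "k c y = (\<tau> - L * y powr p + c * y powr r) powr (- (1 / p))" for c y
  obtain m where m: "m > 0" "\<tau> - L * m powr p + c * m powr r = 0"
    "half_time p r L \<tau> c b \<ge> (\<integral>\<^sup>+y\<in>{0<..<m}. ennreal (k c y) \<partial>lborel)"
    unfolding k_def by (rule half_time_ge[OF r0 r(2) L \<tau> ab(2) neg(1)])
  obtain n where n: "n > 0" "\<tau> - L * n powr p + (- c) * n powr r = 0"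
    "half_time p r L \<tau> (- c) a \<ge> (\<integral>\<^sup>+y\<in>{0<..<n}. ennreal (k (- c) y) \<partial>lborel)"
    unfolding k_def by (rule half_time_ge[OF r0 r(2) L \<tau> ab(1) neg(2)])
  have km: "k c \<in> borel_measurable borel" for c unfolding k_def by measurable
  have k0: "k c y \<ge> 0" for c y by (simp add: k_def)
  let ?N1 = "\<integral>\<^sup>+y\<in>{0<..<m}. ennreal (k c y) \<partial>lborel" and ?N2 = "\<integral>\<^sup>+y\<in>{0<..<n}. ennreal (k (- c) y) \<partial>lborel"
  have le: "?N1 + ?N2 \<le> half_time p r L \<tau> c b + half_time p r L \<tau> (- c) a"
    using m(3) n(3) by (rule add_mono)
  have main: "1 \<le> ?N1 + ?N2 \<and> (c > 0 \<longrightarrow> p / 2 < r \<longrightarrow> 1 < ?N1 + ?N2)"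
  proof (cases "?N1 < \<infinity> \<and> ?N2 < \<infinity>")
    case True
    note i1 = set_nn_integral_finite_imp[OF km _ k0, of "{0<..<m}" c]
    note i2 = set_nn_integral_finite_imp[OF km _ k0, of "{0<..<n}" "- c"]
    have a1: "k c absolutely_integrable_on {0<..<m}" "?N1 = ennreal (integral {0<..<m} (k c))"
      using i1 True by auto
    have a2: "k (- c) absolutely_integrable_on {0<..<n}" "?N2 = ennreal (integral {0<..<n} (k (- c)))"
      using i2 True by auto
    have nn: "0 \<le> integral {0<..<m} (k c)" "0 \<le> integral {0<..<n} (k (- c))"
      using a1(1) a2(1) k0 by (auto intro!: Henstock_Kurzweil_Integration.integral_nonneg simp: absolutely_integrable_on_def)
    note T = two_sided_time[OF p r \<tau> m(1) n(1) c, folded L_def, folded k_def, OF m(2) n(2) a1(1) a2(1)]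
    have s: "?N1 + ?N2 = ennreal (integral {0<..<m} (k c) + integral {0<..<n} (k (- c)))"
      unfolding a1(2) a2(2) using nn by (rule ennreal_plus[symmetric])
    show ?thesis unfolding s ennreal_1[symmetric]
      using T by (auto intro!: ennreal_leI ennreal_lessI)
  next
    case False
    then have "?N1 + ?N2 = top" by (auto simp: less_top[symmetric])
    then show ?thesis by (simp only: top_greatest ennreal_one_less_top simp_thms)
  qed
  then show "1 \<le> half_time p r L \<tau> c b + half_time p r L \<tau> (- c) a" using le by (blast intro: order_trans)
  show "1 < half_time p r L \<tau> c b + half_time p r L \<tau> (- c) a" if "c > 0" "p / 2 < r"
    using main le that by (blast intro: less_le_trans)
qed

text \<open>The share of one half line in the integral that defines \<open>G\<close>.\<close>

definition half_gain :: "real \<Rightarrow> real \<Rightarrow> real \<Rightarrow> real \<Rightarrow> real \<Rightarrow> real \<Rightarrow> real" where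
  "half_gain p r L e c b = integral {0..b} (\<lambda>y. max 0 (e - L * y powr p + c * y powr r) powr (1 - 1 / p))"

lemma continuous_half_gain_integrand:
  fixes p r L e c b :: real
  assumes "p > 1" "r > 0"
  shows "continuous_on {0..b} (\<lambda>y. max 0 (e - L * y powr p + c * y powr r) powr (1 - 1 / p))"
  using assms by (intro continuous_max_powr continuous_intros continuous_on_powr') auto

text \<open>For fixed height, with \<open>q\<close> the rest of the potential, this is the growth of
  the gain integrand in the level. The single level \<open>- q\<close>, where the power is not
  differentiable, is exempted.\<close>

lemma level_integral:
  fixes p q e0 e :: real
  assumes p: "p > 1" and e: "e0 \<le> e"
  shows "((\<lambda>\<tau>. (1 - 1 / p) * max 0 (\<tau> + q) powr (- (1 / p))) has_integral
     (max 0 (e + q) powr (1 - 1 / p) - max 0 (e0 + q) powr (1 - 1 / p))) {e0..e}"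
proof (rule fundamental_theorem_of_calculus_interior_strong[of "{- q}"])
  show "continuous_on {e0..e} (\<lambda>\<tau>. max 0 (\<tau> + q) powr (1 - 1 / p))"
    using p by (intro continuous_max_powr continuous_intros) auto
  fix x assume x: "x \<in> {e0<..<e} - {- q}"
  show "((\<lambda>\<tau>. max 0 (\<tau> + q) powr (1 - 1 / p)) has_vector_derivative (1 - 1 / p) * max 0 (x + q) powr (- (1 / p))) (at x)"
  proof (cases "x + q > 0")
    case True
    have "((\<lambda>\<tau>. (\<tau> + q) powr (1 - 1 / p)) has_real_derivative (1 - 1 / p) * max 0 (x + q) powr (- (1 / p))) (at x)"
      using True by (auto intro!: derivative_eq_intros)
    then have "((\<lambda>\<tau>. max 0 (\<tau> + q) powr (1 - 1 / p)) has_real_derivative (1 - 1 / p) * max 0 (x + q) powr (- (1 / p))) (at x)"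
      by (rule has_field_derivative_transform_within_open[where S = "{- q<..}"]) (use True in auto)
    then show ?thesis by (simp add: has_real_derivative_iff_has_vector_derivative)
  next
    case False
    with x have neg: "x + q < 0" by auto
    have "((\<lambda>\<tau>. 0) has_real_derivative (1 - 1 / p) * max 0 (x + q) powr (- (1 / p))) (at x)"
      using neg by auto
    then have "((\<lambda>\<tau>. max 0 (\<tau> + q) powr (1 - 1 / p)) has_real_derivative (1 - 1 / p) * max 0 (x + q) powr (- (1 / p))) (at x)"
      by (rule has_field_derivative_transform_within_open[where S = "{..<- q}"]) (use neg in auto)
    then show ?thesis by (simp add: has_real_derivative_iff_has_vector_derivative)
  qed
qed (use e in auto)

text \<open>The integrated form of dG/de for one half line: Tonelli's theorem exchanges the level
  \<open>\<tau>\<close> with the height \<open>y\<close>, in \<open>ennreal\<close>, so that no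
  bound on the times is required beforehand.\<close>

lemma half_gain_diff:
  fixes p r L e0 e c b :: real
  assumes p: "p > 1" and r: "r > 0" and e: "e0 \<le> e"
  shows "ennreal (half_gain p r L e c b - half_gain p r L e0 c b) =
    ennreal (1 - 1 / p) * (\<integral>\<^sup>+\<tau>\<in>{e0..e}. half_time p r L \<tau> c b \<partial>lborel)"
proof -
  define q where "q y = - (L * y powr p) + c * y powr r" for y
  define G where "G e y = max 0 (e + q y) powr (1 - 1 / p)" for e y
  define k where "k \<tau> y = (1 - 1 / p) * max 0 (\<tau> + q y) powr (- (1 / p))" for \<tau> y
  have p': "1 - 1 / p \<ge> 0" using p by simp
  have [measurable]: "q \<in> borel_measurable borel" unfolding q_def by measurable
  have G: "half_gain p r L e c b = integral {0..b} (G e)" for e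
    unfolding half_gain_def G_def q_def by (simp add: algebra_simps)
  have cG: "continuous_on {0..b} (G e)" for e
    using continuous_half_gain_integrand[OF p r, of b e L c] unfolding G_def q_def by (simp add: algebra_simps)
  have "((\<lambda>y. G e y - G e0 y) has_integral integral {0..b} (G e) - integral {0..b} (G e0)) {0..b}"
    by (intro has_integral_diff integrable_integral integrable_continuous_real cG)
  moreover have "G e y - G e0 y \<ge> 0" for y
    unfolding G_def using e p' by (auto intro!: powr_mono2)
  ultimately have "ennreal (integral {0..b} (G e) - integral {0..b} (G e0)) =
      (\<integral>\<^sup>+y. ennreal (G e y - G e0 y) * indicator {0..b} y \<partial>lborel)"
    by (intro nn_integral_has_integral_lebesgue'[symmetric]) auto
  also have "\<dots> = (\<integral>\<^sup>+y. (\<integral>\<^sup>+\<tau>. ennreal (k \<tau> y) * indicator {e0..e} \<tau> \<partial>lborel) * indicator {0..b} y \<partial>lborel)"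
  proof (intro nn_integral_cong)
    fix y
    have "(\<integral>\<^sup>+\<tau>. ennreal (k \<tau> y) * indicator {e0..e} \<tau> \<partial>lborel) = ennreal (G e y - G e0 y)"
      unfolding k_def G_def using p' by (intro nn_integral_has_integral_lebesgue' level_integral[OF p e]) auto
    then show "ennreal (G e y - G e0 y) * indicator {0..b} y =
       (\<integral>\<^sup>+\<tau>. ennreal (k \<tau> y) * indicator {e0..e} \<tau> \<partial>lborel) * indicator {0..b} y" by simp
  qed
  also have "\<dots> = (\<integral>\<^sup>+y. (\<integral>\<^sup>+\<tau>. ennreal (k \<tau> y) * indicator {e0..e} \<tau> * indicator {0..b} y \<partial>lborel) \<partial>lborel)"
    unfolding k_def by (intro nn_integral_cong nn_integral_multc[symmetric]) measurable
  also have "\<dots> = (\<integral>\<^sup>+\<tau>. (\<integral>\<^sup>+y. ennreal (k \<tau> y) * indicator {e0..e} \<tau> * indicator {0..b} y \<partial>lborel) \<partial>lborel)"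
    unfolding k_def by (intro lborel_pair.Fubini') measurable
  also have "\<dots> = (\<integral>\<^sup>+\<tau>. ennreal (1 - 1 / p) * (half_time p r L \<tau> c b * indicator {e0..e} \<tau>) \<partial>lborel)"
  proof (intro nn_integral_cong)
    fix \<tau>
    have "(\<integral>\<^sup>+y. ennreal (k \<tau> y) * indicator {e0..e} \<tau> * indicator {0..b} y \<partial>lborel) =
      (\<integral>\<^sup>+y. (ennreal (1 - 1 / p) * indicator {e0..e} \<tau>) *
         (ennreal (max 0 (\<tau> - L * y powr p + c * y powr r) powr (- (1 / p))) * indicator {0..b} y) \<partial>lborel)"
      unfolding k_def q_def using p'
      by (intro nn_integral_cong) (simp only: ennreal_mult powr_ge_zero diff_conv_add_uminus ac_simps)
    also have "\<dots> = (ennreal (1 - 1 / p) * indicator {e0..e} \<tau>) * half_time p r L \<tau> c b"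
      unfolding half_time_def by (intro nn_integral_cmult) measurable
    finally show "(\<integral>\<^sup>+y. ennreal (k \<tau> y) * indicator {e0..e} \<tau> * indicator {0..b} y \<partial>lborel) =
       ennreal (1 - 1 / p) * (half_time p r L \<tau> c b * indicator {e0..e} \<tau>)" by (simp add: mult_ac)
  qed
  also have "\<dots> = ennreal (1 - 1 / p) * (\<integral>\<^sup>+\<tau>\<in>{e0..e}. half_time p r L \<tau> c b \<partial>lborel)"
    unfolding half_time_def by (intro nn_integral_cmult) measurable
  finally show ?thesis unfolding G .
qed

lemma half_gain_mono:
  assumes "p > 1" "r > 0" "e0 \<le> e"
  shows "half_gain p r L e0 c b \<le> half_gain p r L e c b"
  unfolding half_gain_def
  using assms by (intro integral_le integrable_continuous_real continuous_half_gain_integrand) (auto intro!: powr_mono2)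

text \<open>A potential that is nonpositive at both ends for the level \<open>e\<close> is so for
  every lower level, so the two-sided time is at least 1 throughout (e0, e); integration over the
  levels gives the claim. In the strict case the time exceeds 1 on an interval of positive
  length.\<close>

lemma two_sided_gain:
  fixes p r e0 e c a b :: real
  assumes p: "p \<ge> 2" and r: "p / 2 \<le> r" "r \<le> p" and e: "0 \<le> e0" "e0 \<le> e" and c: "c \<ge> 0" and ab: "a > 0" "b > 0"
  defines "L \<equiv> eig_const p"
  assumes neg: "e - L * b powr p + c * b powr r \<le> 0" "e - L * a powr p + (- c) * a powr r \<le> 0"
  defines "\<Delta> \<equiv> (half_gain p r L e c b + half_gain p r L e (- c) a) - (half_gain p r L e0 c b + half_gain p r L e0 (- c) a)"
  shows "(1 - 1 / p) * (e - e0) \<le> \<Delta>"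
    "c > 0 \<Longrightarrow> p / 2 < r \<Longrightarrow> e0 < e \<Longrightarrow> (1 - 1 / p) * (e - e0) < \<Delta>"
proof -
  have p1: "p > 1" and r0: "r > 0" and p': "1 - 1 / p > 0" using p r by auto
  let ?T = "\<lambda>\<tau>. half_time p r L \<tau> c b + half_time p r L \<tau> (- c) a"
  have mT[measurable]: "(\<lambda>\<tau>. half_time p r L \<tau> c b) \<in> borel_measurable borel" for c b
    unfolding half_time_def by measurable
  have T: "1 \<le> ?T \<tau> \<and> (c > 0 \<longrightarrow> p / 2 < r \<longrightarrow> 1 < ?T \<tau>)" if "\<tau> \<in> {e0<..<e}" for \<tau>
    using two_sided_time_nn[OF p r _ c ab, folded L_def, of \<tau>] that neg e by auto
  have d: "half_gain p r L e c b - half_gain p r L e0 c b \<ge> 0" for c b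
    using half_gain_mono[OF p1 r0 e(2), of L c b] by simp
  have "ennreal \<Delta> = ennreal (half_gain p r L e c b - half_gain p r L e0 c b) +
      ennreal (half_gain p r L e (- c) a - half_gain p r L e0 (- c) a)"
    unfolding \<Delta>_def using d[of c b] d[of "- c" a] by (subst ennreal_plus[symmetric]) (auto simp: algebra_simps)
  also have "\<dots> = ennreal (1 - 1 / p) * (\<integral>\<^sup>+\<tau>\<in>{e0..e}. ?T \<tau> \<partial>lborel)"
    unfolding half_gain_diff[OF p1 r0 e(2)] distrib_left[symmetric]
    by (subst nn_integral_add[symmetric]) (auto simp: distrib_right)
  finally have \<Delta>: "ennreal \<Delta> = ennreal (1 - 1 / p) * (\<integral>\<^sup>+\<tau>\<in>{e0..e}. ?T \<tau> \<partial>lborel)" .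
  have \<Delta>0: "\<Delta> \<ge> 0" unfolding \<Delta>_def using d[of c b] d[of "- c" a] by simp
  have one: "(\<integral>\<^sup>+\<tau>\<in>{e0<..<e}. 1 \<partial>lborel) = ennreal (e - e0)"
    using e by simp
  have sub: "(\<integral>\<^sup>+\<tau>\<in>{e0<..<e}. ?T \<tau> \<partial>lborel) \<le> (\<integral>\<^sup>+\<tau>\<in>{e0..e}. ?T \<tau> \<partial>lborel)"
    by (intro nn_integral_mono mult_left_mono) (auto simp: indicator_def)
  have "ennreal (e - e0) \<le> (\<integral>\<^sup>+\<tau>\<in>{e0<..<e}. ?T \<tau> \<partial>lborel)"
    unfolding one[symmetric] using T by (intro nn_integral_mono) (auto simp: indicator_def)
  then have "ennreal (1 - 1 / p) * ennreal (e - e0) \<le> ennreal \<Delta>"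
    unfolding \<Delta> using sub by (intro mult_left_mono) auto
  then show "(1 - 1 / p) * (e - e0) \<le> \<Delta>"
    using \<Delta>0 p' e by (simp add: ennreal_mult[symmetric] ennreal_le_iff)
  assume strict: "c > 0" "p / 2 < r" "e0 < e"
  have "(\<integral>\<^sup>+\<tau>. indicator {e0<..<e} \<tau> \<partial>lborel) < (\<integral>\<^sup>+\<tau>\<in>{e0<..<e}. ?T \<tau> \<partial>lborel)"
  proof (rule nn_integral_less)
    show "AE \<tau> in lborel. indicator {e0<..<e} \<tau> \<le> ?T \<tau> * indicator {e0<..<e} \<tau>"
      using T by (intro AE_I2) (auto simp: indicator_def)
    show "\<not> (AE \<tau> in lborel. ?T \<tau> * indicator {e0<..<e} \<tau> \<le> indicator {e0<..<e} \<tau>)"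
    proof
      assume "AE \<tau> in lborel. ?T \<tau> * indicator {e0<..<e} \<tau> \<le> indicator {e0<..<e} \<tau>"
      then have "AE \<tau> in lborel. \<tau> \<notin> {e0<..<e}"
      proof eventually_elim
        case (elim \<tau>)
        then show ?case using T[of \<tau>] strict by (auto simp: indicator_def split: if_splits)
      qed
      then have "emeasure lborel {e0<..<e} = 0"
        by (subst (asm) AE_iff_measurable[where N = "{e0<..<e}"]) auto
      then show False using strict by simp
    qed
  qed (use e in auto)
  then have "ennreal (e - e0) < (\<integral>\<^sup>+\<tau>\<in>{e0..e}. ?T \<tau> \<partial>lborel)"
    using sub e by (simp add: less_le_trans)
  then have "ennreal (1 - 1 / p) * ennreal (e - e0) < ennreal \<Delta>"
    unfolding \<Delta> using p' by (intro ennreal_mult_strict_left_mono) auto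
  then show "(1 - 1 / p) * (e - e0) < \<Delta>"
    using \<Delta>0 p' e by (simp add: ennreal_mult[symmetric] ennreal_less_iff)
qed

section \<open>Extremal profiles\<close>

text \<open>One arc of an extremal: it leaves height 0 with speed \<open>h\<close> and reaches its
  top \<open>M\<close>, a zero of the potential, after time \<open>T\<close>. \<open>F\<close> is
  the time at which a height is reached and \<open>W\<close> the height at a given time. It is used
  for the positive minimizer with \<open>M = 1\<close>, \<open>T = 1\<close>, and for the
  generalized sine with \<open>c = 0\<close>, \<open>T = 1 / 2\<close>.\<close>

locale profile =
  fixes p r L e c M T :: real
  assumes p: "p \<ge> 2" and r: "r > 0" and M: "M > 0"
    and K_pos: "\<And>y. y \<in> {0<..<M} \<Longrightarrow> e - L * y powr p + c * y powr r > 0"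
    and e: "e \<ge> 0" and K_end: "e - L * M powr p + c * M powr r = 0"
    and time: "((\<lambda>y. (e - L * y powr p + c * y powr r) powr (- (1 / p))) has_integral T) {0..M}"
begin

definition K where "K y = e - L * y powr p + c * y powr r"
definition h where "h y = K y powr (1 / p)"
definition F where "F y = integral {0..y} (\<lambda>s. K s powr (- (1 / p)))"
definition W where "W = inv_into {0..M} F"

lemma K_nonneg: "y \<in> {0..M} \<Longrightarrow> K y \<ge> 0"
proof -
  assume "y \<in> {0..M}"
  then consider "y = 0" | "y = M" | "y \<in> {0<..<M}" by fastforce
  then show ?thesis
    by cases (use K_pos[of y] K_end e r p in \<open>auto simp: K_def\<close>)
qed

lemma h_props: "h y \<ge> 0" "h M = 0" "y \<in> {0<..<M} \<Longrightarrow> h y > 0" "y \<in> {0..M} \<Longrightarrow> h y powr p = K y"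
  "1 / h y = K y powr (- (1 / p))"
  using K_pos[of y] K_end p K_nonneg[of y] by (auto simp: h_def K_def powr_powr powr_minus_divide)

lemma continuous_h: "continuous_on {0..M} h"
proof -
  have "continuous_on {0..M} K"
    unfolding K_def using p r by (intro continuous_intros continuous_on_powr') auto
  then show ?thesis
    unfolding h_def using p K_nonneg by (intro continuous_on_powr' continuous_intros) auto
qed

lemma F_integrable: "(\<lambda>s. K s powr (- (1 / p))) integrable_on {a..b}" if "0 \<le> a" "b \<le> M"
  by (rule integrable_subinterval_real[of _ 0 M]) (use time that in \<open>auto simp: K_def has_integral_iff\<close>)

lemma F_diff: "F b - F a = integral {a..b} (\<lambda>s. K s powr (- (1 / p)))" if "0 \<le> a" "a \<le> b" "b \<le> M"
  unfolding F_def
  using Henstock_Kurzweil_Integration.integral_combine[of 0 a b "\<lambda>s. K s powr (- (1 / p))"] that F_integrable[of 0 b]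
  by simp

lemma F_strict: "F a < F b" if "0 \<le> a" "a < b" "b \<le> M"
proof -
  have "0 < integral {a<..<b} (\<lambda>s. K s powr (- (1 / p)))"
  proof (rule integral_pos_Ioo)
    show "(\<lambda>s. K s powr (- (1 / p))) integrable_on {a<..<b}"
      using that F_integrable[of a b] by (simp add: integrable_on_open_interval_real)
    show "K y powr (- (1 / p)) > 0" if "y \<in> {a<..<b}" for y
      using K_pos[of y] that \<open>0 \<le> a\<close> \<open>b \<le> M\<close> by (simp add: K_def)
  qed (use that in auto)
  then show ?thesis using F_diff[of a b] that by (simp flip: integral_open_interval_real)
qed

lemma F_ends: "F 0 = 0" "F M = T"
  using time by (auto simp: F_def K_def has_integral_iff)

lemma T_pos: "T > 0" using F_strict[of 0 M] F_ends M by simp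

lemma F_cont: "continuous_on {0..M} F"
  unfolding F_def by (intro indefinite_integral_continuous_1 F_integrable) auto

lemma F_inj: "inj_on F {0..M}"
proof (rule linorder_inj_onI)
  show "F x \<noteq> F y" if "x < y" "x \<in> {0..M}" "y \<in> {0..M}" for x y
    using F_strict[of x y] that by auto
qed auto

lemma F_image: "F ` {0..M} = {0..T}"
proof (intro equalityI subsetI)
  fix t assume "t \<in> F ` {0..M}"
  then obtain y where y: "y \<in> {0..M}" "t = F y" by blast
  have "F 0 \<le> F y" "F y \<le> F M"
    using F_strict[of 0 y] F_strict[of y M] y by (cases "y = 0"; cases "y = M"; force)+
  then show "t \<in> {0..T}" using F_ends y by auto
next
  fix t assume t: "t \<in> {0..T}"
  have "\<exists>y. 0 \<le> y \<and> y \<le> M \<and> F y = t"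
    by (rule IVT') (use t F_ends F_cont M in auto)
  then show "t \<in> F ` {0..M}" by auto
qed

lemma
  shows W_F: "y \<in> {0..M} \<Longrightarrow> W (F y) = y" and F_W: "t \<in> {0..T} \<Longrightarrow> F (W t) = t"
    and W_in: "t \<in> {0..T} \<Longrightarrow> W t \<in> {0..M}" and W_0: "W 0 = 0" and W_T: "W T = M"
proof -
  show 1: "W (F y) = y" if "y \<in> {0..M}" for y
    unfolding W_def by (rule inv_into_f_f[OF F_inj that])
  show "F (W t) = t" if "t \<in> {0..T}"
    unfolding W_def by (rule f_inv_into_f) (use that F_image in simp)
  show "W t \<in> {0..M}" if "t \<in> {0..T}"
    unfolding W_def by (rule inv_into_into) (use that F_image in simp)
  show "W 0 = 0" "W T = M" using 1[of 0] 1[of M] F_ends M by auto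
qed

lemma W_interior: "t \<in> {0<..<T} \<Longrightarrow> W t \<in> {0<..<M}"
proof -
  assume t: "t \<in> {0<..<T}"
  then have "W t \<in> {0..M}" "F (W t) = t" using W_in F_W by auto
  moreover have "W t \<noteq> 0" "W t \<noteq> M" using t F_ends F_W[of t] by auto
  ultimately show ?thesis by auto
qed

lemma W_cont: "continuous_on {0..T} W"
  using continuous_on_inv[OF F_cont compact_Icc, of W] W_F by (simp add: F_image)

lemma hW_cont: "continuous_on {0..T} (\<lambda>t. h (W t))"
  by (rule continuous_on_compose2[OF continuous_h W_cont]) (use W_in in auto)

lemma W_deriv_interior: "(W has_real_derivative h (W t)) (at t)" if t: "t \<in> {0<..<T}"
proof -
  let ?y = "W t"
  have y: "?y \<in> {0<..<M}" by (rule W_interior[OF t])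
  have "continuous (at ?y) (\<lambda>s. K s powr (- (1 / p)))"
  proof -
    have "isCont K ?y" unfolding K_def using y by (intro continuous_intros) auto
    moreover have "K ?y \<noteq> 0" using K_pos[OF y] by (simp add: K_def)
    ultimately show ?thesis unfolding isCont_def by (rule tendsto_powr[OF _ tendsto_const])
  qed
  then have "continuous (at ?y within {0..M} - {}) (\<lambda>s. K s powr (- (1 / p)))"
    by (rule continuous_within_subset) auto
  then have "(F has_vector_derivative K ?y powr (- (1 / p))) (at ?y within {0..M} - {})"
    unfolding F_def by (intro integral_has_vector_derivative_continuous_at F_integrable) (use y in auto)
  then have "(F has_real_derivative K ?y powr (- (1 / p))) (at ?y)"
    using y by (simp add: has_real_derivative_iff_has_vector_derivative at_within_Icc_at)
  then have "(F has_real_derivative 1 / h ?y) (at ?y)" by (simp only: h_props(5))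
  then have "(W has_real_derivative inverse (1 / h ?y)) (at t)"
  proof (rule DERIV_inverse_function)
    show "0 < t" "t < T" using t by auto
    show "F (W s) = s" if "0 < s" "s < T" for s using F_W that by auto
    show "isCont W t" using W_cont t by (auto intro: continuous_on_interior)
    show "1 / h ?y \<noteq> 0" using h_props(3)[OF y] by simp
  qed
  then show ?thesis by simp
qed

text \<open>In the interior this is the inverse function rule. At an end \<open>h\<close> may vanish
  and \<open>1 / h\<close> be singular, so \<open>W\<close> is recovered as the integral of the
  continuous function \<open>h (W t)\<close>, whose one-sided derivatives exist.\<close>

lemma W_deriv: "(W has_real_derivative h (W t)) (at t within {0..T})" if t: "t \<in> {0..T}"
proof -
  have W: "W s = integral {0..s} (\<lambda>t. h (W t))" if s: "s \<in> {0..T}" for s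
  proof -
    have "((\<lambda>t. h (W t)) has_integral W s - W 0) {0..s}"
    proof (rule fundamental_theorem_of_calculus_interior)
      show "continuous_on {0..s} W" by (rule continuous_on_subset[OF W_cont]) (use s in auto)
      show "(W has_vector_derivative h (W x)) (at x)" if "x \<in> {0<..<s}" for x
        using W_deriv_interior[of x] that s by (auto simp: has_real_derivative_iff_has_vector_derivative)
    qed (use s in auto)
    then show ?thesis using W_0 by (simp add: integral_unique)
  qed
  have "((\<lambda>s. integral {0..s} (\<lambda>t. h (W t))) has_real_derivative h (W t)) (at t within {0..T})"
    by (rule integral_has_real_derivative[OF hW_cont t])
  then show ?thesis
    by (rule has_field_derivative_transform_within[where d = 1]) (use W t in auto)
qed

text \<open>The extremal equation multiplied by \<open>W\<close> and integrated. The combined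
  integrand is the derivative of \<open>W t * h (W t) powr (p - 1)\<close>, which vanishes at both
  ends because \<open>W 0 = 0\<close> and \<open>h M = 0\<close>.\<close>

lemma energy_identity:
  "integral {0..T} (\<lambda>t. h (W t) powr p) =
   (p - 1) * L * integral {0..T} (\<lambda>t. W t powr p) - (p - 1) * c * (r / p) * integral {0..T} (\<lambda>t. W t powr r)"
proof -
  have Wn: "W t \<ge> 0" if "t \<in> {0..T}" for t using W_in[OF that] by simp
  have c1: "continuous_on {0..T} (\<lambda>t. h (W t) powr s)" if "s > 0" for s
    using that h_props(1) by (intro continuous_on_powr' hW_cont continuous_intros) auto
  have c2: "continuous_on {0..T} (\<lambda>t. W t powr s)" if "s > 0" for s
    using that Wn by (intro continuous_on_powr' W_cont continuous_intros) auto
  have "((\<lambda>t. h (W t) powr p - (p - 1) * L * W t powr p + (p - 1) * c * (r / p) * W t powr r) has_integral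
      (W T * h (W T) powr (p - 1) - W 0 * h (W 0) powr (p - 1))) {0..T}"
  proof (rule fundamental_theorem_of_calculus_interior)
    show "continuous_on {0..T} (\<lambda>t. W t * h (W t) powr (p - 1))"
      using p by (intro continuous_intros W_cont c1) auto
    fix t assume t: "t \<in> {0<..<T}"
    let ?y = "W t"
    have y: "?y \<in> {0<..<M}" "?y > 0" using W_interior[OF t] by auto
    have Ky: "K ?y > 0" using K_pos[OF y(1)] by (simp add: K_def)
    have hy: "h ?y = K ?y powr (1 / p)" by (simp add: h_def)
    have dK: "(K has_real_derivative - L * (p * ?y powr (p - 1)) + c * (r * ?y powr (r - 1))) (at ?y)"
      unfolding K_def using y by (auto intro!: derivative_eq_intros)
    from DERIV_chain2[OF this W_deriv_interior[OF t]]
    have dKW: "((\<lambda>t. K (W t)) has_real_derivative (- L * (p * ?y powr (p - 1)) + c * (r * ?y powr (r - 1))) * h ?y) (at t)" .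
    from DERIV_fun_powr[OF this Ky, of "(p - 1) / p"]
    have "((\<lambda>t. K (W t) powr ((p - 1) / p)) has_real_derivative
        (p - 1) / p * K ?y powr ((p - 1) / p - 1) * ((- L * (p * ?y powr (p - 1)) + c * (r * ?y powr (r - 1))) * h ?y)) (at t)"
      by simp
    moreover have "(p - 1) / p * K ?y powr ((p - 1) / p - 1) * ((- L * (p * ?y powr (p - 1)) + c * (r * ?y powr (r - 1))) * h ?y)
       = (p - 1) / p * (- L * (p * ?y powr (p - 1)) + c * (r * ?y powr (r - 1)))"
    proof -
      have "K ?y powr ((p - 1) / p - 1) * h ?y = 1"
        unfolding hy using Ky p by (simp add: diff_divide_distrib flip: powr_add)
      then have "a * K ?y powr ((p - 1) / p - 1) * (z * h ?y) = a * z" for a z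
        using mult.assoc mult.commute by (metis mult_1_right)
      then show ?thesis .
    qed
    moreover have hK: "h y powr (p - 1) = K y powr ((p - 1) / p)" for y
      by (simp add: h_def powr_powr)
    ultimately have "((\<lambda>t. h (W t) powr (p - 1)) has_real_derivative
        (p - 1) / p * (- L * (p * ?y powr (p - 1)) + c * (r * ?y powr (r - 1)))) (at t)"
      by (simp only: hK)
    from DERIV_mult[OF W_deriv_interior[OF t] this]
    have "((\<lambda>t. W t * h (W t) powr (p - 1)) has_real_derivative
        h ?y * h ?y powr (p - 1) + (p - 1) / p * (- L * (p * ?y powr (p - 1)) + c * (r * ?y powr (r - 1))) * ?y) (at t)" .
    moreover have "h ?y * h ?y powr (p - 1) + (p - 1) / p * (- L * (p * ?y powr (p - 1)) + c * (r * ?y powr (r - 1))) * ?y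
       = h ?y powr p - (p - 1) * L * ?y powr p + (p - 1) * c * (r / p) * ?y powr r"
    proof -
      have 1: "?y powr p = ?y powr (p - 1) * ?y" "?y powr r = ?y powr (r - 1) * ?y" "h ?y powr p = h ?y * h ?y powr (p - 1)"
        using y h_props(1)[of ?y] by (auto simp: powr_mult_base mult.commute)
      show ?thesis unfolding 1 using p by (simp add: field_simps)
    qed
    ultimately show "((\<lambda>t. W t * h (W t) powr (p - 1)) has_vector_derivative
       h ?y powr p - (p - 1) * L * ?y powr p + (p - 1) * c * (r / p) * ?y powr r) (at t)"
      by (simp add: has_real_derivative_iff_has_vector_derivative)
  qed (use T_pos in simp)
  then have 0: "((\<lambda>t. h (W t) powr p - (p - 1) * L * W t powr p + (p - 1) * c * (r / p) * W t powr r) has_integral 0) {0..T}"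
    using p by (simp add: W_0 W_T h_props(2))
  have "((\<lambda>t. h (W t) powr p - (p - 1) * L * W t powr p + (p - 1) * c * (r / p) * W t powr r) has_integral
     (integral {0..T} (\<lambda>t. h (W t) powr p) - (p - 1) * L * integral {0..T} (\<lambda>t. W t powr p) +
      (p - 1) * c * (r / p) * integral {0..T} (\<lambda>t. W t powr r))) {0..T}"
    using p r by (intro has_integral_add has_integral_diff has_integral_mult_right integrable_integral
        integrable_continuous_real c1 c2) auto
  from has_integral_unique[OF this 0] show ?thesis by simp
qed

end

section \<open>Arcs folded to functions on [-1, 1], and the critical multiplier\<close>

lemma has_real_derivative_glue:
  fixes f :: "real \<Rightarrow> real"
  assumes 1: "\<And>x. x \<in> {a..b} \<Longrightarrow> (f has_real_derivative f' x) (at x within {a..b})"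
    and 2: "\<And>x. x \<in> {b..c} \<Longrightarrow> (f has_real_derivative f' x) (at x within {b..c})"
    and abc: "a \<le> b" "b \<le> c" and x: "x \<in> {a..c}"
  shows "(f has_real_derivative f' x) (at x within {a..c})"
proof -
  \<comment> \<open>Off a closed set the filter within that set is trivial, so the derivative may be
    claimed there as well and both pieces treated alike at every point.\<close>
  have triv: "(f has_real_derivative f' x) (at x within S)" if "closed S" "x \<notin> S" for S
  proof -
    have "at x within S = bot"
      using that by (simp add: at_within_eq_bot_iff closure_closed Diff_insert_absorb)
    then show ?thesis by (simp add: has_field_derivative_iff)
  qed
  have "(f has_real_derivative f' x) (at x within {a..b})" "(f has_real_derivative f' x) (at x within {b..c})"
    using 1[of x] 2[of x] triv[of "{a..b}"] triv[of "{b..c}"] by blast+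
  then have "(f has_real_derivative f' x) (at x within {a..b} \<union> {b..c})"
    unfolding has_field_derivative_iff by (rule Lim_Un)
  moreover have "{a..b} \<union> {b..c} = {a..c}" using abc by auto
  ultimately show ?thesis by simp
qed

lemma has_real_derivative_reflect:
  fixes f :: "real \<Rightarrow> real"
  assumes "(f has_real_derivative d) (at (s - x) within {s - b..s - a})"
  shows "((\<lambda>x. f (s - x)) has_real_derivative - d) (at x within {a..b})"
proof -
  have im: "(\<lambda>x. s - x) ` {a..b} \<subseteq> {s - b..s - a}" by auto
  have "((\<lambda>x. s - x) has_real_derivative - 1) (at x within {a..b})"
    by (auto intro!: derivative_eq_intros)
  from DERIV_image_chain[OF has_field_derivative_subset[OF assms im] this]
  show ?thesis by (simp add: o_def)
qed

lemma has_real_derivative_shift: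
  fixes f :: "real \<Rightarrow> real"
  assumes "(f has_real_derivative d) (at (s + x) within {s + a..s + b})"
  shows "((\<lambda>x. f (s + x)) has_real_derivative d) (at x within {a..b})"
proof -
  have im: "(\<lambda>x. s + x) ` {a..b} \<subseteq> {s + a..s + b}" by auto
  have "((\<lambda>x. s + x) has_real_derivative 1) (at x within {a..b})"
    by (auto intro!: derivative_eq_intros)
  from DERIV_image_chain[OF has_field_derivative_subset[OF assms im] this]
  show ?thesis by (simp add: o_def)
qed

lemma has_integral_shift_reflect:
  fixes f :: "real \<Rightarrow> real"
  assumes "(f has_integral I) {a..b}"
  shows "((\<lambda>x. f (s - x)) has_integral I) {s - b..s - a}" "((\<lambda>x. f (s + x)) has_integral I) {a - s..b - s}"
proof -
  show 1: "((\<lambda>x. f (s + x)) has_integral I) {a - s..b - s}" for s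
    using has_integral_affinity[of f I a b 1 s] assms by (simp add: add.commute)
  show "((\<lambda>x. f (s - x)) has_integral I) {s - b..s - a}"
    using 1[of s] has_integral_reflect_real[of "\<lambda>x. f (s + x)" I "b - s" "a - s"] by simp
qed

context profile
begin

text \<open>The fold at 0 is of class C^1 because the arc arrives there with speed zero,
  \<open>h (W 1) = 0\<close>.\<close>

lemma folded_C1_pair:
  assumes T: "T = 1"
  shows "C1_pair (\<lambda>x. W (1 - \<bar>x\<bar>)) (\<lambda>x. - sgn x * h (W (1 - \<bar>x\<bar>)))"
  unfolding C1_pair_def
proof (intro conjI ballI)
  let ?w = "\<lambda>x. W (1 - \<bar>x\<bar>)" and ?v = "\<lambda>x. - sgn x * h (W (1 - \<bar>x\<bar>))"
  have h0: "h (W 1) = 0" using W_T h_props(2) T by simp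
  have v: "?v x = (if x \<le> 0 then h (W (1 + x)) else - h (W (1 - x)))" for x
    using h0 by (auto simp: sgn_if)
  show "(?w has_real_derivative ?v x) (at x within {-1..1})" if "x \<in> {-1..1}" for x
  proof (rule has_real_derivative_glue[where b = 0])
    fix x :: real assume x: "x \<in> {-1..0}"
    have "((\<lambda>x. W (1 + x)) has_real_derivative h (W (1 + x))) (at x within {-1..0})"
      by (rule has_real_derivative_shift) (use W_deriv[of "1 + x"] T x in auto)
    then show "(?w has_real_derivative ?v x) (at x within {-1..0})"
      unfolding v by (rule has_field_derivative_transform_within[where d = 1, THEN DERIV_cong]) (use x in auto)
  next
    fix x :: real assume x: "x \<in> {0..1}"
    have "((\<lambda>x. W (1 - x)) has_real_derivative - h (W (1 - x))) (at x within {0..1})"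
      by (rule has_real_derivative_reflect) (use W_deriv[of "1 - x"] T x in auto)
    then show "(?w has_real_derivative ?v x) (at x within {0..1})"
      unfolding v by (rule has_field_derivative_transform_within[where d = 1, THEN DERIV_cong]) (use x h0 in auto)
  qed (use that in auto)
  have "continuous_on {-1..1} (\<lambda>x. if x \<le> 0 then h (W (1 + x)) else - h (W (1 - x)))"
  proof -
    have "continuous_on {-1..0} (\<lambda>x. h (W (1 + x)))" "continuous_on {0..1} (\<lambda>x. - h (W (1 - x)))"
      using T by (auto intro!: continuous_on_compose2[OF hW_cont] continuous_intros)
    then have "continuous_on ({-1..0} \<union> {0..1}) (\<lambda>x. if x \<le> 0 then h (W (1 + x)) else - h (W (1 - x)))"
      by (intro continuous_on_cases) (use h0 in auto)
    moreover have "{-1..0} \<union> {0..1} = {-1..1::real}" by auto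
    ultimately show ?thesis by simp
  qed
  then show "continuous_on {-1..1} ?v" unfolding v .
qed (use W_0 in auto)

lemma folded_integral:
  fixes G :: "real \<Rightarrow> real"
  assumes T: "T = 1" and G: "continuous_on {0..1} G"
  shows "integral {-1..1} (\<lambda>x. G (1 - \<bar>x\<bar>)) = 2 * integral {0..1} G"
proof -
  have I: "(G has_integral integral {0..1} G) {0..1}"
    using integrable_continuous_real[OF G] by (rule integrable_integral)
  have "((\<lambda>x. G (1 - \<bar>x\<bar>)) has_integral integral {0..1} G) {0..1}"
    by (rule has_integral_eq[OF _ has_integral_shift_reflect(1)[OF I, of 1, simplified]]) auto
  moreover have "((\<lambda>x. G (1 - \<bar>x\<bar>)) has_integral integral {0..1} G) {-1..0}"
    by (rule has_integral_eq[OF _ has_integral_shift_reflect(2)[OF I, of 1, simplified]]) auto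
  ultimately have "((\<lambda>x. G (1 - \<bar>x\<bar>)) has_integral integral {0..1} G + integral {0..1} G) {-1..1}"
    by (intro has_integral_combine[of "-1" 0 1]) auto
  then show ?thesis by (simp add: integral_unique)
qed

end

text \<open>The endpoint \<open>c = L\<close> of the range of multipliers, where
  \<open>e = L - c\<close> vanishes. Together with the factor from \<open>L\<close> the time becomes
  \<open>p / (2 * (p - r))\<close>, which is at least 1 exactly when
  \<open>r \<ge> p / 2\<close>.\<close>

lemma critical_profile_subcritical:
  fixes p r :: real
  assumes p: "p \<ge> 2" and r: "p / 2 \<le> r" "r < p"
  defines "q \<equiv> p - r"
  shows "((\<lambda>y. (y powr r - y powr p) powr (- (1 / p))) has_integral p / q * arc_const p) {0<..<1}"
proof -
  have q: "q > 0" "q < p" using r p by (auto simp: q_def)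
  \<comment> \<open>\<open>y\<^sup>r - y\<^sup>p = y\<^sup>r (1 - y\<^sup>q)\<close>, and this substitution absorbs the factor \<open>y\<^bsup>-r/p\<^esup>\<close> exactly.\<close>
  define g where "g y = y powr (q / p)" for y :: real
  define f where "f v = (1 - v powr p) powr (- (1 / p))" for v :: real
  have img: "g ` {0<..<1} = {0<..<1}"
  proof (intro equalityI subsetI)
    fix v assume v: "v \<in> {0<..<1::real}"
    then have "g (v powr (p / q)) = v" using p q by (simp add: g_def powr_powr)
    moreover have "v powr (p / q) \<in> {0<..<1}" using v p q powr_less_mono2[of "p / q" v 1] by auto
    ultimately show "v \<in> g ` {0<..<1}" by (metis imageI)
  next
    fix v assume "v \<in> g ` {0<..<1}"
    then obtain y where "v = y powr (q / p)" "0 < y" "y < 1" by (auto simp: g_def)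
    then show "v \<in> {0<..<1}" using powr_less_mono2[of "q / p" y 1] p q by simp
  qed
  have inj: "inj_on g {0<..<1}"
  proof (rule linorder_inj_onI)
    show "g x \<noteq> g y" if "x < y" "x \<in> {0<..<1}" "y \<in> {0<..<1}" for x y
      using powr_less_mono2[of "q / p" x y] that p q by (auto simp: g_def)
  qed auto
  have dg: "(g has_real_derivative q / p * y powr (q / p - 1)) (at y within {0<..<1})" if "y \<in> {0<..<1}" for y
    unfolding g_def using that by (auto intro!: derivative_eq_intros)
  have f: "f absolutely_integrable_on {0<..<1}" "integral {0<..<1} f = arc_const p"
  proof -
    have "f integrable_on {0..1}" unfolding f_def by (rule arc_integrand_integrable[OF p])
    then show "f absolutely_integrable_on {0<..<1}"
      by (intro nonnegative_absolutely_integrable_1) (auto simp: integrable_on_open_interval_real f_def)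
    show "integral {0<..<1} f = arc_const p"
      unfolding arc_const_def f_def[abs_def] by (rule integral_open_interval_real[symmetric])
  qed
  define k where "k y = q / p * (y powr r - y powr p) powr (- (1 / p))" for y :: real
  have k: "\<bar>q / p * y powr (q / p - 1)\<bar> * f (g y) = k y" if y: "y \<in> {0<..<1}" for y
  proof -
    have "y powr r * y powr q = y powr (r + q)" by (simp only: powr_add)
    then have "y powr r - y powr p = y powr r * (1 - y powr q)" by (simp add: right_diff_distrib q_def)
    moreover have "y powr q \<le> 1" using y q by (simp add: powr_le1)
    ultimately have "(y powr r - y powr p) powr (- (1 / p)) = y powr (- (r / p)) * (1 - y powr q) powr (- (1 / p))"
      by (simp add: powr_mult powr_powr)
    moreover have "q / p - 1 = - (r / p)" using p by (simp add: q_def field_simps)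
    moreover have "f (g y) = (1 - y powr q) powr (- (1 / p))" using p by (simp add: f_def g_def powr_powr)
    ultimately show ?thesis using p q by (simp add: k_def abs_mult)
  qed
  have "(\<lambda>y. \<bar>q / p * y powr (q / p - 1)\<bar> * f (g y)) absolutely_integrable_on {0<..<1} \<and>
      integral {0<..<1} (\<lambda>y. \<bar>q / p * y powr (q / p - 1)\<bar> * f (g y)) = arc_const p"
  proof (rule has_absolute_integral_change_of_variables_1'[THEN iffD2, OF _ _ inj])
    show "f absolutely_integrable_on g ` {0<..<1} \<and> integral (g ` {0<..<1}) f = arc_const p"
      unfolding img using f ..
  qed (use dg in auto)
  then have "((\<lambda>y. \<bar>q / p * y powr (q / p - 1)\<bar> * f (g y)) has_integral arc_const p) {0<..<1}"
    by (auto simp: absolutely_integrable_on_def has_integral_iff)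
  then have "(k has_integral arc_const p) {0<..<1}"
    by (rule has_integral_eq[rotated]) (use k in auto)
  from has_integral_mult_right[OF this, of "p / q"] show ?thesis
    using p q by (simp add: k_def)
qed

text \<open>For \<open>r < p\<close>, the intermediate value theorem for the time
  \<open>\<Phi> c\<close> of the climb from 0 to 1: it is 1/2 at \<open>c = 0\<close> by isochrony
  and at least 1 at \<open>c = L\<close>. The integrands increase with \<open>c\<close>, so the one
  for \<open>c = L\<close> dominates and gives continuity. For \<open>r = p\<close> the potential is
  \<open>(L - c) * (1 - y powr p)\<close>, and time 1 is reached when the p-th root of
  \<open>L - c\<close> is half that of \<open>L\<close>.\<close>

lemma critical_constant:
  fixes p r :: real
  assumes p: "p \<ge> 2" and r: "p / 2 \<le> r" "r \<le> p"
  defines "L \<equiv> eig_const p"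
  obtains c where "0 < c" "c \<le> L" "profile p r L (L - c) c 1 1" "r = p \<longrightarrow> c = (1 - 1 / 2 powr p) * L"
proof (cases "r = p")
  case True
  have L: "L > 0" "L powr (1 / p) = 2 * arc_const p" using eig_const[OF p] by (auto simp: L_def)
  define L' where "L' = L / 2 powr p"
  have L': "L' > 0" "L' powr (1 / p) = arc_const p"
    using L p by (auto simp: L'_def powr_divide powr_powr)
  have arc: "arc_const p > 0" by (rule arc_const_pos[OF p])
  define c where "c = (1 - 1 / 2 powr p) * L"
  have "(1::real) < 2 powr p" using p powr_less_mono[of 0 p "2::real"] by simp
  then have "L / 2 powr p < L" using L by (simp add: divide_less_eq)
  then have c: "0 < c" "c \<le> L" "L - c = L'"
    using L by (simp_all add: c_def L'_def left_diff_distrib)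
  have K: "L - c - L * y powr p + c * y powr r = L' - L' * y powr p" for y
    using c(3) by (simp add: True algebra_simps flip: c(3))
  have "profile p r L (L - c) c 1 1"
  proof
    show "L - c - L * y powr p + c * y powr r > 0" if "y \<in> {0<..<1}" for y
      using that p L' powr_less_mono2[of p y 1] unfolding K by simp
    show "((\<lambda>y. (L - c - L * y powr p + c * y powr r) powr (- (1 / p))) has_integral 1) {0..1}"
      unfolding K using scaled_arc_has_integral[OF p L'(1) L'(1)] L' arc by simp
  qed (use p r c L L' in auto)
  with c(1,2) show ?thesis by (rule that) (simp add: c_def)
next
  case False
  with r have r': "r < p" by simp
  have L: "L > 0" "L powr (1 / p) = 2 * arc_const p" using eig_const[OF p] by (auto simp: L_def)
  have arc: "arc_const p > 0" by (rule arc_const_pos[OF p])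
  define K where "K c y = L * (1 - y powr p) - c * (1 - y powr r)" for c y
  define k where "k c y = K c y powr (- (1 / p))" for c y
  have base: "L * (y powr r - y powr p) > 0" if "y \<in> {0<..<1}" for y
    using that r' L powr_less_mono'[of y r p] by simp
  have KL: "K c y \<ge> L * (y powr r - y powr p)" if "c \<le> L" "y \<in> {0<..<1}" for c y
  proof -
    have "y powr r \<le> 1" using that r p by (simp add: powr_le1)
    then have "c * (1 - y powr r) \<le> L * (1 - y powr r)" using that by (intro mult_right_mono) auto
    then show ?thesis by (simp add: K_def algebra_simps)
  qed
  have "((\<lambda>y. L powr (- (1 / p)) * (y powr r - y powr p) powr (- (1 / p))) has_integral
      L powr (- (1 / p)) * (p / (p - r) * arc_const p)) {0<..<1}"
    by (intro has_integral_mult_right critical_profile_subcritical p r r')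
  moreover have "L powr (- (1 / p)) * (p / (p - r) * arc_const p) = p / (2 * (p - r))"
    using L arc by (simp add: powr_minus field_simps)
  ultimately have kL: "(k L has_integral p / (2 * (p - r))) {0<..<1}"
  proof (subst has_integral_cong[where g = "\<lambda>y. L powr (- (1 / p)) * (y powr r - y powr p) powr (- (1 / p))"])
    fix y :: real assume y: "y \<in> {0<..<1}"
    have "K L y = L * (y powr r - y powr p)" by (simp add: K_def algebra_simps)
    then show "k L y = L powr (- (1 / p)) * (y powr r - y powr p) powr (- (1 / p))"
      using L by (simp add: k_def powr_mult)
  qed simp
  have kle: "k c y \<le> k L y" if "c \<le> L" "y \<in> {0<..<1}" for c y
  proof -
    have "K L y = L * (y powr r - y powr p)" by (simp add: K_def algebra_simps)
    then show ?thesis unfolding k_def using base[OF that(2)] KL[OF that] p by (intro powr_mono2') auto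
  qed
  have kint: "k c integrable_on {0<..<1}" if "c \<le> L" for c
  proof (rule measurable_bounded_by_integrable_imp_integrable)
    show "k c \<in> borel_measurable (lebesgue_on {0<..<1})"
      unfolding k_def K_def by (intro borel_imp_lebesgue_on) measurable
    show "k L integrable_on {0<..<1}" using kL by blast
    show "norm (k c y) \<le> k L y" if "y \<in> {0<..<1}" for y
      using kle[OF \<open>c \<le> L\<close> that] by (simp add: k_def)
  qed simp
  define \<Phi> where "\<Phi> c = integral {0<..<1} (k c)" for c
  have "continuous_on {0..L} \<Phi>"
  proof (rule continuous_on_sequentiallyI)
    fix u a assume u: "\<forall>n. u n \<in> {0..L}" "a \<in> {0..L}" "u \<longlonglongrightarrow> a"
    show "(\<lambda>n. \<Phi> (u n)) \<longlonglongrightarrow> \<Phi> a" unfolding \<Phi>_def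
    proof (rule dominated_convergence(2)[where h = "k L"])
      show "k (u n) integrable_on {0<..<1}" for n using u by (intro kint) auto
      show "k L integrable_on {0<..<1}" using kL by blast
      fix y :: real assume y: "y \<in> {0<..<1}"
      show "norm (k (u n) y) \<le> k L y" for n using kle[OF _ y, of "u n"] u by (auto simp: k_def)
      have "K a y > 0" using KL[of a y] base[of y] u y by fastforce
      moreover have "(\<lambda>n. K (u n) y) \<longlonglongrightarrow> K a y" unfolding K_def by (intro tendsto_intros u)
      ultimately show "(\<lambda>n. k (u n) y) \<longlonglongrightarrow> k a y" unfolding k_def by (intro tendsto_powr tendsto_const) auto
    qed
  qed
  moreover have "\<Phi> 0 = 1 / 2"
  proof -
    have "(\<lambda>y. (L - L * y powr p) powr (- (1 / p))) = k 0" by (auto simp: k_def K_def algebra_simps)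
    then have "(k 0 has_integral 1 / 2) {0..1}"
      using half_period_integral[OF p L(1)] L by (simp add: L_def)
    then show ?thesis by (simp add: \<Phi>_def integral_unique flip: integral_open_interval_real)
  qed
  moreover have "\<Phi> L \<ge> 1" using kL r r' p by (simp add: \<Phi>_def integral_unique field_simps)
  ultimately have "\<exists>c. 0 \<le> c \<and> c \<le> L \<and> \<Phi> c = 1"
    using L by (intro IVT') auto
  then obtain c where c: "0 \<le> c" "c \<le> L" "\<Phi> c = 1" by blast
  with \<open>\<Phi> 0 = 1 / 2\<close> have c0: "c > 0" by (cases "c = 0") auto
  have Ke: "L - c - L * y powr p + c * y powr r = K c y" for y by (simp add: K_def algebra_simps)
  have "profile p r L (L - c) c 1 1"
  proof
    show "L - c - L * y powr p + c * y powr r > 0" if "y \<in> {0<..<1}" for y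
      unfolding Ke using KL[OF c(2) that] base[OF that] by simp
    have "(k c has_integral 1) {0<..<1}" using kint[OF c(2)] c(3) by (simp add: \<Phi>_def has_integral_iff)
    then show "((\<lambda>y. (L - c - L * y powr p + c * y powr r) powr (- (1 / p))) has_integral 1) {0..1}"
      unfolding Ke using has_integral_open_interval[of "k c" 1 0 1] by (simp add: k_def[abs_def] box_real cbox_interval)
  qed (use p r c in auto)
  with c0 c(2) show ?thesis by (rule that) (use False in simp)
qed

context profile
begin

text \<open>Substituting \<open>y = W t\<close> turns the gain into the integral of
  \<open>h (W t) powr p\<close>. This has two evaluations, by \<open>h powr p = K\<close> and by the
  energy identity; \<open>p - 1\<close> times the first plus the second eliminates the integral of
  \<open>W t powr p\<close>.\<close>

lemma gain_identity:
  "p * half_gain p r L e c M = (p - 1) * e * T + (p - 1) * c * (1 - r / p) * integral {0..T} (\<lambda>t. W t powr r)"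
proof -
  define g where "g y = max 0 (e - L * y powr p + c * y powr r) powr (1 - 1 / p)" for y
  have cg: "continuous_on {0..M} g"
    unfolding g_def using p r by (intro continuous_half_gain_integrand) auto
  have gh: "g y * h y = h y powr p" if "y \<in> {0..M}" for y
  proof -
    have "g y = K y powr (1 - 1 / p)" using K_nonneg[OF that] by (simp add: g_def K_def)
    moreover have "K y powr (1 - 1 / p) * K y powr (1 / p) = K y powr 1" by (simp flip: powr_add)
    ultimately show ?thesis using h_props(4)[OF that] K_nonneg[OF that] by (simp add: h_def)
  qed
  have hp: "h (W t) powr p = e - L * W t powr p + c * W t powr r" if "t \<in> {0..T}" for t
    using h_props(4)[OF W_in[OF that]] by (simp add: K_def)
  have "((\<lambda>t. h (W t) powr p) has_integral integral {0..W T} g - integral {0..W 0} g) {0..T}"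
  proof (rule fundamental_theorem_of_calculus)
    fix t assume t: "t \<in> {0..T}"
    have "((\<lambda>y. integral {0..y} g) has_real_derivative g (W t)) (at (W t) within W ` {0..T})"
      using integral_has_real_derivative[OF cg W_in[OF t]]
      by (rule has_field_derivative_subset) (use W_in in blast)
    from DERIV_image_chain[OF this W_deriv[OF t]]
    have "((\<lambda>t. integral {0..W t} g) has_real_derivative g (W t) * h (W t)) (at t within {0..T})"
      by (simp add: o_def)
    then show "((\<lambda>t. integral {0..W t} g) has_vector_derivative h (W t) powr p) (at t within {0..T})"
      using gh[OF W_in[OF t]] by (simp add: has_real_derivative_iff_has_vector_derivative)
  qed (use T_pos in simp)
  then have X: "half_gain p r L e c M = integral {0..T} (\<lambda>t. h (W t) powr p)"
    by (simp add: W_0 W_T half_gain_def g_def[abs_def] integral_unique)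
  have c2: "continuous_on {0..T} (\<lambda>t. W t powr s)" if "s > 0" for s
    using that W_in by (intro continuous_on_powr' W_cont continuous_intros) auto
  have "((\<lambda>t. e - L * W t powr p + c * W t powr r) has_integral
     (T * e - L * integral {0..T} (\<lambda>t. W t powr p) + c * integral {0..T} (\<lambda>t. W t powr r))) {0..T}"
    using p r T_pos has_integral_const_real[of e 0 T]
    by (intro has_integral_add has_integral_diff has_integral_mult_right integrable_integral
        integrable_continuous_real c2) auto
  then have "((\<lambda>t. h (W t) powr p) has_integral
     (T * e - L * integral {0..T} (\<lambda>t. W t powr p) + c * integral {0..T} (\<lambda>t. W t powr r))) {0..T}"
    by (rule has_integral_eq[rotated]) (use hp in auto)
  then have Y: "half_gain p r L e c M = T * e - L * integral {0..T} (\<lambda>t. W t powr p) + c * integral {0..T} (\<lambda>t. W t powr r)"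
    unfolding X by (rule integral_unique)
  have Z: "half_gain p r L e c M =
     (p - 1) * L * integral {0..T} (\<lambda>t. W t powr p) - (p - 1) * c * (r / p) * integral {0..T} (\<lambda>t. W t powr r)"
    unfolding X by (rule energy_identity)
  have "p * X' = (p - 1) * e * T + (p - 1) * c * (1 - r / p) * B"
    if "X' = T * e - L * A + c * B" "X' = (p - 1) * L * A - (p - 1) * c * (r / p) * B" for X' A B
  proof -
    have "p * X' = (p - 1) * (T * e - L * A + c * B) + ((p - 1) * L * A - (p - 1) * c * (r / p) * B)"
      unfolding that(1)[symmetric] that(2)[symmetric] by (simp add: left_diff_distrib)
    then show ?thesis by (simp add: algebra_simps)
  qed
  from this[OF Y Z] show ?thesis .
qed

end

section \<open>The generalized sine\<close>

text \<open>At the level \<open>pi_p p powr p\<close> the zero of the potential is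
  \<open>(p - 1) powr (1 / p)\<close>, the amplitude of \<open>sin_p\<close>, so the arc is a
  quarter wave of \<open>sin_p\<close> itself and not of a multiple.\<close>

lemma sin_profile:
  assumes p: "p \<ge> 2"
  shows "profile p p (eig_const p) (pi_p p powr p) 0 ((p - 1) powr (1 / p)) (1 / 2)"
proof -
  have L: "eig_const p > 0" "pi_p p powr p = (p - 1) * eig_const p" using eig_const[OF p] by auto
  have M: "((p - 1) powr (1 / p)) powr p = p - 1" using p by (simp add: powr_powr)
  show ?thesis
  proof
    fix y assume y: "y \<in> {0<..<(p - 1) powr (1 / p)}"
    then have "y powr p < ((p - 1) powr (1 / p)) powr p" using p by (intro powr_less_mono2) auto
    then show "pi_p p powr p - eig_const p * y powr p + 0 * y powr p > 0" using L M by (simp add: mult.commute)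
  next
    have "pi_p p powr p / eig_const p = p - 1" using L by simp
    then show "((\<lambda>y. (pi_p p powr p - eig_const p * y powr p + 0 * y powr p) powr (- (1 / p))) has_integral 1 / 2)
       {0..(p - 1) powr (1 / p)}"
      using half_period_integral[OF p, of "pi_p p powr p"] pi_p_eq(2)[OF p] by simp
  qed (use p L M in \<open>auto simp: mult.commute\<close>)
qed

definition sin_arch :: "real \<Rightarrow> real \<Rightarrow> real" where
  "sin_arch p = profile.W p p (eig_const p) (pi_p p powr p) 0 ((p - 1) powr (1 / p))"

definition sin_arch_deriv :: "real \<Rightarrow> real \<Rightarrow> real" where
  "sin_arch_deriv p x = profile.h p p (eig_const p) (pi_p p powr p) 0 (sin_arch p x)"

lemma z_p_eq_sin_arch:
  assumes p: "p \<ge> 2" and t: "t \<in> {0..1 / 2}"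
  shows "z_p p (pi_p p * t) = sin_arch p t"
proof -
  interpret S: profile p p "eig_const p" "pi_p p powr p" 0 "(p - 1) powr (1 / p)" "1 / 2" by (rule sin_profile[OF p])
  have pi: "pi_p p > 0" by (rule pi_p_eq(2)[OF p])
  have F: "F_p p y = pi_p p * S.F y" if y: "y \<in> {0..(p - 1) powr (1 / p)}" for y
  proof -
    have "S.K s powr (- (1 / p)) = 1 / pi_p p * (1 - s powr p / (p - 1)) powr (- (1 / p))" for s
    proof -
      have "S.K s = pi_p p powr p * (1 - s powr p / (p - 1))"
        unfolding S.K_def by (simp add: eig_const_def right_diff_distrib)
      then have "S.K s powr (- (1 / p)) = (pi_p p powr p) powr (- (1 / p)) * (1 - s powr p / (p - 1)) powr (- (1 / p))"
        by (simp only: powr_mult)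
      then show ?thesis using p pi by (simp add: powr_powr powr_minus divide_inverse)
    qed
    then have "S.F y = 1 / pi_p p * integral {0..y} (\<lambda>s. (1 - s powr p / (p - 1)) powr (- (1 / p)))"
      unfolding S.F_def by simp
    then show ?thesis using F_p_eq[OF p, of y] y pi by simp
  qed
  have inj: "inj_on (F_p p) {0..(p - 1) powr (1 / p)}"
    using S.F_inj pi F by (auto simp: inj_on_def)
  have W: "S.W t \<in> {0..(p - 1) powr (1 / p)}" "S.F (S.W t) = t" using S.W_in[OF t] S.F_W[OF t] by auto
  then have "pi_p p * t = F_p p (S.W t)" using F by simp
  then show ?thesis unfolding z_p_def sin_arch_def using inv_into_f_f[OF inj W(1)] by simp
qed

definition sine_fn :: "real \<Rightarrow> real \<Rightarrow> real" where
  "sine_fn p x = sin_p p (pi_p p * x)"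

definition sine_fn_deriv :: "real \<Rightarrow> real \<Rightarrow> real" where
  "sine_fn_deriv p x = (if \<bar>x\<bar> \<le> 1 / 2 then sin_arch_deriv p \<bar>x\<bar> else - sin_arch_deriv p (1 - \<bar>x\<bar>))"

lemma sine_fn_eq:
  assumes p: "p \<ge> 2"
  shows "x \<in> {0..1} \<Longrightarrow> sine_fn p x = (if x \<le> 1 / 2 then sin_arch p x else sin_arch p (1 - x))"
    "x \<in> {-1..1} \<Longrightarrow> sine_fn p (- x) = - sine_fn p x"
proof -
  interpret S: profile p p "eig_const p" "pi_p p powr p" 0 "(p - 1) powr (1 / p)" "1 / 2" by (rule sin_profile[OF p])
  have pi: "pi_p p > 0" by (rule pi_p_eq(2)[OF p])
  have W0: "sin_arch p 0 = 0" by (simp add: sin_arch_def S.W_0)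
  define G where "G x = (if x \<le> 1 / 2 then sin_arch p x else sin_arch p (1 - x))" for x
  have half: "sin_p_half p (pi_p p * x) = G x" if "x \<in> {0..1}" for x
  proof -
    have "z_p p (pi_p p - pi_p p * x) = sin_arch p (1 - x)" if "x > 1 / 2"
      using z_p_eq_sin_arch[OF p, of "1 - x"] that \<open>x \<in> {0..1}\<close> by (simp add: right_diff_distrib)
    moreover have "pi_p p * x \<le> pi_p p / 2 \<longleftrightarrow> x \<le> 1 / 2" using pi by (simp add: field_simps)
    ultimately show ?thesis using z_p_eq_sin_arch[OF p, of x] that by (auto simp: sin_p_half_def G_def)
  qed
  have arg: "(pi_p p * x + pi_p p) / (2 * pi_p p) = (x + 1) / 2" for x
    using pi by (simp add: field_simps)
  have fl: "\<lfloor>(x + 1) / 2\<rfloor> = 0" if "x \<in> {-1..<1}" for x :: real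
    using that by (intro floor_unique) auto
  have pos: "sine_fn p x = G x" if x: "x \<in> {0..1}" for x
  \<comment> \<open>At \<open>x = 1\<close> the reduction modulo the period yields
    \<open>s = - pi_p p\<close>, so the value is \<open>- sin_p_half p (pi_p p)\<close>. It agrees
    with the formula for positive arguments because \<open>sin_arch p 0 = 0\<close>.\<close>
  proof (cases "x = 1")
    case True
    then show ?thesis
      using half[of 1] pi W0 by (simp add: sine_fn_def sin_p_def Let_def arg G_def)
  next
    case False
    then show ?thesis
      using half[of x] pi x fl[of x] by (simp add: sine_fn_def sin_p_def Let_def arg)
  qed
  then show "x \<in> {0..1} \<Longrightarrow> sine_fn p x = (if x \<le> 1 / 2 then sin_arch p x else sin_arch p (1 - x))"
    by (simp add: G_def)
  have neg: "sine_fn p (- x) = - G x" if x: "x \<in> {0<..1}" for x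
  proof -
    have f0: "\<lfloor>(- x + 1) / 2\<rfloor> = 0" using fl[of "- x"] x by simp
    moreover have "\<not> 0 \<le> pi_p p * (- x)" using pi x by (simp add: mult_le_0_iff not_le)
    ultimately show ?thesis
      using half[of x] x unfolding sine_fn_def sin_p_def Let_def arg f0 by simp
  qed
  show "sine_fn p (- x) = - sine_fn p x" if x: "x \<in> {-1..1}"
  proof -
    consider "x = 0" | "x > 0" | "x < 0" by linarith
    then show ?thesis
    proof cases
      case 1 then show ?thesis using pos[of 0] W0 by (simp add: G_def)
    next
      case 2 then show ?thesis using pos[of x] neg[of x] x by simp
    next
      case 3 then show ?thesis using pos[of "- x"] neg[of "- x"] x by simp
    qed
  qed
qed

text \<open>Four copies of the arc are glued: at the extrema the speed is zero, and at 0 oddness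
  makes the slopes match. The energy identity for \<open>c = 0\<close> then says that the quotient
  without the nonlocal term equals \<open>pi_p p powr p\<close>.\<close>

lemma sine_fn_C1_pair:
  assumes p: "p \<ge> 2"
  shows "C1_pair (sine_fn p) (sine_fn_deriv p)"
    "integral {-1..1} (\<lambda>x. \<bar>sine_fn_deriv p x\<bar> powr p) = pi_p p powr p * integral {-1..1} (\<lambda>x. \<bar>sine_fn p x\<bar> powr p)"
    "x0 \<in> {0<..1 / 2} \<Longrightarrow> sine_fn p x0 \<noteq> 0"
proof -
  interpret S: profile p p "eig_const p" "pi_p p powr p" 0 "(p - 1) powr (1 / p)" "1 / 2" by (rule sin_profile[OF p])
  let ?A = "sin_arch p" and ?B = "sin_arch_deriv p" and ?Y = "sine_fn p" and ?v = "sine_fn_deriv p"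
  have A: "?A = S.W" by (simp add: sin_arch_def)
  have B: "?B x = S.h (S.W x)" for x by (simp add: sin_arch_deriv_def A)
  have Bh: "?B (1 / 2) = 0" unfolding B by (simp add: S.W_T S.h_props)
  have dA: "(?A has_real_derivative ?B x) (at x within {0..1 / 2})" if "x \<in> {0..1 / 2}" for x
    unfolding A B by (rule S.W_deriv[OF that])
  have Y: "?Y x = (if x \<le> 1 / 2 then ?A x else ?A (1 - x))" if "x \<in> {0..1}" for x
    by (rule sine_fn_eq(1)[OF p that])
  have Y2: "?Y x = ?A (1 - x)" if "x \<in> {1 / 2..1}" for x
  proof (cases "x \<le> 1 / 2")
    case True
    then have e: "1 - x = x" using that by auto
    show ?thesis unfolding e using Y[of x] True that by simp
  qed (use Y[of x] that in auto)
  have v2: "?v x = - ?B (1 - x)" if "x \<in> {1 / 2..1}" for x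
  proof (cases "x \<le> 1 / 2")
    case True
    then have "x = 1 / 2" using that by auto
    show ?thesis unfolding \<open>x = 1 / 2\<close> using Bh by (simp add: sine_fn_deriv_def)
  qed (use that in \<open>auto simp: sine_fn_deriv_def\<close>)
  have odd: "?Y (- x) = - ?Y x" if "x \<in> {-1..1}" for x by (rule sine_fn_eq(2)[OF p that])
  have d01: "(?Y has_real_derivative ?v x) (at x within {0..1})" if "x \<in> {0..1}" for x
  proof (rule has_real_derivative_glue[where b = "1 / 2"])
    fix x :: real assume x: "x \<in> {0..1 / 2}"
    show "(?Y has_real_derivative ?v x) (at x within {0..1 / 2})"
      by (rule has_field_derivative_transform_within[where d = 1, OF dA[OF x, THEN DERIV_cong]])
        (use x Y in \<open>auto simp: sine_fn_deriv_def\<close>)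
  next
    fix x :: real assume x: "x \<in> {1 / 2..1}"
    have "((\<lambda>x. ?A (1 - x)) has_real_derivative - ?B (1 - x)) (at x within {1 / 2..1})"
      by (rule has_real_derivative_reflect) (use dA[of "1 - x"] x in auto)
    moreover have "- ?B (1 - x) = ?v x" using v2[OF x] by simp
    ultimately have "((\<lambda>x. ?A (1 - x)) has_real_derivative ?v x) (at x within {1 / 2..1})" by simp
    then show "(?Y has_real_derivative ?v x) (at x within {1 / 2..1})"
    proof (rule has_field_derivative_transform_within[where d = 1])
      show "?A (1 - y) = ?Y y" if "y \<in> {1 / 2..1}" for y
        using Y2[OF that] by simp
    qed (use x in auto)
  qed (use that in auto)
  have veven: "?v (- x) = ?v x" for x by (simp add: sine_fn_deriv_def)
  have cB: "continuous_on {0..1 / 2} ?B" unfolding B by (rule S.hW_cont)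
  have cv01: "continuous_on {0..1} ?v"
  proof -
    have "continuous_on {0..1 / 2} ?B" "continuous_on {1 / 2..1} (\<lambda>x. - ?B (1 - x))"
      using cB by (auto intro!: continuous_on_compose2[OF cB] continuous_intros)
    then have "continuous_on ({0..1 / 2} \<union> {1 / 2..1}) (\<lambda>x. if x \<le> 1 / 2 then ?B x else - ?B (1 - x))"
    proof (intro continuous_on_cases allI impI)
      fix x :: real assume "x \<in> {0..1 / 2} \<and> \<not> x \<le> 1 / 2 \<or> x \<in> {1 / 2..1} \<and> x \<le> 1 / 2"
      then have "x = 1 / 2" by auto
      show "?B x = - ?B (1 - x)" unfolding \<open>x = 1 / 2\<close> using Bh by simp
    qed auto
    moreover have "{0..1 / 2} \<union> {1 / 2..1} = {0..1::real}" by auto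
    ultimately have "continuous_on {0..1} (\<lambda>x. if x \<le> 1 / 2 then ?B x else - ?B (1 - x))" by simp
    then show ?thesis by (rule continuous_on_eq) (auto simp: sine_fn_deriv_def)
  qed
  have cY01: "continuous_on {0..1} ?Y" using d01 by (rule DERIV_continuous_on)
  show "C1_pair ?Y ?v" unfolding C1_pair_def
  proof (intro conjI ballI)
    show "(?Y has_real_derivative ?v x) (at x within {-1..1})" if "x \<in> {-1..1}" for x
    proof (rule has_real_derivative_glue[where b = 0])
      fix x :: real assume x: "x \<in> {-1..0}"
      have "((\<lambda>x. ?Y (0 - x)) has_real_derivative - ?v (0 - x)) (at x within {-1..0})"
        by (rule has_real_derivative_reflect) (use d01[of "- x"] x in auto)
      from DERIV_minus[OF this] have "((\<lambda>x. - ?Y (- x)) has_real_derivative ?v x) (at x within {-1..0})"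
        by (simp add: veven)
      then show "(?Y has_real_derivative ?v x) (at x within {-1..0})"
        by (rule has_field_derivative_transform_within[where d = 1]) (use x odd in auto)
    qed (use that d01 in auto)
    have "continuous_on {-1..0} ?v"
    proof -
      have "continuous_on {-1..0} (\<lambda>x. ?v (- x))"
        by (intro continuous_on_compose2[OF cv01] continuous_intros) auto
      then show ?thesis by (simp add: veven)
    qed
    then have "continuous_on ({-1..0} \<union> {0..1}) ?v"
      by (intro continuous_on_closed_Un cv01) auto
    moreover have "{-1..0} \<union> {0..1} = {-1..1::real}" by auto
    ultimately show "continuous_on {-1..1} ?v" by simp
    show "?Y 1 = 0" using Y[of 1] A S.W_0 by simp
    then show "?Y (- 1) = 0" using odd[of 1] by simp
  qed
  have four: "integral {-1..1} G = 4 * integral {0..1 / 2} g"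
    if g: "continuous_on {0..1 / 2} g" and G: "\<And>x. x \<in> {0..1 / 2} \<Longrightarrow> G x = g x"
      "\<And>x. x \<in> {1 / 2..1} \<Longrightarrow> G x = g (1 - x)" "\<And>x. x \<in> {0..1} \<Longrightarrow> G (- x) = G x" for g G :: "real \<Rightarrow> real"
  proof -
    have I: "(g has_integral integral {0..1 / 2} g) {0..1 / 2}"
      using integrable_continuous_real[OF g] by (rule integrable_integral)
    have 1: "(G has_integral integral {0..1 / 2} g) {0..1 / 2}"
      by (rule has_integral_eq[OF _ I]) (use G in auto)
    have 2: "(G has_integral integral {0..1 / 2} g) {1 / 2..1}"
      by (rule has_integral_eq[OF _ has_integral_shift_reflect(1)[OF I, of 1, simplified]]) (use G in auto)
    have 3: "(G has_integral 2 * integral {0..1 / 2} g) {0..1}"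
      using has_integral_combine[OF _ _ 1 2] by simp
    have "((\<lambda>x. G (0 - x)) has_integral 2 * integral {0..1 / 2} g) {0 - 1..0 - 0}"
      by (rule has_integral_shift_reflect(1)[OF 3])
    then have *: "((\<lambda>x. G (- x)) has_integral 2 * integral {0..1 / 2} g) {-1..0}" by simp
    have "(G has_integral 2 * integral {0..1 / 2} g) {-1..0}"
    proof (rule has_integral_eq[OF _ *])
      show "G (- x) = G x" if "x \<in> {-1..0}" for x using G(3)[of "- x"] that by simp
    qed
    from has_integral_combine[OF _ _ this 3] show ?thesis by (simp add: integral_unique)
  qed
  have Wn: "?A x \<ge> 0" if "x \<in> {0..1 / 2}" for x using S.W_in[OF that] by (simp add: A)
  have iY: "integral {-1..1} (\<lambda>x. \<bar>?Y x\<bar> powr p) = 4 * integral {0..1 / 2} (\<lambda>x. ?A x powr p)"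
  proof (rule four)
    show "continuous_on {0..1 / 2} (\<lambda>x. ?A x powr p)"
      using p Wn S.W_cont unfolding A by (intro continuous_on_powr' continuous_intros) (auto simp: A)
    show "\<bar>?Y x\<bar> powr p = ?A x powr p" if "x \<in> {0..1 / 2}" for x using Y[of x] Wn[OF that] that by simp
    show "\<bar>?Y x\<bar> powr p = ?A (1 - x) powr p" if "x \<in> {1 / 2..1}" for x
      using Y2[OF that] Wn[of "1 - x"] that by simp
    show "\<bar>?Y (- x)\<bar> powr p = \<bar>?Y x\<bar> powr p" if "x \<in> {0..1}" for x using odd[of x] that by simp
  qed
  have iv: "integral {-1..1} (\<lambda>x. \<bar>?v x\<bar> powr p) = 4 * integral {0..1 / 2} (\<lambda>x. ?B x powr p)"
  proof (rule four)
    show "continuous_on {0..1 / 2} (\<lambda>x. ?B x powr p)"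
      using p cB S.h_props(1) unfolding B by (intro continuous_on_powr' continuous_intros) (auto simp: B)
    show "\<bar>?v x\<bar> powr p = ?B x powr p" if "x \<in> {0..1 / 2}" for x
      using S.h_props(1) that by (simp add: sine_fn_deriv_def B)
    show "\<bar>?v x\<bar> powr p = ?B (1 - x) powr p" if "x \<in> {1 / 2..1}" for x
      using v2[OF that] S.h_props(1) by (simp add: B)
    show "\<bar>?v (- x)\<bar> powr p = \<bar>?v x\<bar> powr p" for x by (simp add: veven)
  qed
  show "integral {-1..1} (\<lambda>x. \<bar>?v x\<bar> powr p) = pi_p p powr p * integral {-1..1} (\<lambda>x. \<bar>?Y x\<bar> powr p)"
    unfolding iY iv using S.energy_identity eig_const(2)[OF p] by (simp add: A B)
  show "sine_fn p x0 \<noteq> 0" if "x0 \<in> {0<..1 / 2}"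
  proof -
    have "S.W x0 \<noteq> 0" using S.F_W[of x0] S.F_ends that by auto
    then show ?thesis using Y[of x0] that by (simp add: A)
  qed
qed

section \<open>The energy gap at the critical parameter\<close>

text \<open>The numerator of the quotient minus \<open>pi_p p powr p\<close> times its denominator:
  nonnegativity is the lower bound for the quotient, and minimizers at that value have gap zero. It
  is homogeneous of degree \<open>p\<close>.\<close>

definition energy_gap :: "real \<Rightarrow> real \<Rightarrow> real \<Rightarrow> (real \<Rightarrow> real) \<Rightarrow> (real \<Rightarrow> real) \<Rightarrow> real" where
  "energy_gap p r \<alpha> w v = integral {-1..1} (\<lambda>x. \<bar>v x\<bar> powr p) -
     pi_p p powr p * integral {-1..1} (\<lambda>x. \<bar>w x\<bar> powr p) +
     \<alpha> * \<bar>integral {-1..1} (\<lambda>x. spow r (w x))\<bar> powr (p / r)"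

lemma spow_mult: "spow r (a * y) = spow r a * spow r y"
  by (simp add: spow_def sgn_mult abs_mult powr_mult)

lemma ac_pair_scale:
  assumes "ac_pair p w v"
  shows "ac_pair p (\<lambda>x. a * w x) (\<lambda>x. a * v x)"
  unfolding ac_pair_def
proof (intro conjI ballI)
  note D = ac_pairD[OF assms]
  show "(\<lambda>x. a * v x) absolutely_integrable_on {-1..1}" using D(1) by simp
  show "(\<lambda>x. \<bar>a * v x\<bar> powr p) absolutely_integrable_on {-1..1}"
    using D(2) by (simp add: abs_mult powr_mult)
  show "a * w x = integral {-1..x} (\<lambda>x. a * v x)" if "x \<in> {-1..1}" for x
    using assms that by (simp add: ac_pair_def)
qed (use assms in \<open>simp add: ac_pair_def\<close>)

lemma energy_gap_scale:
  assumes "r \<noteq> 0"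
  shows "energy_gap p r \<alpha> (\<lambda>x. a * w x) (\<lambda>x. a * v x) = \<bar>a\<bar> powr p * energy_gap p r \<alpha> w v"
proof -
  have "\<bar>spow r a * I\<bar> powr (p / r) = \<bar>a\<bar> powr p * \<bar>I\<bar> powr (p / r)" for I
    using assms by (simp add: abs_mult powr_mult abs_spow powr_powr)
  then show ?thesis
    unfolding energy_gap_def spow_mult abs_mult powr_mult integral_mult_right
    by (simp add: algebra_simps)
qed

lemma potential_gain_split:
  fixes p r L e c a b :: real
  assumes p: "p > 1" and r: "r > 0" and ab: "a \<ge> 0" "b \<ge> 0"
  shows "integral {-a..b} (\<lambda>y. max 0 (potential p r L e c y) powr (1 - 1 / p)) =
    half_gain p r L e c b + half_gain p r L e (- c) a"
proof -
  let ?g = "\<lambda>y. max 0 (potential p r L e c y) powr (1 - 1 / p)"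
  have cg: "continuous_on S ?g" for S
    using p r by (intro continuous_max_powr continuous_potential continuous_intros) auto
  have "integral {-a..0} ?g + integral {0..b} ?g = integral {-a..b} ?g"
    using ab by (intro Henstock_Kurzweil_Integration.integral_combine integrable_continuous_real cg) auto
  moreover have "integral {0..b} ?g = half_gain p r L e c b"
    unfolding half_gain_def by (intro integral_cong) (simp add: potential_def spow_nonneg)
  moreover have "integral {-a..0} ?g = half_gain p r L e (- c) a"
  proof -
    have "integral {-a..0} ?g = integral {0..a} (\<lambda>y. ?g (- y))"
      using Henstock_Kurzweil_Integration.integral_reflect_real[of a 0 "\<lambda>y. ?g (- y)"] by simp
    also have "\<dots> = half_gain p r L e (- c) a"
      unfolding half_gain_def by (intro integral_cong) (simp add: potential_def spow_nonneg)
    finally show ?thesis .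
  qed
  ultimately show ?thesis by simp
qed

lemma potential_nonneg:
  fixes p r L e c a b y :: real
  assumes r: "0 < r" "r \<le> p" and L: "L > 0" and e: "e \<ge> 0"
    and b: "e - L * b powr p + c * b powr r \<ge> 0" and a: "e - L * a powr p + (- c) * a powr r \<ge> 0"
    and y: "y \<in> {-a..b}"
  shows "potential p r L e c y \<ge> 0"
proof (cases "y \<ge> 0")
  case True
  then show ?thesis
    using potential_half_nonneg[OF r L e, of y b c] b y by (simp add: potential_def spow_nonneg)
next
  case False
  have "spow r y = - ((- y) powr r)" using spow_simps(2)[of r "- y"] spow_nonneg[of "- y" r] False by simp
  moreover have "\<bar>y\<bar> = - y" using False by simp
  ultimately show ?thesis
    using potential_half_nonneg[OF r L e, of "- y" a "- c"] a y False by (simp add: potential_def)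
qed

lemma half_gain_mono_interval:
  fixes p r L e c b b' :: real
  assumes "p > 1" "r > 0" "b \<le> b'"
  shows "half_gain p r L e c b \<le> half_gain p r L e c b'"
  unfolding half_gain_def
  using assms by (intro integral_subset_le integrable_continuous_real continuous_half_gain_integrand) auto

lemma half_gain_nonneg:
  fixes p r L e c b :: real
  assumes "p > 1" "r > 0"
  shows "half_gain p r L e c b \<ge> 0"
  unfolding half_gain_def
  using assms by (intro Henstock_Kurzweil_Integration.integral_nonneg integrable_continuous_real continuous_half_gain_integrand) auto

lemma half_gain_pos:
  fixes p r L e c b :: real
  assumes "p > 1" "r > 0" "b > 0" and pos: "\<And>y. y \<in> {0<..<b} \<Longrightarrow> e - L * y powr p + c * y powr r > 0"
  shows "half_gain p r L e c b > 0"
proof -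
  have "0 < integral {0<..<b} (\<lambda>y. max 0 (e - L * y powr p + c * y powr r) powr (1 - 1 / p))"
  proof (rule integral_pos_Ioo)
    show "(\<lambda>y. max 0 (e - L * y powr p + c * y powr r) powr (1 - 1 / p)) integrable_on {0<..<b}"
      unfolding integrable_on_open_interval_real
      by (intro integrable_continuous_real continuous_half_gain_integrand assms)
    show "0 < max 0 (e - L * y powr p + c * y powr r) powr (1 - 1 / p)" if "y \<in> {0<..<b}" for y
      using pos[OF that] by simp
  qed (use assms in auto)
  then show ?thesis by (simp add: half_gain_def flip: integral_open_interval_real)
qed

locale critical =
  fixes p r c0 :: real
  assumes p: "p \<ge> 2" and r: "p / 2 \<le> r" "r \<le> p" and c0: "0 < c0" "c0 \<le> eig_const p"
    and prof: "profile p r (eig_const p) (eig_const p - c0) c0 1 1"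
begin

abbreviation "L \<equiv> eig_const p"
abbreviation "e0 \<equiv> L - c0"

sublocale P: profile p r L e0 c0 1 1 by (rule prof)

definition s0 where "s0 = 2 * integral {0..1} (\<lambda>t. P.W t powr r)"
text \<open>Chosen so that \<open>alpha0 * s powr (p / r)\<close> has slope
  \<open>(p - 1) * c0\<close> at \<open>s0\<close>, the nonlocal integral of the folded profile;
  this makes \<open>c0\<close> its Lagrange multiplier.\<close>

definition alpha0 where "alpha0 = (p - 1) * c0 * (r / p) * s0 powr (1 - p / r)"

lemma param_bounds: "p > 1" "r > 0" "L > 0" "e0 \<ge> 0" "pi_p p powr p = (p - 1) * L"
  using p r c0 eig_const[OF p] by auto

lemma s0_pos: "s0 > 0"
proof -
  have "0 < integral {0<..<1} (\<lambda>t. P.W t powr r)"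
  proof (rule integral_pos_Ioo)
    have "continuous_on {0..1} (\<lambda>t. P.W t powr r)"
      using param_bounds P.W_in by (intro continuous_on_powr' P.W_cont continuous_intros) auto
    then show "(\<lambda>t. P.W t powr r) integrable_on {0<..<1}"
      unfolding integrable_on_open_interval_real by (rule integrable_continuous_real)
    show "P.W t powr r > 0" if "t \<in> {0<..<1}" for t using P.W_interior[OF that] by simp
  qed simp
  then show ?thesis by (simp add: s0_def flip: integral_open_interval_real)
qed

lemma alpha0_pos: "alpha0 > 0"
  using param_bounds c0 s0_pos by (simp add: alpha0_def)

text \<open>Convexity for the exponent \<open>p / r \<ge> 1\<close>: the right-hand side is the
  tangent at \<open>s0\<close>. It replaces the nonlocal term by a linear one with multiplier
  \<open>c0\<close>; for \<open>r = p\<close> the tangent passes through the origin.\<close>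

lemma alpha0_tangent:
  "alpha0 * \<bar>s\<bar> powr (p / r) \<ge> (p - 1) * c0 * s - (p - 1) * c0 * (1 - r / p) * s0"
proof (cases "r = p")
  case True
  have "(p - 1) * c0 * s \<le> (p - 1) * c0 * \<bar>s\<bar>"
    using param_bounds c0 by (intro mult_left_mono) auto
  moreover have "r / p = 1" "p / r = 1" using True param_bounds by auto
  moreover have "alpha0 = (p - 1) * c0" unfolding alpha0_def calculation(2,3) using s0_pos by simp
  ultimately show ?thesis by simp
next
  case False
  define k where "k = p / r"
  have k: "k > 1" using False r param_bounds by (simp add: k_def)
  have "alpha0 * (k * s0 powr (k - 1) * \<bar>s\<bar> - (k - 1) * s0 powr k) \<le> alpha0 * \<bar>s\<bar> powr k"
    using powr_tangent(1)[OF k, of "\<bar>s\<bar>" s0] s0_pos alpha0_pos by (intro mult_left_mono) auto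
  moreover have "alpha0 * (k * s0 powr (k - 1) * \<bar>s\<bar> - (k - 1) * s0 powr k) =
     (p - 1) * c0 * \<bar>s\<bar> - (p - 1) * c0 * (1 - r / p) * s0"
  proof -
    have a: "alpha0 = (p - 1) * c0 * (r / p) * s0 powr (1 - k)" by (simp add: alpha0_def k_def)
    have 1: "s0 powr (1 - k) * s0 powr (k - 1) = 1" "s0 powr (1 - k) * s0 powr k = s0"
      using s0_pos by (simp_all flip: powr_add)
    have 2: "r / p * k = 1" "r / p * (k - 1) = 1 - r / p" using param_bounds by (auto simp: k_def field_simps)
    have 3: "q * \<rho> * E * (k * F * S - k1 * G) = q * (\<rho> * k) * (E * F) * S - q * (\<rho> * k1) * (E * G)"
      for q \<rho> E k F S k1 G :: real by (simp add: algebra_simps)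
    show ?thesis unfolding a 3 1 2 by simp
  qed
  moreover have "(p - 1) * c0 * s \<le> (p - 1) * c0 * \<bar>s\<bar>"
    using param_bounds c0 by (intro mult_left_mono) auto
  ultimately show ?thesis by (simp add: k_def)
qed

text \<open>For the range [0, 1] and the parameters \<open>e0\<close>, \<open>c0\<close>, the energy
  bound equals exactly the constant lost in the tangent inequality, so the two cancel and the gap of
  a positive function is at least zero with nothing to spare.\<close>

lemma critical_gain: "2 * p * half_gain p r L e0 c0 1 - 2 * (p - 1) * e0 = (p - 1) * c0 * (1 - r / p) * s0"
proof -
  have "2 * X - 2 * A = B * (2 * I)" if "X = A * 1 + B * I" for X A B I :: real
    using that by simp
  from this[OF P.gain_identity] show ?thesis by (simp only: s0_def mult.assoc)
qed

lemma gap_bound: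
  assumes w: "ac_pair p w v" and rng: "w ` {-1..1} \<subseteq> {-a..b}"
    and x: "x1 \<in> {-1..1}" "w x1 = b" "x2 \<in> {-1..1}" "w x2 = - a" and ab: "a \<ge> 0" "b \<ge> 0"
    and e: "e \<ge> 0"
    and ends: "e - L * b powr p + c * b powr r \<ge> 0" "e - L * a powr p + (- c) * a powr r \<ge> 0"
  defines "B \<equiv> 2 * p * (half_gain p r L e c b + half_gain p r L e (- c) a) - 2 * (p - 1) * e"
    and "s \<equiv> integral {-1..1} (\<lambda>x. spow r (w x))"
  shows "energy_gap p r alpha0 w v \<ge> B + alpha0 * \<bar>s\<bar> powr (p / r) - (p - 1) * c * s"
    "energy_gap p r alpha0 w v = B + alpha0 * \<bar>s\<bar> powr (p / r) - (p - 1) * c * s \<Longrightarrow>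
      AE x in lebesgue_on I_open. \<bar>v x\<bar> = max 0 (potential p r L e c (w x)) powr (1 / p)"
proof -
  have K: "potential p r L e c y \<ge> 0" if "y \<in> {-a..b}" for y
    using potential_nonneg[OF param_bounds(2) r(2) param_bounds(3) e ends that] .
  note elb = energy_lower_bound[OF w param_bounds(1,2) rng x(1,3,2,4) K, unfolded potential_gain_split[OF param_bounds(1,2) ab], folded s_def]
  show "energy_gap p r alpha0 w v \<ge> B + alpha0 * \<bar>s\<bar> powr (p / r) - (p - 1) * c * s"
    using elb(1) unfolding energy_gap_def B_def s_def param_bounds(5) by simp
  assume "energy_gap p r alpha0 w v = B + alpha0 * \<bar>s\<bar> powr (p / r) - (p - 1) * c * s"
  then show "AE x in lebesgue_on I_open. \<bar>v x\<bar> = max 0 (potential p r L e c (w x)) powr (1 / p)"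
    using elb(2) unfolding energy_gap_def B_def s_def param_bounds(5) by simp
qed

text \<open>The value \<open>- n\<close> still lies where the potential with \<open>e0\<close> and
  \<open>c0\<close> is nonnegative, so this potential serves and the negative side adds its gain as
  pure surplus. A zero gap makes the surplus vanish, hence \<open>n = 0\<close>, and the climb to 1
  then uses up all the time available.\<close>

lemma gap_small_negative_part:
  assumes w: "ac_pair p w v" and rng: "w ` {-1..1} \<subseteq> {-n..1}"
    and x: "x1 \<in> {-1..1}" "w x1 = 1" "x2 \<in> {-1..1}" "w x2 = - n" and n: "n \<ge> 0"
    and case1: "L * n powr p + c0 * n powr r \<le> e0"
  shows "energy_gap p r alpha0 w v \<ge> 0"
    "energy_gap p r alpha0 w v = 0 \<Longrightarrow> \<forall>x\<in>I_open. 0 < w x"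
proof -
  define s where "s = integral {-1..1} (\<lambda>x. spow r (w x))"
  let ?B = "2 * p * (half_gain p r L e0 c0 1 + half_gain p r L e0 (- c0) n) - 2 * (p - 1) * e0"
  have ends: "e0 - L * 1 powr p + c0 * 1 powr r \<ge> 0" "e0 - L * n powr p + (- c0) * n powr r \<ge> 0"
    using case1 by auto
  note gb = gap_bound[OF w rng x n zero_le_one param_bounds(4) ends, folded s_def]
  have "?B + alpha0 * \<bar>s\<bar> powr (p / r) - (p - 1) * c0 * s \<ge> 2 * p * half_gain p r L e0 (- c0) n"
    using critical_gain alpha0_tangent[of s] by (simp add: algebra_simps)
  moreover have hg: "2 * p * half_gain p r L e0 (- c0) n \<ge> 0"
    using half_gain_nonneg[OF param_bounds(1,2)] p by simp
  ultimately show "energy_gap p r alpha0 w v \<ge> 0" using gb(1) by linarith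
  assume 0: "energy_gap p r alpha0 w v = 0"
  then have eq: "energy_gap p r alpha0 w v = ?B + alpha0 * \<bar>s\<bar> powr (p / r) - (p - 1) * c0 * s"
    "2 * p * half_gain p r L e0 (- c0) n = 0"
    using gb(1) hg \<open>?B + alpha0 * \<bar>s\<bar> powr (p / r) - (p - 1) * c0 * s \<ge> 2 * p * half_gain p r L e0 (- c0) n\<close> by linarith+
  have n0: "n = 0"
  proof (rule ccontr)
    assume "n \<noteq> 0"
    then have n': "n > 0" using n by simp
    have "half_gain p r L e0 (- c0) n > 0"
    proof (rule half_gain_pos[OF param_bounds(1,2) n'])
      fix y assume y: "y \<in> {0<..<n}"
      \<comment> \<open>On the negative half line both terms of the potential decrease with the
        distance from 0, so it is positive strictly before \<open>n\<close>.\<close>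
      have "L * y powr p < L * n powr p" "c0 * y powr r < c0 * n powr r"
        using y param_bounds c0 by (auto intro!: mult_strict_left_mono powr_less_mono2)
      then show "e0 - L * y powr p + (- c0) * y powr r > 0" using case1 by simp
    qed
    then show False using eq(2) p by simp
  qed
  have AE: "AE x in lebesgue_on I_open. \<bar>v x\<bar> = max 0 (potential p r L e0 c0 (w x)) powr (1 / p)"
    by (rule gb(2)[OF eq(1)])
  define h where "h y = max 0 (potential p r L e0 c0 y) powr (1 / p)" for y
  have pot: "potential p r L e0 c0 y = e0 - L * y powr p + c0 * y powr r" if "y \<ge> 0" for y
    using that by (simp add: potential_def spow_nonneg)
  show "\<forall>x\<in>I_open. 0 < w x"
  proof
    fix x assume x': "x \<in> I_open"
    show "0 < w x"
    proof (rule positive_of_full_traversal[OF w _ _ _ _ _ _ x(1,2) x', where h = h])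
      show "w ` {-1..1} \<subseteq> {0..1}" using rng n0 by simp
      show "continuous_on {0..1} h"
        unfolding h_def using param_bounds by (intro continuous_max_powr continuous_potential continuous_intros) auto
      show "h y > 0" if "y \<in> {0<..<1}" for y
        using P.K_pos[OF that] pot[of y] that by (simp add: h_def)
      show "AE x in lebesgue_on I_open. \<bar>v x\<bar> \<le> h (w x)" using AE by eventually_elim (simp add: h_def)
      show "((\<lambda>y. 1 / h y) has_integral 1) {0..1}"
      proof (rule has_integral_eq[OF _ P.time])
        fix y :: real assume y: "y \<in> {0..1}"
        have "P.K y \<ge> 0" by (rule P.K_nonneg[OF y])
        then show "(e0 - L * y powr p + c0 * y powr r) powr (- (1 / p)) = 1 / h y"
          using pot[of y] y by (simp add: h_def P.K_def powr_minus_divide)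
      qed
    qed (simp add: h_def)
  qed
qed

text \<open>The potential with \<open>e0\<close> and \<open>c0\<close> is negative at
  \<open>- n\<close>, so the level must rise, while \<open>c0\<close> must stay for the tangent to
  cancel the linear term. After scaling, both ends are zeros at a level \<open>e > e0\<close>.
  Raising the level costs \<open>2 * (p - 1) * (e - e0)\<close>, which the two-sided gain
  covers.\<close>

lemma gap_large_negative_part:
  assumes w: "ac_pair p w v" and rng: "w ` {-1..1} \<subseteq> {-n..1}"
    and x: "x1 \<in> {-1..1}" "w x1 = 1" "x2 \<in> {-1..1}" "w x2 = - n" and n: "n \<ge> 0" "n < 1" and rp: "r < p"
    and case2: "L * n powr p + c0 * n powr r > e0"
  shows "energy_gap p r alpha0 w v \<ge> 0" "p / 2 < r \<Longrightarrow> energy_gap p r alpha0 w v > 0"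
proof -
  have n0: "n > 0" using case2 n param_bounds by (cases "n = 0") auto
  have np: "n powr p < 1" using n param_bounds powr_less_mono2[of p n 1] by simp
  \<comment> \<open>The scaling after which the potential with \<open>c = c0\<close> vanishes at both extreme values of \<open>w\<close>.\<close>
  define t where "t = (c0 * (1 + n powr r) / (L * (1 - n powr p))) powr (1 / (p - r))"
  have base: "c0 * (1 + n powr r) / (L * (1 - n powr p)) > 1"
    using case2 np param_bounds by (simp add: divide_simps algebra_simps)
  have t: "t > 1" using powr_less_mono2[of "1 / (p - r)" 1] base rp by (simp add: t_def)
  have tp: "L * (1 - n powr p) * t powr (p - r) = c0 * (1 + n powr r)"
  proof -
    have "c0 * (1 + n powr r) > 0" using c0 by (simp add: add_pos_nonneg)
    moreover have "L * (1 - n powr p) > 0" using np param_bounds by simp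
    ultimately have "t powr (p - r) = c0 * (1 + n powr r) / (L * (1 - n powr p))"
      using rp by (simp add: t_def powr_powr)
    then show ?thesis using \<open>L * (1 - n powr p) > 0\<close>
      by (metis less_irrefl nonzero_mult_div_cancel_left times_divide_eq_right)
  qed
  have split: "t powr p = t powr r * t powr (p - r)" by (simp flip: powr_add)
  define e where "e = L * t powr p - c0 * t powr r"
  have e_eq: "e = t powr r * (L * t powr (p - r) - c0)" unfolding e_def split by (simp add: algebra_simps)
  have e: "e > e0"
  proof -
    have "t powr (p - r) > 1" "t powr r > 1" using t rp param_bounds powr_less_mono2[of "p - r" 1 t] powr_less_mono2[of r 1 t] by auto
    then have "L * 1 < L * t powr (p - r)" using param_bounds by (intro mult_strict_left_mono) auto
    then have 1: "e0 < L * t powr (p - r) - c0" by simp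
    then have 2: "0 \<le> L * t powr (p - r) - c0" using param_bounds(4) by linarith
    note 1
    also have "\<dots> = 1 * (L * t powr (p - r) - c0)" by simp
    also have "\<dots> \<le> e" unfolding e_eq using 2 \<open>t powr r > 1\<close> by (intro mult_right_mono) auto
    finally show ?thesis .
  qed
  have end2: "e - L * (t * n) powr p + (- c0) * (t * n) powr r = 0"
  proof -
    have "e - L * (t * n) powr p + (- c0) * (t * n) powr r =
       t powr r * (L * (1 - n powr p) * t powr (p - r) - c0 * (1 + n powr r))"
      unfolding e_def powr_mult split by (simp add: algebra_simps)
    then show ?thesis unfolding tp by simp
  qed
  have end1: "e - L * t powr p + c0 * t powr r = 0" by (simp add: e_def)
  have tn: "t * n > 0" "t > 0" using t n0 by auto
  define s where "s = integral {-1..1} (\<lambda>x. spow r (t * w x))"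
  have w': "ac_pair p (\<lambda>x. t * w x) (\<lambda>x. t * v x)" by (rule ac_pair_scale[OF w])
  have rng': "(\<lambda>x. t * w x) ` {-1..1} \<subseteq> {-(t * n)..t}"
  proof
    fix y assume "y \<in> (\<lambda>x. t * w x) ` {-1..1}"
    then obtain x where "x \<in> {-1..1}" "y = t * w x" by blast
    moreover from this have "w x \<in> {-n..1}" using rng by blast
    then have "- n \<le> w x" "w x \<le> 1" by auto
    then have "t * (- n) \<le> t * w x" "t * w x \<le> t * 1" using tn by (intro mult_left_mono; simp)+
    ultimately show "y \<in> {-(t * n)..t}" by auto
  qed
  let ?B = "2 * p * (half_gain p r L e c0 t + half_gain p r L e (- c0) (t * n)) - 2 * (p - 1) * e"
  have gb: "energy_gap p r alpha0 (\<lambda>x. t * w x) (\<lambda>x. t * v x) \<ge> ?B + alpha0 * \<bar>s\<bar> powr (p / r) - (p - 1) * c0 * s"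
    unfolding s_def
    by (rule gap_bound(1)[OF w' rng' x(1) _ x(3)]) (use x tn end1 end2 e param_bounds in auto)
  have ts: "(1 - 1 / p) * (e - e0) \<le> (half_gain p r L e c0 t + half_gain p r L e (- c0) (t * n)) -
      (half_gain p r L e0 c0 t + half_gain p r L e0 (- c0) (t * n))"
    "p / 2 < r \<Longrightarrow> (1 - 1 / p) * (e - e0) < (half_gain p r L e c0 t + half_gain p r L e (- c0) (t * n)) -
      (half_gain p r L e0 c0 t + half_gain p r L e0 (- c0) (t * n))"
    using two_sided_gain[OF p r param_bounds(4) less_imp_le[OF e] less_imp_le[OF c0(1)] tn] end1 end2 c0 e by auto
  \<comment> \<open>At the reference level \<open>e0\<close> only the gain over [0, 1] is kept, the
    one evaluated in \<open>critical_gain\<close>.\<close>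
  have hg: "half_gain p r L e0 c0 1 \<le> half_gain p r L e0 c0 t + half_gain p r L e0 (- c0) (t * n)"
    using half_gain_mono_interval[OF param_bounds(1,2), of 1 t] half_gain_nonneg[OF param_bounds(1,2)] t
    by (meson add_increasing2 less_imp_le order_trans)
  have pp: "2 * p * ((1 - 1 / p) * (e - e0)) = 2 * (p - 1) * (e - e0)" using p by (simp add: field_simps)
  have tang: "alpha0 * \<bar>s\<bar> powr (p / r) - (p - 1) * c0 * s \<ge> - (2 * p * half_gain p r L e0 c0 1 - 2 * (p - 1) * e0)"
    using alpha0_tangent[of s] unfolding critical_gain by simp
  have fin: "energy_gap p r alpha0 (\<lambda>x. t * w x) (\<lambda>x. t * v x) \<ge>
     2 * p * ((half_gain p r L e c0 t + half_gain p r L e (- c0) (t * n)) - half_gain p r L e0 c0 1) - 2 * p * ((1 - 1 / p) * (e - e0))"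
    using gb tang unfolding pp by (simp add: algebra_simps)
  have scale: "energy_gap p r alpha0 (\<lambda>x. t * w x) (\<lambda>x. t * v x) = t powr p * energy_gap p r alpha0 w v"
    using energy_gap_scale[of r p alpha0 t w v] param_bounds tn by simp
  have "2 * p * ((1 - 1 / p) * (e - e0)) \<le>
     2 * p * ((half_gain p r L e c0 t + half_gain p r L e (- c0) (t * n)) - half_gain p r L e0 c0 1)"
    using ts(1) hg p by (intro mult_left_mono) auto
  then have "t powr p * energy_gap p r alpha0 w v \<ge> 0" using fin unfolding scale by linarith
  then show "energy_gap p r alpha0 w v \<ge> 0" using tn by (simp add: zero_le_mult_iff)
  assume "p / 2 < r"
  then have "2 * p * ((1 - 1 / p) * (e - e0)) <
     2 * p * ((half_gain p r L e c0 t + half_gain p r L e (- c0) (t * n)) - half_gain p r L e0 c0 1)"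
    using ts(2) hg p by (intro mult_strict_left_mono) auto
  then have "t powr p * energy_gap p r alpha0 w v > 0" using fin unfolding scale by linarith
  then show "energy_gap p r alpha0 w v > 0" using tn by (simp add: zero_less_mult_iff)
qed

text \<open>The cases in which no scale with \<open>c0\<close> balances the ends. Here
  \<open>c\<close> itself is chosen to do so, and \<open>e\<close> is compared with 0, where the
  gains are nonnegative. The remaining terms are nonnegative too: \<open>n = 1\<close> gives
  \<open>c = 0\<close>, and \<open>r = p\<close> gives \<open>c < c0\<close> with nonlocal term
  \<open>(p - 1) * c0 * \<bar>s\<bar>\<close>. For \<open>r > p / 2\<close> a zero gap excludes
  \<open>c > 0\<close>, hence forces \<open>n = 1\<close> and a full traversal.\<close>

lemma gap_balanced:
  assumes w: "ac_pair p w v" and rng: "w ` {-1..1} \<subseteq> {-n..1}"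
    and x: "x1 \<in> {-1..1}" "w x1 = 1" "x2 \<in> {-1..1}" "w x2 = - n" and n: "0 < n" "n \<le> 1"
    and rp: "r = p \<or> n = 1" and case2: "L * n powr p + c0 * n powr r > e0"
  shows "energy_gap p r alpha0 w v \<ge> 0"
    "energy_gap p r alpha0 w v = 0 \<Longrightarrow> p / 2 < r \<Longrightarrow> \<forall>x\<in>I_open. w (- x) = - w x"
proof -
  have np: "n powr p \<le> 1" using n param_bounds by (simp add: powr_le1)
  \<comment> \<open>With \<open>e = L - c\<close> this is the solution of the end equations at 1 and
    at \<open>- n\<close>.\<close>
  define c where "c = L * (1 - n powr p) / (1 + n powr r)"
  define e where "e = L - c"
  have c: "c \<ge> 0" using np param_bounds by (simp add: c_def)
  have nr: "1 + n powr r > 0" by (simp add: add_pos_nonneg)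
  have ceq: "c * (1 + n powr r) = L * (1 - n powr p)" using nr by (simp add: c_def)
  have e: "e > 0"
  proof -
    have "0 < n powr p" "0 < n powr r" using n by auto
    then have "1 - n powr p < 1 + n powr r" by linarith
    then have "L * (1 - n powr p) < L * (1 + n powr r)" using param_bounds by simp
    then have "c * (1 + n powr r) < L * (1 + n powr r)" using ceq by simp
    then show ?thesis using nr by (simp add: e_def)
  qed
  have ends: "e - L * 1 powr p + c * 1 powr r = 0" "e - L * n powr p + (- c) * n powr r = 0"
    using ceq by (auto simp: e_def algebra_simps)
  define s where "s = integral {-1..1} (\<lambda>x. spow r (w x))"
  let ?B = "2 * p * (half_gain p r L e c 1 + half_gain p r L e (- c) n) - 2 * (p - 1) * e"
  note gb = gap_bound[OF w rng x less_imp_le[OF n(1)] zero_le_one less_imp_le[OF e], of c, folded s_def]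
  have pp: "2 * p * ((1 - 1 / p) * (e - 0)) = 2 * (p - 1) * e" using p by (simp add: field_simps)
  have ts: "(1 - 1 / p) * (e - 0) \<le> (half_gain p r L e c 1 + half_gain p r L e (- c) n) -
      (half_gain p r L 0 c 1 + half_gain p r L 0 (- c) n)"
    "c > 0 \<Longrightarrow> p / 2 < r \<Longrightarrow> (1 - 1 / p) * (e - 0) < (half_gain p r L e c 1 + half_gain p r L e (- c) n) -
      (half_gain p r L 0 c 1 + half_gain p r L 0 (- c) n)"
    using two_sided_gain[OF p r order_refl less_imp_le[OF e] c n(1) zero_less_one] ends e by auto
  have hg0: "half_gain p r L 0 c 1 \<ge> 0" "half_gain p r L 0 (- c) n \<ge> 0"
    using half_gain_nonneg[OF param_bounds(1,2)] by auto
  have "2 * p * ((1 - 1 / p) * (e - 0)) \<le> 2 * p * (half_gain p r L e c 1 + half_gain p r L e (- c) n)"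
    using ts(1) hg0 p by (intro mult_left_mono) auto
  then have B: "?B \<ge> 0" unfolding pp by simp
  have Bs: "?B > 0" if "c > 0" "p / 2 < r"
  proof -
    have "2 * p * ((1 - 1 / p) * (e - 0)) < 2 * p * (half_gain p r L e c 1 + half_gain p r L e (- c) n)"
      using ts(2)[OF that] hg0 p by (intro mult_strict_left_mono) auto
    then show ?thesis unfolding pp by simp
  qed
  have rest: "alpha0 * \<bar>s\<bar> powr (p / r) - (p - 1) * c * s \<ge> 0"
  proof (cases "n = 1")
    case True
    then have "c = 0" by (simp add: c_def)
    then show ?thesis using alpha0_pos by simp
  next
    case False
    then have rp: "r = p" using rp by simp
    \<comment> \<open>\<open>case2\<close> says that \<open>c0 * (1 + n powr r)\<close> exceeds
      \<open>L * (1 - n powr p)\<close>, and the latter is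
      \<open>c * (1 + n powr r)\<close>.\<close>
    have "c * (1 + n powr r) < c0 * (1 + n powr r)" using case2 ceq rp by (simp add: algebra_simps)
    then have "c < c0" using nr by simp
    have "(p - 1) * c * s \<le> (p - 1) * c * \<bar>s\<bar>" using param_bounds c by (intro mult_left_mono) auto
    also have "\<dots> \<le> (p - 1) * c0 * \<bar>s\<bar>" using param_bounds \<open>c < c0\<close> by (intro mult_right_mono mult_left_mono) auto
    finally have "(p - 1) * c * s \<le> (p - 1) * c0 * \<bar>s\<bar>" .
    moreover have "r / p = 1" "p / r = 1" using rp param_bounds by auto
    moreover have "alpha0 = (p - 1) * c0" unfolding alpha0_def calculation(2,3) using s0_pos by simp
    ultimately show ?thesis by simp
  qed
  show "energy_gap p r alpha0 w v \<ge> 0" using gb(1) ends B rest by simp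
  assume 0: "energy_gap p r alpha0 w v = 0" and pr: "p / 2 < r"
  have c_0: "c = 0"
  proof (rule ccontr)
    assume "c \<noteq> 0"
    then show False using Bs c pr gb(1) ends rest 0 by simp
  qed
  have n1: "n = 1"
  proof (rule ccontr)
    assume "n \<noteq> 1"
    then have "n powr p < 1" using n param_bounds powr_less_mono2[of p n 1] by simp
    then have "c > 0" using param_bounds nr by (simp add: c_def)
    with c_0 show False by simp
  qed
  have eL: "e = L" using c_0 by (simp add: e_def)
  have AE: "AE x in lebesgue_on I_open. \<bar>v x\<bar> = max 0 (potential p r L e c (w x)) powr (1 / p)"
    using gb(2) gb(1) ends B rest 0 by simp
  define h where "h y = max 0 (potential p r L L 0 y) powr (1 / p)" for y
  have h_eq: "h y = max 0 (L - L * \<bar>y\<bar> powr p) powr (1 / p)" for y by (simp add: h_def potential_def)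
  show "\<forall>x\<in>I_open. w (- x) = - w x"
  proof
    fix xx assume xx: "xx \<in> I_open"
    then have xx': "xx \<in> {-1..1}" by auto
    have x2: "w x2 = - 1" using x n1 by simp
    show "w (- xx) = - w xx"
    proof (rule odd_of_full_traversal[OF w _ _ _ _ _ _ _ zero_less_one x(1,2,3) x2 xx', where h = h])
      show "w ` {-1..1} \<subseteq> {-1..1}" using rng n1 by simp
      show "continuous_on {-1..1} h"
        unfolding h_def using param_bounds by (intro continuous_max_powr continuous_potential continuous_intros) auto
      show "h y > 0" if "y \<in> {-1<..<1}" for y
      proof -
        have "\<bar>y\<bar> powr p < 1" using that param_bounds powr_less_mono2[of p "\<bar>y\<bar>" 1] by auto
        then show ?thesis using param_bounds by (simp add: h_eq)
      qed
      show "h (- y) = h y" for y by (simp add: h_eq)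
      show "AE x in lebesgue_on I_open. \<bar>v x\<bar> \<le> h (w x)"
        using AE unfolding eL c_0 by eventually_elim (simp add: h_def)
      have "((\<lambda>y. (L - L * y powr p) powr (- (1 / p))) has_integral 1 / 2) {0..1}"
        using half_period_integral[OF p param_bounds(3)] param_bounds by simp
      then show "((\<lambda>y. 1 / h y) has_integral 1 / 2) {0..1}"
      proof (rule has_integral_eq[rotated])
        fix y :: real assume y: "y \<in> {0..1}"
        then have "y powr p \<le> 1" using param_bounds by (simp add: powr_le1)
        then show "(L - L * y powr p) powr (- (1 / p)) = 1 / h y"
          using y param_bounds by (simp add: h_eq powr_minus_divide)
      qed
    qed (simp add: h_def)
  qed
qed

lemma gap_normalized:
  assumes w: "ac_pair p w v" and rng: "w ` {-1..1} \<subseteq> {-n..1}"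
    and x: "x1 \<in> {-1..1}" "w x1 = 1" "x2 \<in> {-1..1}" "w x2 = - n" and n: "0 \<le> n" "n \<le> 1"
  shows "energy_gap p r alpha0 w v \<ge> 0"
    "energy_gap p r alpha0 w v = 0 \<Longrightarrow> p / 2 < r \<Longrightarrow>
      (\<forall>x\<in>I_open. 0 < w x) \<or> (\<forall>x\<in>I_open. w (- x) = - w x)"
proof -
  have "energy_gap p r alpha0 w v \<ge> 0 \<and> (energy_gap p r alpha0 w v = 0 \<longrightarrow> p / 2 < r \<longrightarrow>
      (\<forall>x\<in>I_open. 0 < w x) \<or> (\<forall>x\<in>I_open. w (- x) = - w x))"
  proof (cases "L * n powr p + c0 * n powr r \<le> e0")
    case True
    show ?thesis using gap_small_negative_part[OF w rng x n(1) True] by blast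
  next
    case False
    then have case2: "L * n powr p + c0 * n powr r > e0" by simp
    show ?thesis
    proof (cases "r = p \<or> n = 1")
      case True
      have "n > 0" using case2 n param_bounds by (cases "n = 0") auto
      then show ?thesis using gap_balanced[OF w rng x _ n(2) True case2] by blast
    next
      case False
      then have "n < 1" "r < p" using n r by auto
      then show ?thesis using gap_large_negative_part[OF w rng x n(1) _ _ case2] by auto
    qed
  qed
  then show "energy_gap p r alpha0 w v \<ge> 0"
    "energy_gap p r alpha0 w v = 0 \<Longrightarrow> p / 2 < r \<Longrightarrow>
      (\<forall>x\<in>I_open. 0 < w x) \<or> (\<forall>x\<in>I_open. w (- x) = - w x)" by auto
qed

text \<open>Division by the extreme value of largest modulus, sign included, makes the maximum 1 and
  the minimum \<open>- n\<close> with \<open>0 \<le> n \<le> 1\<close>; by homogeneity the gap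
  changes by a positive factor only. The sign -1 is the source of the negative alternative.\<close>

lemma gap_nonneg:
  assumes w: "ac_pair p w v" and nz: "x0 \<in> {-1..1}" "w x0 \<noteq> 0"
  shows "energy_gap p r alpha0 w v \<ge> 0"
    "energy_gap p r alpha0 w v = 0 \<Longrightarrow> p / 2 < r \<Longrightarrow>
      (\<forall>x\<in>I_open. 0 < w x) \<or> (\<forall>x\<in>I_open. w x < 0) \<or> (\<forall>x\<in>I_open. w (- x) = - w x)"
proof -
  note wD = ac_pairD[OF w]
  obtain a where a: "a \<in> {-1..1}" "\<And>x. x \<in> {-1..1} \<Longrightarrow> w x \<le> w a"
    using continuous_attains_sup[OF compact_Icc _ wD(5)] by auto
  obtain b where b: "b \<in> {-1..1}" "\<And>x. x \<in> {-1..1} \<Longrightarrow> w b \<le> w x"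
    using continuous_attains_inf[OF compact_Icc _ wD(5)] by auto
  have ab: "w a \<ge> 0" "w b \<le> 0" using a(2)[of "-1"] b(2)[of "-1"] wD(3) by auto
  have main: "energy_gap p r alpha0 w v \<ge> 0 \<and> (energy_gap p r alpha0 w v = 0 \<longrightarrow> p / 2 < r \<longrightarrow>
      (\<forall>x\<in>I_open. 0 < \<sigma> * w x) \<or> (\<forall>x\<in>I_open. w (- x) = - w x))"
    if \<sigma>: "\<bar>\<sigma>\<bar> = 1" and m: "x1 \<in> {-1..1}" "x2 \<in> {-1..1}" "\<sigma> * w x1 > 0" "\<sigma> * w x2 \<le> 0" "- (\<sigma> * w x2) \<le> \<sigma> * w x1"
      "\<And>x. x \<in> {-1..1} \<Longrightarrow> \<sigma> * w x \<le> \<sigma> * w x1 \<and> \<sigma> * w x2 \<le> \<sigma> * w x" for \<sigma> x1 x2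
  proof -
    define d where "d = \<sigma> * w x1"
    have d: "d > 0" using m by (simp add: d_def)
    define k where "k = \<sigma> / d"
    define n where "n = - (k * w x2)"
    have kw: "k * w x = (\<sigma> * w x) / d" for x by (simp add: k_def)
    have k0: "\<bar>k\<bar> > 0" using \<sigma> d by (auto simp: k_def)
    have w': "ac_pair p (\<lambda>x. k * w x) (\<lambda>x. k * v x)" by (rule ac_pair_scale[OF w])
    have rng: "(\<lambda>x. k * w x) ` {-1..1} \<subseteq> {-n..1}"
    proof
      fix y assume "y \<in> (\<lambda>x. k * w x) ` {-1..1}"
      then obtain x where x: "x \<in> {-1..1}" "y = k * w x" by blast
      show "y \<in> {-n..1}"
        using m(6)[OF x(1)] d unfolding x(2) n_def kw
        by (auto simp: d_def[symmetric] intro: divide_right_mono)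
    qed
    have x1: "k * w x1 = 1" using d unfolding kw by (simp add: d_def[symmetric])
    have neq: "n = (- (\<sigma> * w x2)) / d" by (simp add: n_def kw)
    have n: "0 \<le> n" "n \<le> 1"
      unfolding neq using m(4,5)[folded d_def] d by (rule_tac divide_nonneg_pos, simp_all only: pos_divide_le_eq mult_1 neg_0_le_iff_le)
    note g = gap_normalized[OF w' rng m(1) x1 m(2) _ n]
    have sc: "energy_gap p r alpha0 (\<lambda>x. k * w x) (\<lambda>x. k * v x) = \<bar>k\<bar> powr p * energy_gap p r alpha0 w v"
      using param_bounds by (intro energy_gap_scale) auto
    have kp: "\<bar>k\<bar> powr p > 0" using k0 by simp
    have "energy_gap p r alpha0 w v \<ge> 0"
      using g(1) kp unfolding sc n_def by (simp add: zero_le_mult_iff)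
    moreover have "(\<forall>x\<in>I_open. 0 < \<sigma> * w x) \<or> (\<forall>x\<in>I_open. w (- x) = - w x)"
      if "energy_gap p r alpha0 w v = 0" "p / 2 < r"
    proof -
      have "(\<forall>x\<in>I_open. 0 < k * w x) \<or> (\<forall>x\<in>I_open. k * w (- x) = - (k * w x))"
        using g(2) that unfolding sc n_def by simp
      moreover have "0 < \<sigma> * w x" if "0 < k * w x" for x
        using that d unfolding kw by (simp add: zero_less_divide_iff)
      moreover have "w (- x) = - w x" if "k * w (- x) = - (k * w x)" for x
      proof -
        have "k * w (- x) = k * (- w x)" using that by simp
        then show ?thesis using k0 by (simp only: mult_left_cancel abs_0_eq zero_less_abs_iff)
      qed
      ultimately show ?thesis by blast
    qed
    ultimately show ?thesis by blast
  qed
  have "energy_gap p r alpha0 w v \<ge> 0 \<and> (energy_gap p r alpha0 w v = 0 \<longrightarrow> p / 2 < r \<longrightarrow>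
      (\<forall>x\<in>I_open. 0 < w x) \<or> (\<forall>x\<in>I_open. w x < 0) \<or> (\<forall>x\<in>I_open. w (- x) = - w x))"
  proof (cases "- w b \<le> w a")
    case True
    then have "w a > 0" using nz a(2)[OF nz(1)] b(2)[OF nz(1)] by linarith
    then show ?thesis using main[of 1 a b] a b ab True by auto
  next
    case False
    then have "w b < 0" using nz a(2)[OF nz(1)] b(2)[OF nz(1)] ab by linarith
    then show ?thesis using main[of "-1" b a] a b ab False by auto
  qed
  then show "energy_gap p r alpha0 w v \<ge> 0"
    "energy_gap p r alpha0 w v = 0 \<Longrightarrow> p / 2 < r \<Longrightarrow>
      (\<forall>x\<in>I_open. 0 < w x) \<or> (\<forall>x\<in>I_open. w x < 0) \<or> (\<forall>x\<in>I_open. w (- x) = - w x)" by auto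
qed

end

section \<open>The Rayleigh quotient and its minimizers\<close>

lemma integral_powr_pos:
  assumes w: "continuous_on {-1..1} (w :: real \<Rightarrow> real)" and p: "p > 0" and x0: "x0 \<in> {-1..1}" "w x0 \<noteq> 0"
  shows "integral {-1..1} (\<lambda>x. \<bar>w x\<bar> powr p) > 0"
proof -
  note c = abs_powr_continuous[OF w p]
  have "integral {-1..1} (\<lambda>x. \<bar>w x\<bar> powr p) \<ge> 0"
    by (intro Henstock_Kurzweil_Integration.integral_nonneg integrable_continuous_real c) auto
  moreover have "integral {-1..1} (\<lambda>x. \<bar>w x\<bar> powr p) \<noteq> 0"
    using integral_cbox_eq_0_iff[of "-1" 1 "\<lambda>x. \<bar>w x\<bar> powr p"] c x0 by auto
  ultimately show ?thesis by simp
qed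

text \<open>The source of the lower bound for the quotient at every parameter. It rests on
  \<open>t powr r \<le> 1 + t powr p\<close> for the normalized function; the 3 is the length 2 of
  the interval plus the normalized integral 1.\<close>

lemma spow_integral_bound:
  assumes w: "continuous_on {-1..1} (w :: real \<Rightarrow> real)" and p: "0 < r" "r \<le> p"
    and N: "integral {-1..1} (\<lambda>x. \<bar>w x\<bar> powr p) > 0"
  shows "\<bar>integral {-1..1} (\<lambda>x. spow r (w x))\<bar> powr (p / r) \<le>
     3 powr (p / r) * integral {-1..1} (\<lambda>x. \<bar>w x\<bar> powr p)"
proof -
  define A where "A = integral {-1..1} (\<lambda>x. \<bar>w x\<bar> powr p)"
  have A: "A > 0" using N by (simp add: A_def)
  have le: "\<bar>y\<bar> powr r \<le> A powr (r / p) * (1 + \<bar>y\<bar> powr p / A)" for y :: real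
  proof -
    define t where "t = \<bar>y\<bar> / A powr (1 / p)"
    have t: "t \<ge> 0" by (simp add: t_def)
    have tr: "\<bar>y\<bar> powr r = A powr (r / p) * t powr r" and tp: "t powr p = \<bar>y\<bar> powr p / A"
      using A p by (auto simp: t_def powr_divide powr_powr)
    have "t powr r \<le> 1 + t powr p"
    proof (cases "t \<le> 1")
      case True
      then show ?thesis using t p by (simp add: powr_le1 add_increasing2)
    next
      case False
      then have "t powr r \<le> t powr p" using p by (intro powr_mono) auto
      then show ?thesis by simp
    qed
    then show ?thesis unfolding tr tp[symmetric] by (intro mult_left_mono) auto
  qed
  have p0: "p > 0" using p by simp
  note c = abs_powr_continuous[OF w p0]
  have "norm (integral {-1..1} (\<lambda>x. spow r (w x))) \<le> integral {-1..1} (\<lambda>x. A powr (r / p) * (1 + \<bar>w x\<bar> powr p / A))"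
  proof (rule integral_norm_bound_integral)
    show "(\<lambda>x. spow r (w x)) integrable_on {-1..1}"
      by (intro integrable_continuous_real continuous_spow w p)
    show "(\<lambda>x. A powr (r / p) * (1 + \<bar>w x\<bar> powr p / A)) integrable_on {-1..1}"
      using A by (intro integrable_continuous_real continuous_intros c) auto
  qed (use le in \<open>simp add: abs_spow\<close>)
  also have "\<dots> = A powr (r / p) * 3"
  proof -
    have "((\<lambda>x. A powr (r / p) * (1 + (1 / A) * \<bar>w x\<bar> powr p)) has_integral A powr (r / p) * (2 + (1 / A) * A)) {-1..1}"
      using has_integral_const_real[of "1::real" "-1" 1] integrable_integral[OF integrable_continuous_real[OF c]]
      by (intro has_integral_mult_right has_integral_add) (auto simp: A_def)
    then have "((\<lambda>x. A powr (r / p) * (1 + \<bar>w x\<bar> powr p / A)) has_integral A powr (r / p) * 3) {-1..1}"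
      using A by simp
    then show ?thesis by (rule integral_unique)
  qed
  finally have "\<bar>integral {-1..1} (\<lambda>x. spow r (w x))\<bar> powr (p / r) \<le> (A powr (r / p) * 3) powr (p / r)"
    using p by (intro powr_mono2) auto
  also have "\<dots> = 3 powr (p / r) * A" using A p by (simp add: powr_mult powr_powr)
  finally show ?thesis by (simp add: A_def)
qed

lemma Q_functional_ac_pair:
  assumes u: "u \<in> borel_measurable (lebesgue_on I_open)" and w: "ac_pair p w v" "AE x in lebesgue_on I_open. u x = w x"
    and v: "weak_deriv u \<in> borel_measurable (lebesgue_on I_open)" "AE x in lebesgue_on I_open. weak_deriv u x = v x"
    and p: "p > 0" "r > 0"
  shows "Q_functional p r \<alpha> u =
    (integral {-1..1} (\<lambda>x. \<bar>v x\<bar> powr p) + \<alpha> * \<bar>integral {-1..1} (\<lambda>x. spow r (w x))\<bar> powr (p / r)) /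
     integral {-1..1} (\<lambda>x. \<bar>w x\<bar> powr p)"
proof -
  note wD = ac_pairD[OF w(1)]
  have 1: "(LINT x|lebesgue_on I_open. \<bar>weak_deriv u x\<bar> powr p) = integral {-1..1} (\<lambda>x. \<bar>v x\<bar> powr p)"
  proof -
    have m: "(\<lambda>x. \<bar>weak_deriv u x\<bar> powr p) \<in> borel_measurable (lebesgue_on I_open)" using v(1) by measurable
    have "AE x in lebesgue_on I_open. \<bar>weak_deriv u x\<bar> powr p = \<bar>v x\<bar> powr p"
      using v(2) by eventually_elim simp
    from LINT_cong_I_open(1)[OF m this] LINT_I_open_eq[OF wD(2)] show ?thesis by simp
  qed
  have 2: "(LINT x|lebesgue_on I_open. \<bar>u x\<bar> powr p) = integral {-1..1} (\<lambda>x. \<bar>w x\<bar> powr p)"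
  proof -
    have m: "(\<lambda>x. \<bar>u x\<bar> powr p) \<in> borel_measurable (lebesgue_on I_open)" using u by measurable
    have "AE x in lebesgue_on I_open. \<bar>u x\<bar> powr p = \<bar>w x\<bar> powr p"
      using w(2) by eventually_elim simp
    from LINT_cong_I_open(1)[OF m this] LINT_I_open_eq[OF abs_powr_absolutely_integrable[OF wD(5) p(1)]] show ?thesis by simp
  qed
  have 3: "(LINT x|lebesgue_on I_open. \<bar>u x\<bar> powr (r - 1) * u x) = integral {-1..1} (\<lambda>x. spow r (w x))"
  proof -
    have m: "(\<lambda>x. \<bar>u x\<bar> powr (r - 1) * u x) \<in> borel_measurable (lebesgue_on I_open)" using u by measurable
    have "AE x in lebesgue_on I_open. \<bar>u x\<bar> powr (r - 1) * u x = spow r (w x)"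
      using w(2) by eventually_elim (simp add: spow_eq)
    from LINT_cong_I_open(1)[OF m this]
      LINT_I_open_eq[OF absolutely_integrable_continuous_real[OF continuous_spow[OF wD(5) p(2)]]] show ?thesis by simp
  qed
  show ?thesis unfolding Q_functional_def 1 2 3 ..
qed

lemma C1_pair_ac_pair:
  assumes w: "C1_pair w v" and p: "p > 0"
  shows "ac_pair p w v"
proof -
  have cv: "continuous_on {-1..1} v" using w by (simp add: C1_pair_def)
  show ?thesis unfolding ac_pair_def
  proof (intro conjI ballI)
    show "v absolutely_integrable_on {-1..1}" by (rule absolutely_integrable_continuous_real[OF cv])
    show "(\<lambda>x. \<bar>v x\<bar> powr p) absolutely_integrable_on {-1..1}" by (rule abs_powr_absolutely_integrable[OF cv p])
    show "w x = integral {-1..x} v" if "x \<in> {-1..1}" for x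
      using C1_pair_integral[OF w that] by (simp add: integral_unique)
    show "w 1 = 0" using w by (simp add: C1_pair_def)
  qed
qed

lemma Q_functional_C1_pair:
  assumes w: "C1_pair w v" and p: "p > 0" "r > 0"
  shows "Q_functional p r \<alpha> w =
    (integral {-1..1} (\<lambda>x. \<bar>v x\<bar> powr p) + \<alpha> * \<bar>integral {-1..1} (\<lambda>x. spow r (w x))\<bar> powr (p / r)) /
     integral {-1..1} (\<lambda>x. \<bar>w x\<bar> powr p)"
proof -
  have c: "continuous_on {-1..1} v" "continuous_on {-1..1} w"
    using w C1_pair_continuous by (auto simp: C1_pair_def)
  have AE: "AE x in lebesgue_on I_open. weak_deriv w x = v x"
    by (rule weak_deriv_AE(2)[OF C1_pair_weak_derivative[OF w]])
  then have AE': "AE x in lebesgue_on I_open. v x = weak_deriv w x" by eventually_elim simp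
  show ?thesis
    using Q_functional_ac_pair[OF continuous_I_open_integrable(1)[OF c(2)] C1_pair_ac_pair[OF w p(1)] _
        measurable_I_open_AE[OF continuous_I_open_integrable(1)[OF c(1)] AE'] AE p]
    by simp
qed

lemma continuous_nontrivial:
  assumes w: "continuous_on {-1..1} w" and x0: "x0 \<in> {-1..1}" "w x0 \<noteq> 0"
  shows "nontrivial w"
  unfolding nontrivial_def
proof
  assume "AE x in lebesgue_on I_open. w x = 0"
  then have "AE x in lebesgue_on I_open. 0 = \<bar>w x\<bar> powr 1" by eventually_elim simp
  from LINT_cong_I_open(1)[OF _ this]
  have "(LINT x|lebesgue_on I_open. \<bar>w x\<bar> powr 1) = 0" by simp
  then show False
    using LINT_I_open_eq[OF abs_powr_absolutely_integrable[OF w, of 1]] integral_powr_pos[OF w _ x0, of 1] by simp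
qed

lemma W01p_representative:
  assumes u: "u \<in> W01p p" "nontrivial u" and p: "p \<ge> 1" "r > 0"
  obtains w x0 where "ac_pair p w (weak_deriv u)" "AE x in lebesgue_on I_open. u x = w x" "x0 \<in> {-1..1}" "w x0 \<noteq> 0"
    "\<forall>\<alpha>. Q_functional p r \<alpha> u = (integral {-1..1} (\<lambda>x. \<bar>weak_deriv u x\<bar> powr p) +
       \<alpha> * \<bar>integral {-1..1} (\<lambda>x. spow r (w x))\<bar> powr (p / r)) / integral {-1..1} (\<lambda>x. \<bar>w x\<bar> powr p)"
proof -
  obtain w where w: "ac_pair p w (weak_deriv u)" "AE x in lebesgue_on I_open. u x = w x"
    by (rule W01p_ac_pair[OF u(1) p(1)])
  have "\<exists>x0\<in>{-1..1}. w x0 \<noteq> 0"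
  proof (rule ccontr)
    assume "\<not> ?thesis"
    then have "AE x in lebesgue_on I_open. w x = 0" by (intro AE_I2) auto
    with w(2) have "AE x in lebesgue_on I_open. u x = 0" by eventually_elim simp
    with u(2) show False by (simp add: nontrivial_def)
  qed
  then obtain x0 where x0: "x0 \<in> {-1..1}" "w x0 \<noteq> 0" by blast
  have um: "u \<in> borel_measurable (lebesgue_on I_open)"
    using u(1) by (simp add: W01p_def W1p_def Lp_space_def)
  have vm: "weak_deriv u \<in> borel_measurable (lebesgue_on I_open)"
    using ac_pairD(1)[OF w(1)] by (intro borel_measurable_integrable) (simp add: integrable_I_open_iff)
  have "Q_functional p r \<alpha> u = (integral {-1..1} (\<lambda>x. \<bar>weak_deriv u x\<bar> powr p) +
       \<alpha> * \<bar>integral {-1..1} (\<lambda>x. spow r (w x))\<bar> powr (p / r)) / integral {-1..1} (\<lambda>x. \<bar>w x\<bar> powr p)" for \<alpha>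
    using Q_functional_ac_pair[OF um w vm] p by simp
  then show ?thesis using that[OF w x0] by blast
qed

lemma C1_pair_scale: "C1_pair w v \<Longrightarrow> C1_pair (\<lambda>x. c * w x) (\<lambda>x. c * v x)"
  by (auto simp: C1_pair_def intro!: derivative_eq_intros continuous_intros)

context critical
begin

text \<open>The second bound perturbs the first one away from \<open>alpha0\<close>. It is crude,
  but boundedness below for every \<open>\<beta>\<close> is what allows \<open>INF\<close> to be
  compared with a single competitor.\<close>

lemma Q_lower_bounds:
  assumes u: "u \<in> W01p p" "nontrivial u"
  shows "pi_p p powr p \<le> Q_functional p r alpha0 u"
    "pi_p p powr p - \<bar>\<beta> - alpha0\<bar> * 3 powr (p / r) \<le> Q_functional p r \<beta> u"
proof -
  have p1: "p \<ge> 1" using p by simp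
  obtain w x0 where w: "ac_pair p w (weak_deriv u)" "AE x in lebesgue_on I_open. u x = w x" "x0 \<in> {-1..1}" "w x0 \<noteq> 0"
    and Q: "\<forall>\<alpha>. Q_functional p r \<alpha> u = (integral {-1..1} (\<lambda>x. \<bar>weak_deriv u x\<bar> powr p) +
       \<alpha> * \<bar>integral {-1..1} (\<lambda>x. spow r (w x))\<bar> powr (p / r)) / integral {-1..1} (\<lambda>x. \<bar>w x\<bar> powr p)"
    by (rule W01p_representative[OF u p1 param_bounds(2)])
  define A where "A = integral {-1..1} (\<lambda>x. \<bar>w x\<bar> powr p)"
  define S where "S = \<bar>integral {-1..1} (\<lambda>x. spow r (w x))\<bar> powr (p / r)"
  define V where "V = integral {-1..1} (\<lambda>x. \<bar>weak_deriv u x\<bar> powr p)"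
  have cw: "continuous_on {-1..1} w" by (rule ac_pairD(5)[OF w(1)])
  have A: "A > 0" unfolding A_def using integral_powr_pos[OF cw _ w(3,4)] param_bounds by simp
  have S: "S \<le> 3 powr (p / r) * A"
    unfolding A_def S_def by (rule spow_integral_bound[OF cw param_bounds(2) r(2) A[unfolded A_def]])
  have gap: "V - pi_p p powr p * A + alpha0 * S \<ge> 0"
    using gap_nonneg(1)[OF w(1,3,4)] by (simp add: energy_gap_def V_def A_def S_def)
  have Q': "Q_functional p r \<alpha> u = (V + \<alpha> * S) / A" for \<alpha>
    using spec[OF Q, of \<alpha>] by (simp add: V_def S_def A_def)
  show "pi_p p powr p \<le> Q_functional p r alpha0 u"
    unfolding Q' using gap A by (simp add: pos_le_divide_eq)
  have "(alpha0 - \<beta>) * S \<le> \<bar>\<beta> - alpha0\<bar> * S" by (intro mult_right_mono) (auto simp: S_def)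
  also have "\<dots> \<le> \<bar>\<beta> - alpha0\<bar> * (3 powr (p / r) * A)" by (intro mult_left_mono S) auto
  finally have "(pi_p p powr p - \<bar>\<beta> - alpha0\<bar> * 3 powr (p / r)) * A \<le> V + \<beta> * S"
    using gap by (simp add: algebra_simps)
  then show "pi_p p powr p - \<bar>\<beta> - alpha0\<bar> * 3 powr (p / r) \<le> Q_functional p r \<beta> u"
    unfolding Q' using A by (simp add: pos_le_divide_eq)
qed

text \<open>An odd function has nonlocal integral zero, so its quotient does not depend on
  \<open>\<alpha>\<close>.\<close>

lemma sine_competitor:
  assumes c: "c \<noteq> 0"
  shows "(\<lambda>x. c * sine_fn p x) \<in> W01p p" "nontrivial (\<lambda>x. c * sine_fn p x)"
    "Q_functional p r \<alpha> (\<lambda>x. c * sine_fn p x) = pi_p p powr p"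
proof -
  note S = sine_fn_C1_pair[OF p]
  let ?w = "\<lambda>x. c * sine_fn p x" and ?v = "\<lambda>x. c * sine_fn_deriv p x"
  have C: "C1_pair ?w ?v" by (rule C1_pair_scale[OF S(1)])
  show "?w \<in> W01p p" using C1_pair_W01p[OF C] param_bounds by simp
  have nz: "1 / 2 \<in> {-1..1::real}" "?w (1 / 2) \<noteq> 0" using S(3)[of "1 / 2"] c by auto
  show "nontrivial ?w" by (rule continuous_nontrivial[OF C1_pair_continuous[OF C] nz])
  have A: "integral {-1..1} (\<lambda>x. \<bar>?w x\<bar> powr p) > 0"
    using integral_powr_pos[OF C1_pair_continuous[OF C] _ nz] param_bounds by simp
  have "integral {-1..1} (\<lambda>x. \<bar>?v x\<bar> powr p) = pi_p p powr p * integral {-1..1} (\<lambda>x. \<bar>?w x\<bar> powr p)"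
    using S(2) by (simp add: abs_mult powr_mult)
  moreover have "integral {-1..1} (\<lambda>x. spow r (?w x)) = 0"
  proof -
    have "integral {-1..1} (\<lambda>x. spow r (?w x)) = integral {-1..1} (\<lambda>x. spow r (?w (- x)))"
      using Henstock_Kurzweil_Integration.integral_reflect_real[of 1 "-1" "\<lambda>x. spow r (?w x)"] by simp
    also have "\<dots> = integral {-1..1} (\<lambda>x. - spow r (?w x))"
      by (intro integral_cong) (simp add: sine_fn_eq(2)[OF p])
    finally show ?thesis by simp
  qed
  ultimately show "Q_functional p r \<alpha> ?w = pi_p p powr p"
    using A param_bounds by (simp add: Q_functional_C1_pair[OF C])
qed

definition bell :: "real \<Rightarrow> real" where "bell x = P.W (1 - \<bar>x\<bar>)"

text \<open>By the choice of \<open>alpha0\<close>, its nonlocal term is the last term of the energy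
  identity, so the gap is exactly zero. As \<open>s0 > 0\<close>, the quotient increases strictly
  with \<open>\<alpha>\<close> and is smaller for \<open>\<alpha> < alpha0\<close>.\<close>

lemma bell_competitor:
  shows "bell \<in> W01p p" "nontrivial bell" "continuous_on I_open bell" "\<forall>x\<in>I_open. 0 < bell x"
    "Q_functional p r alpha0 bell = pi_p p powr p" "\<alpha> < alpha0 \<Longrightarrow> Q_functional p r \<alpha> bell < pi_p p powr p"
proof -
  define v where "v x = - sgn x * P.h (P.W (1 - \<bar>x\<bar>))" for x
  have C: "C1_pair bell v"
    unfolding bell_def v_def by (rule P.folded_C1_pair) simp
  show "bell \<in> W01p p" using C1_pair_W01p[OF C] param_bounds by simp
  show "continuous_on I_open bell" by (rule continuous_on_subset[OF C1_pair_continuous[OF C]]) auto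
  have W: "P.W t \<ge> 0" if "t \<in> {0..1}" for t using P.W_in[OF that] by simp
  show pos: "\<forall>x\<in>I_open. 0 < bell x"
  proof
    fix x assume x: "x \<in> I_open"
    show "0 < bell x"
    proof (cases "x = 0")
      case True then show ?thesis using P.W_T by (simp add: bell_def)
    next
      case False then show ?thesis using P.W_interior[of "1 - \<bar>x\<bar>"] x by (auto simp: bell_def abs_if)
    qed
  qed
  have "0 < bell 0" using pos by (rule bspec) simp
  then have nz: "0 \<in> {-1..1::real}" "bell 0 \<noteq> 0" by auto
  show "nontrivial bell" by (rule continuous_nontrivial[OF C1_pair_continuous[OF C] nz])
  have A: "integral {-1..1} (\<lambda>x. \<bar>bell x\<bar> powr p) > 0"
    using integral_powr_pos[OF C1_pair_continuous[OF C] _ nz] param_bounds by simp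
  have cW: "continuous_on {0..1} (\<lambda>t. P.W t powr s)" if "s > 0" for s
    using that W by (intro continuous_on_powr' P.W_cont continuous_intros) auto
  have ch: "continuous_on {0..1} (\<lambda>t. P.h (P.W t) powr p)"
    using param_bounds P.h_props(1) by (intro continuous_on_powr' P.hW_cont continuous_intros) auto
  have 1: "integral {-1..1} (\<lambda>x. \<bar>bell x\<bar> powr p) = 2 * integral {0..1} (\<lambda>t. P.W t powr p)"
  proof -
    have "integral {-1..1} (\<lambda>x. \<bar>bell x\<bar> powr p) = integral {-1..1} (\<lambda>x. P.W (1 - \<bar>x\<bar>) powr p)"
      by (intro integral_cong) (use W in \<open>auto simp: bell_def\<close>)
    then show ?thesis using P.folded_integral[OF refl cW[of p]] param_bounds by simp
  qed
  have 2: "integral {-1..1} (\<lambda>x. \<bar>v x\<bar> powr p) = 2 * integral {0..1} (\<lambda>t. P.h (P.W t) powr p)"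
  proof -
    have "P.h (P.W 1) = 0" using P.W_T P.h_props(2) by simp
    then have "integral {-1..1} (\<lambda>x. \<bar>v x\<bar> powr p) = integral {-1..1} (\<lambda>x. P.h (P.W (1 - \<bar>x\<bar>)) powr p)"
      by (intro integral_cong) (use P.h_props(1) in \<open>auto simp: v_def abs_mult sgn_if\<close>)
    then show ?thesis using P.folded_integral[OF refl ch] by simp
  qed
  have 3: "integral {-1..1} (\<lambda>x. spow r (bell x)) = s0"
  proof -
    have "integral {-1..1} (\<lambda>x. spow r (bell x)) = integral {-1..1} (\<lambda>x. P.W (1 - \<bar>x\<bar>) powr r)"
      by (intro integral_cong) (use W in \<open>auto simp: bell_def spow_nonneg\<close>)
    then show ?thesis using P.folded_integral[OF refl cW[of r]] param_bounds by (simp add: s0_def)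
  qed
  have s: "alpha0 * s0 powr (p / r) = (p - 1) * c0 * (r / p) * s0"
  proof -
    have "s0 powr (1 - p / r) * s0 powr (p / r) = s0" using s0_pos by (simp flip: powr_add)
    then show ?thesis by (simp add: alpha0_def)
  qed
  have gap: "integral {-1..1} (\<lambda>x. \<bar>v x\<bar> powr p) + alpha0 * s0 powr (p / r) =
      pi_p p powr p * integral {-1..1} (\<lambda>x. \<bar>bell x\<bar> powr p)"
  proof -
    have s': "alpha0 * s0 powr (p / r) = (p - 1) * c0 * (r / p) * (2 * integral {0..1} (\<lambda>t. P.W t powr r))"
      unfolding s by (simp only: s0_def)
    have "2 * (a * X - b * Y) + b * (2 * Y) = a * (2 * X)" for a b X Y :: real by (simp add: algebra_simps)
    then show ?thesis unfolding s' 1 2 P.energy_identity param_bounds(5) .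
  qed
  have Q: "Q_functional p r \<alpha> bell = (integral {-1..1} (\<lambda>x. \<bar>v x\<bar> powr p) + \<alpha> * s0 powr (p / r)) /
     integral {-1..1} (\<lambda>x. \<bar>bell x\<bar> powr p)" for \<alpha>
    using Q_functional_C1_pair[OF C _ param_bounds(2), of p \<alpha>] param_bounds 3 s0_pos by simp
  show "Q_functional p r alpha0 bell = pi_p p powr p" unfolding Q gap using A by simp
  assume \<alpha>: "\<alpha> < alpha0"
  have "\<alpha> * s0 powr (p / r) < alpha0 * s0 powr (p / r)" using \<alpha> s0_pos by simp
  then have "integral {-1..1} (\<lambda>x. \<bar>v x\<bar> powr p) + \<alpha> * s0 powr (p / r) <
      pi_p p powr p * integral {-1..1} (\<lambda>x. \<bar>bell x\<bar> powr p)" using gap by linarith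
  then show "Q_functional p r \<alpha> bell < pi_p p powr p" unfolding Q using A by (simp add: pos_divide_less_eq)
qed

lemma eigval_alpha0: "eigval p r alpha0 = pi_p p powr p"
  unfolding eigval_def
proof (rule cInf_eq_minimum)
  show "pi_p p powr p \<in> Q_functional p r alpha0 ` {u \<in> W01p p. nontrivial u}"
    using bell_competitor(1,2,5) by (intro image_eqI[of _ _ bell]) auto
  show "pi_p p powr p \<le> x" if "x \<in> Q_functional p r alpha0 ` {u \<in> W01p p. nontrivial u}" for x
    using that Q_lower_bounds(1) by auto
qed

lemma eigval_less:
  assumes "\<alpha> < alpha0"
  shows "eigval p r \<alpha> < pi_p p powr p"
proof -
  have "eigval p r \<alpha> \<le> Q_functional p r \<alpha> bell"
    unfolding eigval_def
    by (rule cINF_lower) (use bell_competitor(1,2) Q_lower_bounds(2) in \<open>auto intro!: bdd_belowI\<close>)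
  also have "\<dots> < pi_p p powr p" by (rule bell_competitor(6)[OF assms])
  finally show ?thesis .
qed

lemma alpha_C_eq: "alpha_C p r = alpha0"
  unfolding alpha_C_def
proof (rule Least_equality)
  show "eigval p r alpha0 = pi_p p powr p" by (rule eigval_alpha0)
  show "alpha0 \<le> \<alpha>" if "eigval p r \<alpha> = pi_p p powr p" for \<alpha>
    using eigval_less[of \<alpha>] that by (cases "\<alpha> < alpha0") auto
qed

text \<open>A minimizer has gap zero. Its shape is asserted for the continuous representative
  because the minimizer itself is determined only up to null sets.\<close>

lemma minimizer_shape:
  assumes pr: "p / 2 < r" and y: "minimizer p r alpha0 y"
  shows "\<exists>w. continuous_version y w \<and>
     ((\<forall>x\<in>I_open. 0 < w x) \<or> (\<forall>x\<in>I_open. w x < 0) \<or> (\<forall>x\<in>I_open. w (- x) = - w x))"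
proof -
  have p1: "p \<ge> 1" using p by simp
  have u: "y \<in> W01p p" "nontrivial y" and Qy: "Q_functional p r alpha0 y = pi_p p powr p"
    using y eigval_alpha0 by (auto simp: minimizer_def)
  obtain w x0 where w: "ac_pair p w (weak_deriv y)" "AE x in lebesgue_on I_open. y x = w x" "x0 \<in> {-1..1}" "w x0 \<noteq> 0"
    and Q: "\<forall>\<alpha>. Q_functional p r \<alpha> y = (integral {-1..1} (\<lambda>x. \<bar>weak_deriv y x\<bar> powr p) +
       \<alpha> * \<bar>integral {-1..1} (\<lambda>x. spow r (w x))\<bar> powr (p / r)) / integral {-1..1} (\<lambda>x. \<bar>w x\<bar> powr p)"
    by (rule W01p_representative[OF u p1 param_bounds(2)])
  have cw: "continuous_on {-1..1} w" by (rule ac_pairD(5)[OF w(1)])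
  have "integral {-1..1} (\<lambda>x. \<bar>w x\<bar> powr p) > 0"
    using integral_powr_pos[OF cw _ w(3,4)] param_bounds by simp
  then have "energy_gap p r alpha0 w (weak_deriv y) = 0"
    using spec[OF Q, of alpha0] Qy by (simp add: energy_gap_def field_simps)
  from gap_nonneg(2)[OF w(1,3,4) this pr] have
    "(\<forall>x\<in>I_open. 0 < w x) \<or> (\<forall>x\<in>I_open. w x < 0) \<or> (\<forall>x\<in>I_open. w (- x) = - w x)" .
  moreover have "continuous_on I_open w" by (rule continuous_on_subset[OF cw]) auto
  then have "continuous_version y w"
    unfolding continuous_version_def using w(2) by simp
  ultimately show ?thesis by blast
qed

end

theorem theorem1p2:
  fixes p r :: real
  assumes "2 \<le> p" and "p / 2 \<le> r" and "r \<le> p"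
  shows "(\<exists>y. minimizer p r (alpha_C p r) y \<and> continuous_on I_open y \<and> (\<forall>x\<in>I_open. 0 < y x)) \<and>
    (\<forall>c. c \<noteq> 0 \<longrightarrow> minimizer p r (alpha_C p r) (\<lambda>x. c * sin_p p (pi_p p * x))) \<and>
    (p / 2 < r \<longrightarrow>
      (\<forall>y. minimizer p r (alpha_C p r) y \<longrightarrow>
        (\<exists>w. continuous_version y w \<and>
          ((\<forall>x\<in>I_open. 0 < w x) \<or> (\<forall>x\<in>I_open. w x < 0) \<or> (\<forall>x\<in>I_open. w (- x) = - w x))))) \<and>
    (r = p \<longrightarrow> alpha_C p p = (2 powr p - 1) / 2 powr p * pi_p p powr p)"
proof -
  obtain c where c: "0 < c" "c \<le> eig_const p" "profile p r (eig_const p) (eig_const p - c) c 1 1"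
    "r = p \<longrightarrow> c = (1 - 1 / 2 powr p) * eig_const p"
    by (rule critical_constant[OF assms])
  interpret C: critical p r c
    by (rule critical.intro) (use assms c in auto)
  show ?thesis
  proof (intro conjI allI impI)
    show "\<exists>y. minimizer p r (alpha_C p r) y \<and> continuous_on I_open y \<and> (\<forall>x\<in>I_open. 0 < y x)"
      unfolding C.alpha_C_eq minimizer_def C.eigval_alpha0
      using C.bell_competitor(1-5) by blast
    show "minimizer p r (alpha_C p r) (\<lambda>x. k * sin_p p (pi_p p * x))" if "k \<noteq> 0" for k
      unfolding C.alpha_C_eq minimizer_def C.eigval_alpha0
      using C.sine_competitor[OF that] by (simp add: sine_fn_def)
    show "\<exists>w. continuous_version y w \<and>
          ((\<forall>x\<in>I_open. 0 < w x) \<or> (\<forall>x\<in>I_open. w x < 0) \<or> (\<forall>x\<in>I_open. w (- x) = - w x))"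
      if "p / 2 < r" "minimizer p r (alpha_C p r) y" for y
      using C.minimizer_shape that unfolding C.alpha_C_eq by blast
    show "alpha_C p p = (2 powr p - 1) / 2 powr p * pi_p p powr p" if "r = p"
    proof -
      \<comment> \<open>For \<open>r = p\<close> the exponent \<open>1 - p / r\<close> of
        \<open>s0\<close> vanishes, so no integral of the profile remains in \<open>alpha0\<close>
        and the explicit multiplier gives its value.\<close>
      have "r / p = 1" "p / r = 1" using that assms by auto
      then have "C.alpha0 = (p - 1) * c" unfolding C.alpha0_def using C.s0_pos by simp
      also have "\<dots> = (1 - 1 / 2 powr p) * ((p - 1) * eig_const p)" using c(4) that by simp
      also have "\<dots> = (2 powr p - 1) / 2 powr p * pi_p p powr p"
        using C.param_bounds(5) by (simp add: diff_divide_distrib)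
      finally show ?thesis using C.alpha_C_eq that by simp
    qed
  qed
qed

end
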